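(* Suppose $r_1=\bar z_1^*$. Then $$\lim_{\tilde\Delta_{\bar z_1^*}\ni z\to\bar z_1^*}\frac{G_1(\bar z_1^* )-G_1(z)}{(\bar z_1^*-z)^{1/2}}=-\tilde G_{1,1}=-\tilde\alpha_{s_0,1}^{G_1}\,N_1(\bar z_1^* )\,\boldsymbol v^{R_1}(\bar z_1^* )\,\boldsymbol u_{s_0}^{G_1}(\bar z_1^* ),$$ and this matrix is (entry-wise) nonnegative and nonzero. Here $\boldsymbol v^{R_1}(\bar z_1^* )$ is the right eigenvector of $R_1(\bar z_1^* )$ with respect to the eigenvalue $\bar\zeta_2(\bar z_1^* )^{-1}$, satisfying $\boldsymbol u_{s_0}^{G_1}(\bar z_1^* )N_1(\bar z_1^* )\boldsymbol v^{R_1}(\bar z_1^* )=1$.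
   Context: Let $\mathbb{H}=\{-1,0,1\}$, $\mathbb{H}_+=\{0,1\}$, $S_0=\{1,\dots,s_0\}$ finite. Let $A_{i,j}$ ($i,j\in\mathbb{H}$), $A^{(1)}_{i,j}$ ($i\in\mathbb{H},j\in\mathbb{H}_+$), $A^{(2)}_{i,j}$ ($i\in\mathbb{H}_+,j\in\mathbb{H}$), $A^{(0)}_{i,j}$ ($i,j\in\mathbb{H}_+$) be nonnegative $s_0\times s_0$ matrices such that each of $A_{*,*}=\sum A_{i,j}$, $\sum A^{(1)}_{i,j}$, $\sum A^{(2)}_{i,j}$, $\sum A^{(0)}_{i,j}$ is stochastic. The 2d-QBD process $\{\boldsymbol Y_n\}=\{(X_{1,n},X_{2,n},J_n)\}$ is the Markov chain on $\mathbb{Z}_+^2\times S_0$ whose transition block from $(x_1,x_2)$ to $(x_1+i,x_2+j)$ is $A_{i,j}$ if $x_1,x_2\ne0$, $A^{(1)}_{i,j}$ if $x_1\neq0,x_2=0$, $A^{(2)}_{i,j}$ if $x_1=0,x_2\ne0$, $A^{(0)}_{i,j}$ if $x_1=x_2=0$ (other blocks zero). Standing assumptions. (1) $\{\boldsymbol Y_n\}$ is irreducible and aperiodic. (2) The chains on $\mathbb{Z}^2\times S_0$ (blocks $A_{i,j}$ everywhere), on $\mathbb{Z}\times\mathbb{Z}_+\times S_0$ (blocks $A_{i,j}$ if $x_2\ne0$, $A^{(1)}_{i,j}$ if $x_2=0$) and on $\mathbb{Z}_+\times\mathbb{Z}\times S_0$ (blocks $A_{i,j}$ if $x_1\neq0$,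 $A^{(2)}_{i,j}$ if $x_1=0$) are irreducible and aperiodic. (3) The rate matrices of $\{\boldsymbol Y_n\}$ viewed as a QBD process with level $X_{1,n}$ (resp. $X_{2,n}$) and countable phase $(X_{2,n},J_n)$ (resp. $(X_{1,n},J_n)$) are irreducible. (4) Drift conditions (making $\{\boldsymbol Y_n\}$ positive recurrent). Let $A_{k,*}=\sum_lA_{k,l}$, $A_{*,k}=\sum_lA_{l,k}$, $A^{(1)}_{*,k}=\sum_lA^{(1)}_{l,k}$, $A^{(2)}_{k,*}=\sum_lA^{(2)}_{k,l}$, let $\boldsymbol\pi_{*,*}$ be the stationary distribution of $A_{*,*}$, and $a_1^{\{1,2\}}=\boldsymbol\pi_{*,*}(-A_{-1,*}+A_{1,*})\mathbf 1$, $a_2^{\{1,2\}}=\boldsymbol\pi_{*,*}(-A_{*,-1}+A_{*,1})\mathbf 1$. Let $(\boldsymbol\pi^{(1)}_{*,k})_{k\ge0}$ be the stationary distribution (existing iff $a_2^{\{1,2\}}<0$) of the block tridiagonal matrix with first block row $(A^{(1)}_{*,0},A^{(1)}_{*,1},O,\dots)$ and other rows with blocks $A_{*,-1},A_{*,0},A_{*,1}$, and $a_1^{\{1\}}=\boldsymbol\pi^{(1)}_{*,0}\sum_{j\in\mathbb{H}_+}(A^{(1)}_{1,j}-A^{(1)}_{-1,j})\mathbf 1+\sum_{k\ge1}\boldsymbol\pi^{(1)}_{*,k}(A_{1,*}-A_{-1,*})\mathbf 1$; define $a_2^{\{2\}}$ symmetrically (exchanging the two coordinates). Then: $a^{\{1,2\}}_1$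 or $a^{\{1,2\}}_2$ is negative; if both are negative, then $a^{\{1\}}_1<0$ and $a^{\{2\}}_2<0$; if $a^{\{1,2\}}_1>0,a^{\{1,2\}}_2<0$, then $a^{\{1\}}_1<0$; if $a^{\{1,2\}}_1<0,a^{\{1,2\}}_2>0$, then $a^{\{2\}}_2<0$. (5) All eigenvalues of $G_1(r_1)$ are distinct, and all eigenvalues of $G_2(r_2)$ are distinct, where $G_1,G_2,r_1,r_2$ are as below. Let $\nu_{k,l,j}$ be the stationary distribution of $\{\boldsymbol Y_n\}$; $r_1=e^{\xi_1}$, $r_2=e^{\xi_2}$ with $\xi_1=-\lim_n\frac1n\log\nu_{n,j,k}$, $\xi_2=-\lim_n\frac1n\log\nu_{i,n,k}$ (limits exist and do not depend on the other indices). $C(z,w)=\sum_{i,j}A_{i,j}z^iw^j$, $A_{*,j}(z)=\sum_{i}A_{i,j}z^i$, $A_{i,*}(w)=\sum_{j}A_{i,j}w^j$, $\chi=\mathrm{spr}(C)$ (spectral radius). $\log\underline z_i^*,\log\bar z_i^*$ are the minimum and maximum of $s_i$ over $\{(s_1,s_2)\in\mathbb{R}^2:\chi(e^{s_1},e^{s_2})\le1\}$ ($i=1,2$). For $z\in[\underline z_1^*,\bar z_1^*]$, $\underline\zeta_2(z)\le\bar\zeta_2(z)$ are the real solutions $w>0$ of $\chi(z,w)=1$ (coinciding exactly at the endpoints). For $\underline z_1^*\le|z|\le\bar z_1^*$, $N_1(z)=I+\sum_{n\ge1}\sum A_{*,i_1}(z)\cdots A_{*,i_n}(z)$ with the inner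 sum over $(i_1,\dots,i_n)\in\mathbb{H}^n$ having partial sums $\ge0$ and total sum $0$; $G_1(z)=N_1(z)A_{*,-1}(z)$, $R_1(z)=A_{*,1}(z)N_1(z)$ (for real positive $z$ these are the minimal nonnegative solutions of $A_{*,-1}(z)+A_{*,0}(z)X+A_{*,1}(z)X^2=X$ and $X^2A_{*,-1}(z)+XA_{*,0}(z)+A_{*,1}(z)=X$). $G_2$ is defined in the same way from $A_{i,*}(w)$. For $z\in[\underline z_1^*,\bar z_1^*]$, $\mathrm{spr}(G_1(z))=\underline\zeta_2(z)$ and $\mathrm{spr}(R_1(z))=\bar\zeta_2(z)^{-1}$. Spectral data when $r_1=\bar z_1^*$. Let $\alpha_1(z),\dots,\alpha_{s_0}(z)$ be the eigenvalues of $G_1(z)$, with $\alpha_{s_0}(z)=\underline\zeta_2(z)$ for $z\in[\underline z_1^*,\bar z_1^*]$, let $\boldsymbol v_j(z)$ be corresponding right eigenvectors, $V_1(z)=(\boldsymbol v_1(z)\cdots\boldsymbol v_{s_0}(z))$, and let $\boldsymbol u_j(z)$ be the $j$-th row of $V_1(z)^{-1}$ (a left eigenvector, $\boldsymbol u_j\boldsymbol v_k=\delta_{jk}$); $\boldsymbol v_{s_0}(\bar z_1^* )$ is a Perron–Frobenius (nonnegative) eigenvector. Write $\boldsymbol u^{G_1}_{s_0}=\boldsymbol u_{s_0}$, $\boldsymbol v^{G_1}_{s_0}=\boldsymbol v_{s_0}$. It is known that near $z=\bar z_1^*$, $\alpha_j,\boldsymbol v_j$ ($j<s_0$) are analytic,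 while $\alpha_{s_0}(z)=\tilde\alpha_{s_0}((\bar z_1^*-z)^{1/2})$ and $\boldsymbol v_{s_0}(z)=\tilde{\boldsymbol v}_{s_0}((\bar z_1^*-z)^{1/2})$ with $\tilde\alpha_{s_0},\tilde{\boldsymbol v}_{s_0}$ analytic near $0$; hence $G_1(z)=\tilde G_1((\bar z_1^*-z)^{1/2})$ with $\tilde G_1$ entry-wise analytic near $0$. Write Taylor series $\tilde\alpha_{s_0}(\zeta)=\sum_{k\ge0}\tilde\alpha^{G_1}_{s_0,k}\zeta^k$ and $\tilde G_1(\zeta)=\sum_{k\ge0}\tilde G_{1,k}\zeta^k$; here $\tilde\alpha^{G_1}_{s_0,1}<0$. The square root is the branch positive for real $z<\bar z_1^*$. For $r>0$, $\tilde\Delta_r(\varepsilon,\theta)=\{z\in\mathbb{C}:|z|<r+\varepsilon,\ z\ne r,\ |\arg(z-r)|>\theta\}$, and "$\tilde\Delta_r\ni z\to r$" means $z\to r$ within $\tilde\Delta_r(\varepsilon,\theta)$ for some $\varepsilon>0$ and $\theta\in[0,\pi/2)$ (with $G_1$ analytically continued there). *)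

theory Defs
  imports "HOL-Complex_Analysis.Complex_Analysis"
begin

section \<open>Nonnegative kernels on countable sets\<close>

text \<open>Possibly infinite nonnegative matrices are kernels with values in \<^typ>\<open>ennreal\<close>, so that
  products, powers and least solutions of matrix equations always exist.\<close>

definition kmult :: "('x \<Rightarrow> 'x \<Rightarrow> ennreal) \<Rightarrow> ('x \<Rightarrow> 'x \<Rightarrow> ennreal) \<Rightarrow> 'x \<Rightarrow> 'x \<Rightarrow> ennreal" where
  "kmult K L = (\<lambda>x y. \<Sum>\<^sub>\<infinity>z. K x z * L z y)"

primrec kpow :: "('x \<Rightarrow> 'x \<Rightarrow> ennreal) \<Rightarrow> nat \<Rightarrow> 'x \<Rightarrow> 'x \<Rightarrow> ennreal" where
  "kpow K 0 = (\<lambda>x y. if x = y then 1 else 0)"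
| "kpow K (Suc n) = kmult K (kpow K n)"

definition kirreducible :: "('x \<Rightarrow> 'x \<Rightarrow> ennreal) \<Rightarrow> bool" where
  "kirreducible K \<longleftrightarrow> (\<forall>x y. \<exists>n\<ge>1. 0 < kpow K n x y)"

definition kaperiodic :: "('x \<Rightarrow> 'x \<Rightarrow> ennreal) \<Rightarrow> bool" where
  "kaperiodic K \<longleftrightarrow> (\<forall>x. Gcd {n. 1 \<le> n \<and> 0 < kpow K n x x} = 1)"

definition kernel :: "('x \<Rightarrow> 'x \<Rightarrow> real) \<Rightarrow> 'x \<Rightarrow> 'x \<Rightarrow> ennreal" where
  "kernel P = (\<lambda>x y. ennreal (P x y))"

definition is_stationary :: "('x \<Rightarrow> 'x \<Rightarrow> real) \<Rightarrow> ('x \<Rightarrow> real) \<Rightarrow> bool" where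
  "is_stationary P p \<longleftrightarrow> (\<forall>x. 0 \<le> p x) \<and> (p has_sum 1) UNIV \<and>
     (\<forall>y. ((\<lambda>x. p x * P x y) has_sum p y) UNIV)"

definition stationary_dist :: "('x \<Rightarrow> 'x \<Rightarrow> real) \<Rightarrow> 'x \<Rightarrow> real" where
  "stationary_dist P = (THE p. is_stationary P p)"


section \<open>The two-dimensional QBD process\<close>

text \<open>The finite type \<open>'s\<close> is the background state space \<open>S\<^sub>0\<close>.  A family of blocks is indexed by
  pairs of integers; only its values at admissible increments are ever used.\<close>

type_synonym 's blocks = "int \<Rightarrow> int \<Rightarrow> real^'s^'s"

definition H :: "int set" where "H = {-1, 0, 1}"

definition Hp :: "int set" where "Hp = {0, 1}"

definition stochastic :: "real^('s::finite)^'s \<Rightarrow> bool" where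
  "stochastic M \<longleftrightarrow> (\<forall>a b. 0 \<le> M $ a $ b) \<and> (\<forall>a. (\<Sum>b\<in>UNIV. M $ a $ b) = 1)"

definition qbd_blocks ::
  "('s::finite) blocks \<Rightarrow> 's blocks \<Rightarrow> 's blocks \<Rightarrow> 's blocks \<Rightarrow> bool" where
  "qbd_blocks A A1 A2 A0 \<longleftrightarrow>
     (\<forall>i\<in>H. \<forall>j\<in>H. \<forall>a b. 0 \<le> A i j $ a $ b) \<and>
     (\<forall>i\<in>H. \<forall>j\<in>Hp. \<forall>a b. 0 \<le> A1 i j $ a $ b) \<and>
     (\<forall>i\<in>Hp. \<forall>j\<in>H. \<forall>a b. 0 \<le> A2 i j $ a $ b) \<and>
     (\<forall>i\<in>Hp. \<forall>j\<in>Hp. \<forall>a b. 0 \<le> A0 i j $ a $ b) \<and>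
     stochastic (\<Sum>i\<in>H. \<Sum>j\<in>H. A i j) \<and>
     stochastic (\<Sum>i\<in>H. \<Sum>j\<in>Hp. A1 i j) \<and>
     stochastic (\<Sum>i\<in>Hp. \<Sum>j\<in>H. A2 i j) \<and>
     stochastic (\<Sum>i\<in>Hp. \<Sum>j\<in>Hp. A0 i j)"

definition block :: "int set \<Rightarrow> int set \<Rightarrow> ('s::finite) blocks \<Rightarrow> 's blocks" where
  "block I J B = (\<lambda>i j. if i \<in> I \<and> j \<in> J then B i j else 0)"

definition swap :: "'s blocks \<Rightarrow> 's blocks" where
  "swap B = (\<lambda>i j. B j i)"

definition quarter_chain ::
  "('s::finite) blocks \<Rightarrow> 's blocks \<Rightarrow> 's blocks \<Rightarrow> 's blocks \<Rightarrow> nat \<times> nat \<times> 's \<Rightarrow> nat \<times> nat \<times> 's \<Rightarrow> real" where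
  "quarter_chain A A1 A2 A0 = (\<lambda>(x1, x2, a) (y1, y2, b).
     (if x1 \<noteq> 0 \<and> x2 \<noteq> 0 then block H H A
      else if x1 \<noteq> 0 then block H Hp A1
      else if x2 \<noteq> 0 then block Hp H A2
      else block Hp Hp A0) (int y1 - int x1) (int y2 - int x2) $ a $ b)"

definition plane_chain :: "('s::finite) blocks \<Rightarrow> int \<times> int \<times> 's \<Rightarrow> int \<times> int \<times> 's \<Rightarrow> real" where
  "plane_chain A = (\<lambda>(x1, x2, a) (y1, y2, b). block H H A (y1 - x1) (y2 - x2) $ a $ b)"

text \<open>The chain on \<open>\<int> \<times> \<int>\<^sub>+ \<times> S\<^sub>0\<close>.  The chain on \<open>\<int>\<^sub>+ \<times> \<int> \<times> S\<^sub>0\<close> is, after exchanging the two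
  coordinates of its states, \<open>half_plane_chain (swap A) (swap A2)\<close>.\<close>

definition half_plane_chain ::
  "('s::finite) blocks \<Rightarrow> 's blocks \<Rightarrow> int \<times> nat \<times> 's \<Rightarrow> int \<times> nat \<times> 's \<Rightarrow> real" where
  "half_plane_chain A A1 = (\<lambda>(x1, x2, a) (y1, y2, b).
     (if x2 \<noteq> 0 then block H H A else block H Hp A1) (y1 - x1) (int y2 - int x2) $ a $ b)"

definition irreducible_aperiodic :: "('x \<Rightarrow> 'x \<Rightarrow> real) \<Rightarrow> bool" where
  "irreducible_aperiodic P \<longleftrightarrow> kirreducible (kernel P) \<and> kaperiodic (kernel P)"

text \<open>The process as a QBD process with level \<open>X\<^sub>1\<close> and countable phase \<open>(X\<^sub>2, J)\<close>.  Its block for a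
  level change \<open>i \<in> {-1, 0, 1}\<close> is the same from every level \<open>\<ge> 1\<close>, and is read off at level 1.
  The rate matrix is the minimal nonnegative solution of \<open>X = X\<^sup>2 Q\<^sub>-\<^sub>1 + X Q\<^sub>0 + Q\<^sub>1\<close>.\<close>

definition level_block ::
  "('s::finite) blocks \<Rightarrow> 's blocks \<Rightarrow> 's blocks \<Rightarrow> 's blocks \<Rightarrow> int \<Rightarrow> nat \<times> 's \<Rightarrow> nat \<times> 's \<Rightarrow> ennreal" where
  "level_block A A1 A2 A0 i = (\<lambda>p q. kernel (quarter_chain A A1 A2 A0) (1, p) (nat (1 + i), q))"

definition rate_matrix ::
  "('s::finite) blocks \<Rightarrow> 's blocks \<Rightarrow> 's blocks \<Rightarrow> 's blocks \<Rightarrow> nat \<times> 's \<Rightarrow> nat \<times> 's \<Rightarrow> ennreal" where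
  "rate_matrix A A1 A2 A0 =
     (let Q = level_block A A1 A2 A0
      in lfp (\<lambda>X p q. kmult (kmult X X) (Q (-1)) p q + kmult X (Q 0) p q + Q 1 p q))"


section \<open>Drift conditions\<close>

definition mean_drift :: "('s::finite \<Rightarrow> real) \<Rightarrow> real^'s^'s \<Rightarrow> real" where
  "mean_drift p M = (\<Sum>a\<in>UNIV. p a * (M *v 1) $ a)"

definition pi_interior :: "('s::finite) blocks \<Rightarrow> 's \<Rightarrow> real" where
  "pi_interior A = stationary_dist (\<lambda>a b. (\<Sum>i\<in>H. \<Sum>j\<in>H. A i j) $ a $ b)"

definition drift1_interior :: "('s::finite) blocks \<Rightarrow> real" where
  "drift1_interior A = mean_drift (pi_interior A) (- (\<Sum>l\<in>H. A (-1) l) + (\<Sum>l\<in>H. A 1 l))"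

definition drift2_interior :: "('s::finite) blocks \<Rightarrow> real" where
  "drift2_interior A = mean_drift (pi_interior A) (- (\<Sum>l\<in>H. A l (-1)) + (\<Sum>l\<in>H. A l 1))"

text \<open>The block tridiagonal matrix with first block row \<open>A\<^sup>(\<^sup>1\<^sup>)\<^sub>*\<^sub>,\<^sub>0, A\<^sup>(\<^sup>1\<^sup>)\<^sub>*\<^sub>,\<^sub>1\<close> and other block rows
  \<open>A\<^sub>*\<^sub>,\<^sub>-\<^sub>1, A\<^sub>*\<^sub>,\<^sub>0, A\<^sub>*\<^sub>,\<^sub>1\<close>.\<close>

definition boundary_phase_chain ::
  "('s::finite) blocks \<Rightarrow> 's blocks \<Rightarrow> nat \<times> 's \<Rightarrow> nat \<times> 's \<Rightarrow> real" where
  "boundary_phase_chain A A1 = (\<lambda>(k, a) (l, b).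
     (\<Sum>i\<in>H. (if k \<noteq> 0 then block H H A else block H Hp A1) i (int l - int k)) $ a $ b)"

definition drift_boundary :: "('s::finite) blocks \<Rightarrow> 's blocks \<Rightarrow> real" where
  "drift_boundary A A1 =
     (let p = stationary_dist (boundary_phase_chain A A1) in
        mean_drift (\<lambda>a. p (0, a)) (\<Sum>j\<in>Hp. A1 1 j - A1 (-1) j) +
        (\<Sum>k. mean_drift (\<lambda>a. p (Suc k, a)) ((\<Sum>l\<in>H. A 1 l) - (\<Sum>l\<in>H. A (-1) l))))"

definition drift_conditions :: "('s::finite) blocks \<Rightarrow> 's blocks \<Rightarrow> 's blocks \<Rightarrow> bool" where
  "drift_conditions A A1 A2 \<longleftrightarrow>
     (let a1 = drift1_interior A; a2 = drift2_interior A;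
          b1 = drift_boundary A A1; b2 = drift_boundary (swap A) (swap A2)
      in (a1 < 0 \<or> a2 < 0) \<and>
         (a1 < 0 \<and> a2 < 0 \<longrightarrow> b1 < 0 \<and> b2 < 0) \<and>
         (0 < a1 \<and> a2 < 0 \<longrightarrow> b1 < 0) \<and>
         (a1 < 0 \<and> 0 < a2 \<longrightarrow> b2 < 0))"


section \<open>Matrix generating functions\<close>

definition eigenvalues :: "complex^('n::finite)^'n \<Rightarrow> complex set" where
  "eigenvalues M = {l. \<exists>x. x \<noteq> 0 \<and> M *v x = l *s x}"

definition spr :: "complex^('n::finite)^'n \<Rightarrow> real" where
  "spr M = Max (cmod ` eigenvalues M)"

definition distinct_eigenvalues :: "complex^('n::finite)^'n \<Rightarrow> bool" where
  "distinct_eigenvalues M \<longleftrightarrow> card (eigenvalues M) = CARD('n)"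

definition Cmat :: "('s::finite) blocks \<Rightarrow> complex \<Rightarrow> complex \<Rightarrow> complex^'s^'s" where
  "Cmat A z w = (\<chi> a b. \<Sum>i\<in>H. \<Sum>j\<in>H. complex_of_real (A i j $ a $ b) * z powi i * w powi j)"

definition Acol :: "('s::finite) blocks \<Rightarrow> complex \<Rightarrow> int \<Rightarrow> complex^'s^'s" where
  "Acol A z j = (\<chi> a b. \<Sum>i\<in>H. complex_of_real (A i j $ a $ b) * z powi i)"

definition chi :: "('s::finite) blocks \<Rightarrow> real \<Rightarrow> real \<Rightarrow> real" where
  "chi A z w = spr (Cmat A (of_real z) (of_real w))"

definition Gam :: "('s::finite) blocks \<Rightarrow> (real \<times> real) set" where
  "Gam A = {(s1, s2). chi A (exp s1) (exp s2) \<le> 1}"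

definition zlow :: "('s::finite) blocks \<Rightarrow> real" where
  "zlow A = exp (Inf (fst ` Gam A))"

definition zup :: "('s::finite) blocks \<Rightarrow> real" where
  "zup A = exp (Sup (fst ` Gam A))"

definition annulus :: "('s::finite) blocks \<Rightarrow> complex set" where
  "annulus A = {z. zlow A \<le> cmod z \<and> cmod z \<le> zup A}"

definition zeta_low :: "('s::finite) blocks \<Rightarrow> real \<Rightarrow> real" where
  "zeta_low A z = (LEAST w. 0 < w \<and> chi A z w = 1)"

definition zeta_up :: "('s::finite) blocks \<Rightarrow> real \<Rightarrow> real" where
  "zeta_up A z = (GREATEST w. 0 < w \<and> chi A z w = 1)"

definition excursions :: "nat \<Rightarrow> int list set" where
  "excursions n = {js. length js = n \<and> set js \<subseteq> H \<and>
     (\<forall>k\<le>n. 0 \<le> sum_list (take k js)) \<and> sum_list js = 0}"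

definition mat_prod :: "(complex^('n::finite)^'n) list \<Rightarrow> complex^'n^'n" where
  "mat_prod Ms = foldr (**) Ms (mat 1)"

definition N1 :: "('s::finite) blocks \<Rightarrow> complex \<Rightarrow> complex^'s^'s" where
  "N1 A z = mat 1 + (\<Sum>n. \<Sum>js\<in>excursions (Suc n). mat_prod (map (Acol A z) js))"

definition G1 :: "('s::finite) blocks \<Rightarrow> complex \<Rightarrow> complex^'s^'s" where
  "G1 A z = N1 A z ** Acol A z (-1)"

definition R1 :: "('s::finite) blocks \<Rightarrow> complex \<Rightarrow> complex^'s^'s" where
  "R1 A z = Acol A z 1 ** N1 A z"

definition G2 :: "('s::finite) blocks \<Rightarrow> complex \<Rightarrow> complex^'s^'s" where
  "G2 A w = G1 (swap A) w"


section \<open>Spectral data and the singular point\<close>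

definition mscale :: "complex \<Rightarrow> complex^('n::finite)^('m::finite) \<Rightarrow> complex^'n^'m" where
  "mscale c M = (\<chi> a b. c * M $ a $ b)"

definition outer :: "complex^('m::finite) \<Rightarrow> complex^('n::finite) \<Rightarrow> complex^'n^'m" where
  "outer x y = (\<chi> a b. x $ a * y $ b)"

definition row_col :: "complex^('n::finite) \<Rightarrow> complex^'n \<Rightarrow> complex" where
  "row_col x y = (\<Sum>a\<in>UNIV. x $ a * y $ a)"

definition taylor_coeff :: "(complex \<Rightarrow> complex) \<Rightarrow> nat \<Rightarrow> complex" where
  "taylor_coeff f k = (deriv ^^ k) f 0 / fact k"

definition taylor_coeff_mat :: "(complex \<Rightarrow> complex^('n::finite)^('m::finite)) \<Rightarrow> nat \<Rightarrow> complex^'n^'m" where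
  "taylor_coeff_mat F k = (\<chi> a b. taylor_coeff (\<lambda>t. F t $ a $ b) k)"

text \<open>\<open>al j\<close> and \<open>v j\<close>, \<open>j \<in> S\<^sub>0\<close>, are the eigenvalues (with multiplicity) and right eigenvectors of
  \<open>G\<^sub>1(z)\<close> on the annulus; the index \<open>m\<close> plays the role of \<open>s\<^sub>0\<close>.\<close>

definition eigen_data :: "('s::finite) blocks \<Rightarrow> 's \<Rightarrow> ('s \<Rightarrow> complex \<Rightarrow> complex) \<Rightarrow>
    ('s \<Rightarrow> complex \<Rightarrow> complex^'s) \<Rightarrow> bool" where
  "eigen_data A m al v \<longleftrightarrow>
     (\<forall>z\<in>annulus A. \<forall>x. det (mat x - G1 A z) = (\<Prod>j\<in>UNIV. x - al j z)) \<and>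
     (\<forall>z\<in>annulus A. \<forall>j. v j z \<noteq> 0 \<and> G1 A z *v v j z = al j z *s v j z) \<and>
     (\<forall>z\<in>{zlow A..zup A}. al m (of_real z) = of_real (zeta_low A z)) \<and>
     (\<forall>a. v m (of_real (zup A)) $ a \<in> \<real>\<^sub>\<ge>\<^sub>0)"

definition Vmat :: "('s::finite \<Rightarrow> complex \<Rightarrow> complex^'s) \<Rightarrow> complex \<Rightarrow> complex^'s^'s" where
  "Vmat v z = (\<chi> a j. v j z $ a)"

definition left_eigvec :: "('s::finite \<Rightarrow> complex \<Rightarrow> complex^'s) \<Rightarrow> 's \<Rightarrow> complex \<Rightarrow> complex^'s" where
  "left_eigvec v j z = matrix_inv (Vmat v z) $ j"

text \<open>The known local behaviour at \<open>z = zup A\<close>.  As \<open>G\<^sub>1\<close> is given on the annulus only, the branch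
  expansions are required there; \<^const>\<open>csqrt\<close> is the branch positive on the positive reals.  The
  values of \<open>al j\<close>, \<open>v j\<close> for \<open>j \<noteq> m\<close> off the annulus are those of their analytic extensions.\<close>

definition branch_data :: "('s::finite) blocks \<Rightarrow> 's \<Rightarrow> ('s \<Rightarrow> complex \<Rightarrow> complex) \<Rightarrow>
    ('s \<Rightarrow> complex \<Rightarrow> complex^'s) \<Rightarrow> (complex \<Rightarrow> complex) \<Rightarrow> (complex \<Rightarrow> complex^'s) \<Rightarrow>
    (complex \<Rightarrow> complex^'s^'s) \<Rightarrow> bool" where
  "branch_data A m al v alt vt Gt \<longleftrightarrow>
     (let r = complex_of_real (zup A) in
        (\<forall>j. j \<noteq> m \<longrightarrow> al j analytic_on {r} \<and> (\<forall>a. (\<lambda>z. v j z $ a) analytic_on {r})) \<and>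
        alt analytic_on {0} \<and> (\<forall>a. (\<lambda>t. vt t $ a) analytic_on {0}) \<and>
        (\<forall>a b. (\<lambda>t. Gt t $ a $ b) analytic_on {0}) \<and>
        (\<forall>\<^sub>F z in nhds r. z \<in> annulus A \<longrightarrow>
           al m z = alt (csqrt (r - z)) \<and> v m z = vt (csqrt (r - z)) \<and>
           G1 A z = Gt (csqrt (r - z))))"

definition Delta_tilde :: "real \<Rightarrow> real \<Rightarrow> real \<Rightarrow> complex set" where
  "Delta_tilde r e th = {z. cmod z < r + e \<and> z \<noteq> of_real r \<and> \<bar>Arg (z - of_real r)\<bar> > th}"

text \<open>\<open>F\<close> is an analytic continuation of \<open>G\<^sub>1\<close> to \<open>Delta_tilde (zup A) e th\<close>.  Only the part of that
  set near \<open>zup A\<close> is relevant to limits at \<open>zup A\<close>, so nothing is required elsewhere (\<open>G\<^sub>1\<close> need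
  not extend to \<open>0\<close>, for instance).\<close>

definition continues_G1 :: "('s::finite) blocks \<Rightarrow> real \<Rightarrow> real \<Rightarrow> (complex \<Rightarrow> complex^'s^'s) \<Rightarrow> bool" where
  "continues_G1 A e th F \<longleftrightarrow>
     (\<exists>d>0. let U = Delta_tilde (zup A) e th \<inter> ball (of_real (zup A)) d in
        (\<forall>a b. (\<lambda>z. F z $ a $ b) holomorphic_on U) \<and> (\<forall>z\<in>U \<inter> annulus A. F z = G1 A z))"

text \<open>Right eigenvector of \<open>R\<^sub>1(z)\<close> for the eigenvalue \<open>1 / zeta_up A z\<close>, normalised against the row
  vector \<open>u\<close> by \<open>u N\<^sub>1(z) x = 1\<close> (which forces \<open>x \<noteq> 0\<close>).\<close>

definition normalised_R1_eigvec ::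
  "('s::finite) blocks \<Rightarrow> complex^'s \<Rightarrow> real \<Rightarrow> complex^'s \<Rightarrow> bool" where
  "normalised_R1_eigvec A u z x \<longleftrightarrow>
     R1 A (of_real z) *v x = of_real (inverse (zeta_up A z)) *s x \<and>
     row_col u (N1 A (of_real z) *v x) = 1"

end

theory Submission
  imports Defs
begin

text \<open>Write \<open>r = zup A\<close>, \<open>B\<^sub>j = A\<^sub>*\<^sub>,\<^sub>j(r)\<close>, \<open>G, R, N\<close> for the values at \<open>r\<close>.  At the endpoint \<open>r\<close> the
  two roots of \<open>\<chi>(r, w) = 1\<close> coincide; call the root \<open>\<zeta>\<close>.  Differentiating
  \<open>G = B\<^sub>-\<^sub>1 + B\<^sub>0 G + B\<^sub>1 G\<^sup>2\<close> along the square-root branch (\<open>z = r - t\<^sup>2\<close> has no linear term in \<open>t\<close>)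
  gives \<open>X = R X G\<close> for \<open>X = N\<^sup>-\<^sup>1 D\<close>, where \<open>D\<close> is the first Taylor coefficient.  On the
  eigenvectors of \<open>G\<close> this reads \<open>X v\<^sub>j = \<alpha>\<^sub>j R X v\<^sub>j\<close>; since \<open>spr(G) = \<zeta>\<close> and \<open>spr(R) = 1 / \<zeta>\<close>, a nonzero
  \<open>X v\<^sub>j\<close> forces \<open>|\<alpha>\<^sub>j| = \<zeta>\<close>, and irreducibility of the plane chain then forces \<open>\<alpha>\<^sub>j = \<zeta>\<close>.  So \<open>X\<close> has rank
  one with row space spanned by \<open>u\<close> and column in the \<open>1 / \<zeta>\<close>-eigenspace of \<open>R\<close>, and its size is found from
  \<open>u D v = \<alpha>'\<close>.  Nonnegativity holds because the moduli of these eigenvectors are again eigenvectors.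

  The quadratic equation is only needed on the circle \<open>|z| = r\<close>, where the series for \<open>N\<^sub>1\<close> is dominated by
  the one at \<open>r\<close>; the circle accumulates at \<open>r\<close> inside the sector, so it also identifies the
  continuation of \<open>G\<^sub>1\<close>.\<close>

text \<open>The spectral bounds on G and R are derived from the walk itself. Let h and y be the
  positive right and left fixed vectors of C(r, \<zeta>). The function \<zeta>^(x+1) h is
  superharmonic for the walk in the second coordinate with weights \<open>B\<^sub>j\<close>.
  Bounding the weight of its first passages below 0 yields convergence of N and G h \<le> \<zeta> h;
  the time-reversed walk yields y R \<le> y / \<zeta>. Irreducibility acts as rigidity. Equality in
  a termwise inequality (AM-GM for the two roots, the triangle inequality for \<alpha>) gives a
  multiplicative relation along each transition, and a path returning to the same phase one level
  higher forces the factor to be 1. The endpoint matters because \<chi>(r, w) < 1 would allow r to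
  be enlarged. That 1 / \<zeta> is a simple eigenvalue of R, which determines the column of X, comes
  from factorising I - C(w) through R and G: such eigenvectors of R lead back to fixed vectors of
  the irreducible matrix C(r, \<zeta>).\<close>

no_notation fps_nth (infixl "$" 75)

section \<open>Irreducible nonnegative matrices\<close>

text \<open>Reachability is reflexive, so the 1-by-1 zero matrix counts as irreducible; positive
  Perron vectors exist for it too, with eigenvalue 0.\<close>

definition irreducible_mat :: "real^('n::finite)^'n \<Rightarrow> bool" where
  "irreducible_mat M \<longleftrightarrow> (\<forall>a b. 0 \<le> M $ a $ b) \<and> {(a, b). 0 < M $ a $ b}\<^sup>* = UNIV"

lemma irreducible_mat_transpose:
  assumes "irreducible_mat M"
  shows "irreducible_mat (transpose M)"
proof -
  have "{(a, b). 0 < transpose M $ a $ b} = {(a, b). 0 < M $ a $ b}\<inverse>"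
    by (auto simp: transpose_def)
  then show ?thesis
    using assms unfolding irreducible_mat_def by (auto simp: transpose_def rtrancl_converse)
qed

text \<open>At a zero entry of \<open>x\<close> the row sum of nonnegative terms is at most 0, so
  \<open>x\<close> also vanishes at every successor; irreducibility then spreads the zero
  everywhere.\<close>

lemma irreducible_mat_pos:
  assumes M: "irreducible_mat M" and x: "\<And>a. 0 \<le> x $ a" "x \<noteq> 0"
    and le: "\<And>a. (M *v x) $ a \<le> c * x $ a"
  shows "0 < x $ a"
proof (rule ccontr)
  assume "\<not> 0 < x $ a"
  then have xa: "x $ a = 0" using x(1)[of a] by simp
  have step: "x $ b = 0" if "x $ a = 0" "0 < M $ a $ b" for a b
  proof -
    have nn: "0 \<le> M $ a $ b' * x $ b'" for b'
      using M x(1) by (simp add: irreducible_mat_def)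
    have "M $ a $ b * x $ b \<le> (\<Sum>b'\<in>UNIV. M $ a $ b' * x $ b')"
      by (rule member_le_sum) (use nn in auto)
    also have "\<dots> \<le> 0" using le[of a] that by (simp add: matrix_vector_mult_def)
    finally show ?thesis using that x(1)[of b] by (simp add: mult_le_0_iff)
  qed
  have "x $ b = 0" for b
  proof -
    have "(a, b) \<in> {(a, b). 0 < M $ a $ b}\<^sup>*"
      using M by (simp add: irreducible_mat_def)
    then show ?thesis by induction (use xa step in auto)
  qed
  then show False using x(2) by (simp add: vec_eq_iff)
qed

lemma matrix_vector_mono:
  fixes M :: "real^('n::finite)^'m"
  assumes "\<And>a b. 0 \<le> M $ a $ b" "\<And>b. x $ b \<le> y $ b"
  shows "(M *v x) $ a \<le> (M *v y) $ a"
  by (simp add: matrix_vector_mult_def assms sum_mono mult_left_mono)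

lemma matrix_vector_nonneg:
  fixes M :: "real^('n::finite)^'m"
  assumes "\<And>a b. 0 \<le> M $ a $ b" "\<And>b. 0 \<le> x $ b"
  shows "0 \<le> (M *v x) $ a"
  by (simp add: matrix_vector_mult_def assms sum_nonneg)

definition prob_vecs :: "(real^('n::finite)) set" where
  "prob_vecs = {x. (\<forall>a. 0 \<le> x $ a) \<and> (\<Sum>a\<in>UNIV. x $ a) = 1}"

lemma compact_prob_vecs: "compact prob_vecs"
proof -
  have "closed prob_vecs"
    unfolding prob_vecs_def
    by (intro closed_Collect_conj closed_Collect_all closed_Collect_le closed_Collect_eq
        continuous_intros)
  moreover have "bounded (prob_vecs :: (real^'n) set)"
  proof (intro boundedI ballI)
    fix x :: "real^'n" assume "x \<in> prob_vecs"
    then have "(\<Sum>i\<in>UNIV. \<bar>x $ i\<bar>) = 1" by (simp add: prob_vecs_def)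
    then show "norm x \<le> 1" using norm_le_l1_cart[of x] by simp
  qed
  ultimately show ?thesis by (simp add: compact_eq_bounded_closed)
qed

lemma convex_prob_vecs: "convex prob_vecs"
  unfolding prob_vecs_def convex_def
  by (auto simp: sum.distrib simp flip: sum_distrib_left)

lemma prob_vecs_nonempty: "prob_vecs \<noteq> {}"
proof -
  have "(\<chi> a. 1 / real CARD('n)) \<in> (prob_vecs :: (real^'n) set)"
    by (simp add: prob_vecs_def)
  then show ?thesis by blast
qed

text \<open>Brouwer's theorem on the simplex. Normalising \<open>x + M *v x\<close> instead of
  \<open>M *v x\<close> keeps the denominator at least 1 even where \<open>M *v x\<close> vanishes;
  a fixed point is an eigenvector whose eigenvalue is the denominator minus 1.\<close>

lemma perron_right:
  assumes M: "irreducible_mat M"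
  shows "\<exists>\<mu> h. (\<forall>a. 0 < h $ a) \<and> M *v h = \<mu> *s h"
proof -
  let ?f = "\<lambda>x. (1 / (1 + (\<Sum>a\<in>UNIV. (M *v x) $ a))) *s (x + M *v x)"
  have M0: "0 \<le> M $ a $ b" for a b using M by (simp add: irreducible_mat_def)
  have den: "0 < 1 + (\<Sum>a\<in>UNIV. (M *v x) $ a)" if "x \<in> prob_vecs" for x
    using that by (intro add_pos_nonneg sum_nonneg matrix_vector_nonneg M0) (auto simp: prob_vecs_def)
  have "?f = (\<lambda>x. \<chi> a. (x $ a + (M *v x) $ a) / (1 + (\<Sum>a\<in>UNIV. (M *v x) $ a)))"
    by (simp add: fun_eq_iff vec_eq_iff add_divide_distrib)
  moreover have "continuous_on prob_vecs \<dots>"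
    using den by (intro continuous_intros continuous_on_vec_lambda matrix_vector_mult_linear_continuous_on) force
  ultimately have "continuous_on prob_vecs ?f" by (simp only:)
  moreover have "?f \<in> prob_vecs \<rightarrow> prob_vecs"
  proof
    fix x :: "real^'a" assume x: "x \<in> prob_vecs"
    have "0 \<le> ?f x $ a" for a
      using den[OF x] x by (auto simp: prob_vecs_def matrix_vector_nonneg M0)
    moreover have "(\<Sum>a\<in>UNIV. ?f x $ a) = 1"
    proof -
      have "(\<Sum>a\<in>UNIV. ?f x $ a)
          = (1 / (1 + (\<Sum>a\<in>UNIV. (M *v x) $ a))) * (\<Sum>a\<in>UNIV. x $ a + (M *v x) $ a)"
        by (simp only: sum_distrib_left vector_smult_component vector_add_component)
      then show ?thesis using den[OF x] x by (simp add: prob_vecs_def sum.distrib)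
    qed
    ultimately show "?f x \<in> prob_vecs" by (simp add: prob_vecs_def)
  qed
  ultimately obtain h where h: "h \<in> prob_vecs" "?f h = h"
    using brouwer[OF compact_prob_vecs convex_prob_vecs prob_vecs_nonempty] by blast
  define d where "d = 1 + (\<Sum>a\<in>UNIV. (M *v h) $ a)"
  have d: "0 < d" using den[OF h(1)] by (simp add: d_def)
  have *: "(M *v h) $ a = (d - 1) * h $ a" for a
  proof -
    have "(h $ a + (M *v h) $ a) / d = h $ a" using arg_cong[OF h(2), of "\<lambda>v. v $ a"]
      by (simp add: d_def add_divide_distrib)
    then show ?thesis using d by (simp add: field_simps)
  qed
  have "h \<noteq> 0" using h(1) by (auto simp: prob_vecs_def)
  then have "0 < h $ a" for a
    using h(1) * by (intro irreducible_mat_pos[OF M, of h "d - 1"]) (auto simp: prob_vecs_def)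
  moreover have "M *v h = (d - 1) *s h" by (subst vec_eq_iff) (simp only: * vector_smult_component simp_thms)
  ultimately show ?thesis by blast
qed

lemma vector_mat_sum:
  fixes M :: "real^('n::finite)^('m::finite)"
  shows "(\<Sum>a\<in>UNIV. y $ a * (M *v x) $ a) = (\<Sum>b\<in>UNIV. (y v* M) $ b * x $ b)"
  using dot_lmul_matrix[of y M x] by (simp add: inner_vec_def)

lemma sum_pos_vec:
  fixes x y :: "real^('n::finite)"
  assumes "\<And>a. 0 < y $ a" "\<And>a. 0 \<le> x $ a" "x \<noteq> 0"
  shows "0 < (\<Sum>a\<in>UNIV. y $ a * x $ a)"
proof -
  obtain a where "x $ a \<noteq> 0" using assms(3) by (auto simp: vec_eq_iff)
  then have "0 < x $ a" using assms(2)[of a] by simp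
  then show ?thesis using assms by (intro sum_pos2[of _ a]) (auto simp: less_imp_le)
qed

text \<open>The right and left eigenvalues agree because evaluating \<open>y M h\<close> in both
  ways multiplies the same positive number \<open>y h\<close>.\<close>

lemma perron:
  assumes M: "irreducible_mat M"
  shows "\<exists>\<mu> h y. (\<forall>a. 0 < h $ a) \<and> (\<forall>a. 0 < y $ a) \<and> M *v h = \<mu> *s h \<and> y v* M = \<mu> *s y"
proof -
  obtain \<mu> h where h: "\<And>a. 0 < h $ a" "M *v h = \<mu> *s h"
    using perron_right[OF M] by auto
  obtain \<nu> y where y: "\<And>a. 0 < y $ a" "y v* M = \<nu> *s y"
    using perron_right[OF irreducible_mat_transpose[OF M]] by auto
  have "\<mu> * (\<Sum>a\<in>UNIV. y $ a * h $ a) = \<nu> * (\<Sum>a\<in>UNIV. y $ a * h $ a)"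
    using vector_mat_sum[of y M h] h(2) y(2) by (simp add: sum_distrib_left algebra_simps)
  moreover have "0 < (\<Sum>a\<in>UNIV. y $ a * h $ a)" using h y by (intro sum_pos) auto
  ultimately have "\<mu> = \<nu>" by simp
  then show ?thesis using h y by blast
qed

section \<open>Complex eigenvalues\<close>

definition complex_mat :: "real^('n::finite)^('m::finite) \<Rightarrow> complex^'n^'m" where
  "complex_mat M = (\<chi> a b. complex_of_real (M $ a $ b))"

lemma complex_mat_nth [simp]: "complex_mat M $ a $ b = complex_of_real (M $ a $ b)"
  by (simp add: complex_mat_def)

lemma complex_mat_mult: "complex_mat (M ** K) = complex_mat M ** complex_mat K"
  by (simp add: vec_eq_iff matrix_matrix_mult_def)

definition modulus :: "complex^('n::finite) \<Rightarrow> real^'n" where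
  "modulus x = (\<chi> a. cmod (x $ a))"

lemma modulus_nth [simp]: "modulus x $ a = cmod (x $ a)"
  by (simp add: modulus_def)

lemma modulus_eq_0 [simp]: "modulus x = 0 \<longleftrightarrow> x = 0"
  by (simp add: vec_eq_iff)

lemma modulus_mult_le:
  fixes M :: "complex^('n::finite)^('m::finite)"
  assumes "\<And>a b. cmod (M $ a $ b) \<le> K $ a $ b"
  shows "cmod ((M *v x) $ a) \<le> (K *v modulus x) $ a"
  unfolding matrix_vector_mult_def
  by (auto intro!: sum_norm_le mult_right_mono assms simp: norm_mult)

text \<open>Pairing with the positive left vector \<open>y\<close> turns the inequality \<open>|l| |x| \<le> K |x|\<close> into an equality.\<close>

lemma modulus_eigvec:
  fixes M :: "complex^('n::finite)^'n"
  assumes dom: "\<And>a b. cmod (M $ a $ b) \<le> K $ a $ b"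
    and y: "\<And>a. 0 < y $ a" "\<And>a. (y v* K) $ a \<le> \<rho> * y $ a"
    and x: "M *v x = l *s x" "x \<noteq> 0"
  shows "cmod l \<le> \<rho>" and "cmod l = \<rho> \<Longrightarrow> K *v modulus x = \<rho> *s modulus x"
proof -
  have le: "cmod l * modulus x $ a \<le> (K *v modulus x) $ a" for a
    using modulus_mult_le[OF dom, of x a] x(1) by (simp add: norm_mult)
  have pos: "0 < (\<Sum>a\<in>UNIV. y $ a * modulus x $ a)"
    by (rule sum_pos_vec) (use y x in auto)
  have up: "(\<Sum>a\<in>UNIV. y $ a * (K *v modulus x) $ a) \<le> \<rho> * (\<Sum>a\<in>UNIV. y $ a * modulus x $ a)"
    unfolding vector_mat_sum sum_distrib_left
    by (rule sum_mono) (metis mult.assoc mult_right_mono norm_ge_zero modulus_nth y(2))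
  have lo: "cmod l * (\<Sum>a\<in>UNIV. y $ a * modulus x $ a) \<le> (\<Sum>a\<in>UNIV. y $ a * (K *v modulus x) $ a)"
    unfolding sum_distrib_left
    by (rule sum_mono) (metis le mult.left_commute mult_left_mono y(1) less_imp_le)
  show "cmod l \<le> \<rho>" using up lo pos by (meson mult_le_cancel_right_pos order_trans)
  show "K *v modulus x = \<rho> *s modulus x" if eq: "cmod l = \<rho>"
  proof -
    have "(\<Sum>a\<in>UNIV. y $ a * ((K *v modulus x) $ a - \<rho> * modulus x $ a)) \<le> 0"
      using up by (simp add: right_diff_distrib sum_subtractf sum_distrib_left mult.left_commute)
    moreover have nn: "0 \<le> y $ a * ((K *v modulus x) $ a - \<rho> * modulus x $ a)" for a
      using le[of a] eq y(1)[of a] by (intro mult_nonneg_nonneg) auto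
    ultimately have "(\<Sum>a\<in>UNIV. y $ a * ((K *v modulus x) $ a - \<rho> * modulus x $ a)) = 0"
      by (meson antisym sum_nonneg)
    then have "y $ a * ((K *v modulus x) $ a - \<rho> * modulus x $ a) = 0" for a
      using nn by (simp add: sum_nonneg_eq_0_iff)
    then show ?thesis using y(1) by (simp add: vec_eq_iff) (metis less_irrefl)
  qed
qed

lemma eigenvectors_independent:
  fixes M :: "complex^('n::finite)^'n"
  assumes "finite L" and v: "\<And>l. l \<in> L \<Longrightarrow> v l \<noteq> 0 \<and> M *v v l = l *s v l"
    and "(\<Sum>l\<in>L. c l *s v l) = 0" "l \<in> L"
  shows "c l = 0"
  using assms
proof (induction L arbitrary: c l)
  case empty
  then show ?case by simp
next
  case (insert k L)
  have "(\<Sum>l\<in>L. (c l * (l - k)) *s v l) = M *v (\<Sum>l\<in>insert k L. c l *s v l) - k *s (\<Sum>l\<in>insert k L. c l *s v l)"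
  proof -
    have "M *v (\<Sum>l\<in>insert k L. c l *s v l) = (\<Sum>l\<in>insert k L. (c l * l) *s v l)"
      unfolding vec.sum
      by (rule sum.cong) (use insert.prems(1) in \<open>auto simp: vec.scale\<close>)
    then show ?thesis
      using insert.hyps by (simp add: vec.scale_sum_right sum_subtractf[symmetric] algebra_simps)
  qed
  then have z: "(\<Sum>l\<in>L. (c l * (l - k)) *s v l) = 0" using insert.prems by simp
  have L: "c l = 0" if "l \<in> L" for l
    using insert.IH[OF _ z that] insert.prems insert.hyps that by auto
  then have "c k *s v k = 0" using insert by simp
  then have "c k = 0" using insert.prems by auto
  then show ?case using L insert.prems by auto
qed

lemma card_eigenvalues_le:
  fixes M :: "complex^('n::finite)^'n"
  assumes L: "finite L" "L \<subseteq> eigenvalues M"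
  shows "card L \<le> CARD('n)"
proof -
  have "\<forall>l\<in>L. \<exists>x. x \<noteq> 0 \<and> M *v x = l *s x"
    using L(2) by (auto simp: eigenvalues_def)
  then obtain v where v: "\<And>l. l \<in> L \<Longrightarrow> v l \<noteq> 0 \<and> M *v v l = l *s v l" by metis
  have inj: "inj_on v L"
    by (rule inj_onI) (metis v vector_mul_rcancel)
  have "vec.independent (v ` L)"
  proof (rule vec.independent_if_scalars_zero)
    show "finite (v ` L)" using L by simp
    fix f x assume s: "(\<Sum>x\<in>v ` L. f x *s x) = 0" and "x \<in> v ` L"
    then obtain l where l: "l \<in> L" "x = v l" by blast
    have "(\<Sum>l\<in>L. f (v l) *s v l) = 0" using s by (simp add: sum.reindex[OF inj])
    then show "f x = 0"
      using eigenvectors_independent[OF L(1) v, of "\<lambda>l. f (v l)" l] l by auto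
  qed
  then have "card (v ` L) \<le> vec.dim (UNIV :: (complex^'n) set)"
    by (intro vec.independent_card_le_dim) auto
  then show ?thesis by (simp add: card_image[OF inj] card_cart_basis)
qed

text \<open>Needed because \<open>spr\<close> is a \<open>Max\<close>, which is meaningful only over
  a finite set.\<close>

lemma finite_eigenvalues: "finite (eigenvalues M)"
  by (rule finite_if_finite_subsets_card_bdd[of _ "CARD('a)", THEN conjunct1])
     (use card_eigenvalues_le in blast)

text \<open>The Perron root is an eigenvalue, and the left Perron vector bounds the modulus of every
  other one. This turns statements about \<open>chi\<close> into statements about positive
  vectors.\<close>

lemma spr_complex_mat:
  assumes M: "irreducible_mat M"
  shows "\<exists>h y. (\<forall>a. 0 < h $ a) \<and> (\<forall>a. 0 < y $ a) \<and>
    M *v h = spr (complex_mat M) *s h \<and> y v* M = spr (complex_mat M) *s y"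
proof -
  obtain \<mu> h y where h: "\<And>a. 0 < h $ a" "M *v h = \<mu> *s h"
    and y: "\<And>a. 0 < y $ a" "y v* M = \<mu> *s y"
    using perron[OF M] by auto
  have M0: "0 \<le> M $ a $ b" for a b using M by (simp add: irreducible_mat_def)
  have "0 \<le> \<mu> * h $ undefined"
    using matrix_vector_nonneg[OF M0, of h] h(1) by (metis h(2) less_imp_le vector_smult_component)
  then have \<mu>: "0 \<le> \<mu>" using h(1)[of undefined] by (simp add: zero_le_mult_iff)
  have "complex_of_real \<mu> \<in> eigenvalues (complex_mat M)"
  proof -
    let ?h = "\<chi> a. complex_of_real (h $ a)"
    have "complex_mat M *v ?h = complex_of_real \<mu> *s ?h"
      using h(2) by (simp add: vec_eq_iff matrix_vector_mult_def flip: of_real_mult of_real_sum)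
    moreover have "?h \<noteq> 0" using h(1)[of undefined] by (auto simp: vec_eq_iff intro!: exI[of _ undefined])
    ultimately show ?thesis by (auto simp: eigenvalues_def)
  qed
  moreover have "cmod l \<le> \<mu>" if l: "l \<in> eigenvalues (complex_mat M)" for l
  proof -
    obtain x where "x \<noteq> 0" "complex_mat M *v x = l *s x" using l by (auto simp: eigenvalues_def)
    then show ?thesis
      using modulus_eigvec(1)[of "complex_mat M" M y \<mu> x l] M0 y by auto
  qed
  ultimately have "spr (complex_mat M) = \<mu>"
    unfolding spr_def using \<mu> by (intro Max_eqI) (force simp: finite_eigenvalues)+
  then show ?thesis using h y by blast
qed

text \<open>Pairing \<open>M x \<le> x\<close> with the left Perron vector \<open>y\<close> compares
  \<open>spr\<close> times \<open>y x\<close> with \<open>y x\<close>; as \<open>y\<close> is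
  strictly positive, one strict entry makes the comparison strict.\<close>

lemma spr_le_1:
  assumes M: "irreducible_mat M" and x: "\<And>a. 0 \<le> x $ a" "x \<noteq> 0" "\<And>a. (M *v x) $ a \<le> x $ a"
  shows "spr (complex_mat M) \<le> 1" and "M *v x \<noteq> x \<Longrightarrow> spr (complex_mat M) < 1"
proof -
  let ?s = "spr (complex_mat M)"
  obtain y where y: "\<And>a. 0 < y $ a" "y v* M = ?s *s y" using spr_complex_mat[OF M] by auto
  have eq: "(\<Sum>a\<in>UNIV. y $ a * (M *v x) $ a) = ?s * (\<Sum>a\<in>UNIV. y $ a * x $ a)"
    by (simp add: vector_mat_sum y sum_distrib_left mult.assoc)
  have pos: "0 < (\<Sum>a\<in>UNIV. y $ a * x $ a)" using sum_pos_vec[of y x] y x by simp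
  have "(\<Sum>a\<in>UNIV. y $ a * (M *v x) $ a) \<le> (\<Sum>a\<in>UNIV. y $ a * x $ a)"
    by (intro sum_mono mult_left_mono) (use x y in \<open>auto simp: less_imp_le\<close>)
  then show "?s \<le> 1" using eq pos by simp
  show "?s < 1" if "M *v x \<noteq> x"
  proof -
    have "0 < (\<Sum>a\<in>UNIV. y $ a * (x - M *v x) $ a)"
      by (rule sum_pos_vec) (use x y that in auto)
    then show ?thesis using eq pos by (simp add: right_diff_distrib sum_subtractf)
  qed
qed

lemma irreducible_mat_fixed_real:
  assumes M: "irreducible_mat M" and h: "\<And>a. 0 < h $ a" "M *v h = h" and x: "M *v x = x"
  shows "\<exists>c. x = c *s h"
proof -
  \<comment> \<open>The largest multiple of \<open>h\<close> below \<open>x\<close>: the remainder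
    \<open>w\<close> is nonnegative, fixed by \<open>M\<close> and has a zero entry, which
    irreducibility allows only for \<open>w = 0\<close>.\<close>
  define c where "c = Min (range (\<lambda>a. x $ a / h $ a))"
  define w where "w = x - c *s h"
  have "c \<le> x $ a / h $ a" for a by (simp add: c_def)
  then have w0: "0 \<le> w $ a" for a
    using pos_le_divide_eq[OF h(1)[of a], of c "x $ a"] by (simp add: w_def)
  have "c \<in> range (\<lambda>a. x $ a / h $ a)" unfolding c_def by (rule Min_in) auto
  then obtain a where "c = x $ a / h $ a" by blast
  then have a: "w $ a = 0" using h(1)[of a] by (simp add: w_def)
  have "M *v w = w" by (simp add: w_def matrix_vector_mult_diff_distrib vec.scale h x)
  then have "w = 0" using irreducible_mat_pos[OF M w0, of 1 a] a by auto
  then have "x = c *s h" by (simp add: w_def)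
  then show ?thesis ..
qed

lemma irreducible_mat_fixed:
  assumes M: "irreducible_mat M" and h: "\<And>a. 0 < h $ a" "M *v h = h"
    and x: "complex_mat M *v x = x"
  shows "\<exists>c. \<forall>a. x $ a = c * complex_of_real (h $ a)"
proof -
  have "M *v (\<chi> a. Re (x $ a)) = (\<chi> a. Re (x $ a))" "M *v (\<chi> a. Im (x $ a)) = (\<chi> a. Im (x $ a))"
    using x by (simp_all add: vec_eq_iff matrix_vector_mult_def complex_eq_iff)
  then obtain c d where "(\<chi> a. Re (x $ a)) = c *s h" "(\<chi> a. Im (x $ a)) = d *s h"
    using irreducible_mat_fixed_real[OF M h] by presburger
  then have "x $ a = Complex c d * complex_of_real (h $ a)" for a
    by (simp add: vec_eq_iff complex_eq_iff)
  then show ?thesis by blast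
qed

section \<open>Walks on the nonnegative integers with matrix weights\<close>

text \<open>\<open>walk B n x y\<close> is the total weight of the paths of length \<open>n\<close> from \<open>x\<close> to \<open>y\<close> that never become
  negative, a step \<open>j\<close> having the weight \<open>B j\<close>.\<close>

primrec walk :: "(int \<Rightarrow> 'a::semiring_1^('s::finite)^'s) \<Rightarrow> nat \<Rightarrow> int \<Rightarrow> int \<Rightarrow> 'a^'s^'s" where
  "walk B 0 x y = (if x = y \<and> 0 \<le> x then mat 1 else 0)"
| "walk B (Suc n) x y = (if 0 \<le> x then \<Sum>j\<in>H. B j ** walk B n (x + j) y else 0)"

lemma finite_H [simp]: "finite H"
  by (simp add: H_def)

lemma sum_H: "(\<Sum>j\<in>H. f j) = f (-1) + f 0 + f (1::int)" for f :: "int \<Rightarrow> 'a::comm_monoid_add"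
  by (simp add: H_def add.assoc)

lemma walk_neg_left [simp]: "x < 0 \<Longrightarrow> walk B n x y = 0"
  by (cases n) auto

lemma matrix_mult_0_left [simp]: "0 ** (M :: 'a::semiring_1^_^_) = 0"
  by (simp add: vec_eq_iff matrix_matrix_mult_def)

lemma matrix_mult_0_right [simp]: "(M :: 'a::semiring_1^_^_) ** 0 = 0"
  by (simp add: vec_eq_iff matrix_matrix_mult_def)

lemma matrix_mult_sum_right: "M ** (\<Sum>i\<in>I. f i) = (\<Sum>i\<in>I. M ** f i)"
  for M :: "'a::semiring_1^_^_"
  by (induction I rule: infinite_finite_induct) (auto simp: matrix_add_ldistrib)

lemma matrix_mult_sum_left: "(\<Sum>i\<in>I. f i) ** M = (\<Sum>i\<in>I. f i ** M)"
  for M :: "'a::semiring_1^_^_"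
  by (induction I rule: infinite_finite_induct)
     (auto simp: vec_eq_iff matrix_matrix_mult_def sum.distrib distrib_right)

lemma walk_neg_right [simp]: "y < 0 \<Longrightarrow> walk B n x y = 0"
  by (induction n arbitrary: x) auto

lemma walk_Suc_right:
  "walk B (Suc n) x y = (if 0 \<le> y then \<Sum>j\<in>H. walk B n x (y - j) ** B j else 0)"
proof (induction n arbitrary: x)
  case 0
  then show ?case by (auto simp: sum_H)
next
  case (Suc n)
  show ?case
  proof (cases "0 \<le> x \<and> 0 \<le> y")
    case True
    then have "walk B (Suc (Suc n)) x y = (\<Sum>i\<in>H. B i ** walk B (Suc n) (x + i) y)" by simp
    also have "\<dots> = (\<Sum>i\<in>H. B i ** (\<Sum>j\<in>H. walk B n (x + i) (y - j) ** B j))"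
      using True by (simp only: Suc.IH) simp
    also have "\<dots> = (\<Sum>i\<in>H. \<Sum>j\<in>H. B i ** walk B n (x + i) (y - j) ** B j)"
      by (simp add: matrix_mult_sum_right matrix_mul_assoc)
    also have "\<dots> = (\<Sum>j\<in>H. (\<Sum>i\<in>H. B i ** walk B n (x + i) (y - j)) ** B j)"
      by (subst sum.swap) (simp add: matrix_mult_sum_left)
    also have "\<dots> = (\<Sum>j\<in>H. walk B (Suc n) x (y - j) ** B j)"
      using True by simp
    finally show ?thesis using True by simp
  next
    case False
    then show ?thesis by (cases "0 \<le> y") (auto simp del: walk.simps)
  qed
qed

text \<open>Time reversal: read backwards, a path has opposite steps and transposed weights. It
  carries bounds on first descents over to \<open>R\<close>.\<close>

lemma walk_reverse:
  fixes B :: "int \<Rightarrow> 'a::comm_semiring_1^('s::finite)^'s"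
  shows "walk (\<lambda>j. transpose (B (- j))) n x y = transpose (walk B n y x)"
proof (induction n arbitrary: x y)
  case 0
  then show ?case by (auto simp: transpose_def vec_eq_iff mat_def)
next
  case (Suc n)
  have tr0: "transpose (0 :: 'a^'s^'s) = 0" and tr_add: "transpose (M + K) = transpose M + transpose K"
    for M K :: "'a^'s^'s"
    by (simp_all add: transpose_def vec_eq_iff)
  show ?case
    unfolding walk_Suc_right[of B n y x]
    by (simp add: Suc.IH sum_H tr0 tr_add matrix_transpose_mul add_ac)
qed

text \<open>A path from \<open>x + 1\<close> to \<open>0\<close> splits at its first visit to \<open>0\<close>.\<close>

lemma walk_first_passage:
  assumes "0 \<le> x"
  shows "walk B n (x + 1) 0 = (\<Sum>i<n. walk B i x 0 ** B (-1) ** walk B (n - 1 - i) 0 0)"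
  using assms
proof (induction n arbitrary: x)
  case 0
  then show ?case by simp
next
  case (Suc n)
  \<comment> \<open>The extra term is the case \<open>x = 0\<close>, \<open>j = -1\<close>, outside
    the induction hypothesis: the first step already reaches 0, and an arbitrary excursion
    remains.\<close>
  have IH: "walk B n (x + j + 1) 0 = (\<Sum>i<n. walk B i (x + j) 0 ** B (-1) ** walk B (n - 1 - i) 0 0)
      + (if x + j = -1 then walk B n 0 0 else 0)" if "j \<in> H" for j
  proof (cases "x + j < 0")
    case True
    then have "x + j = -1" using that Suc.prems by (auto simp: H_def)
    then show ?thesis by simp
  qed (use Suc.IH[of "x + j"] in auto)
  have "walk B (Suc n) (x + 1) 0 = (\<Sum>j\<in>H. B j ** walk B n (x + j + 1) 0)"
    using Suc.prems by (simp add: add_ac)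
  also have "\<dots> = (\<Sum>j\<in>H. B j ** (\<Sum>i<n. walk B i (x + j) 0 ** B (-1) ** walk B (n - 1 - i) 0 0))
      + (\<Sum>j\<in>H. if x + j = -1 then B j ** walk B n 0 0 else 0)"
    unfolding sum.distrib[symmetric] by (rule sum.cong) (auto simp: IH matrix_add_ldistrib)
  also have "(\<Sum>j\<in>H. if x + j = -1 then B j ** walk B n 0 0 else 0)
      = walk B 0 x 0 ** B (-1) ** walk B n 0 0"
    using Suc.prems by (auto simp: sum_H)
  also have "(\<Sum>j\<in>H. B j ** (\<Sum>i<n. walk B i (x + j) 0 ** B (-1) ** walk B (n - 1 - i) 0 0))
      = (\<Sum>i<n. (\<Sum>j\<in>H. B j ** walk B i (x + j) 0) ** B (-1) ** walk B (n - 1 - i) 0 0)"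
    by (simp add: matrix_mult_sum_right matrix_mult_sum_left matrix_mul_assoc sum.swap[of _ H])
  also have "\<dots> = (\<Sum>i<n. walk B (Suc i) x 0 ** B (-1) ** walk B (n - 1 - i) 0 0)"
    using Suc.prems by simp
  finally show ?case
    by (simp only: sum.lessThan_Suc_shift) (simp add: add.commute del: walk.simps)
qed

text \<open>The starting height is general because cutting off the first step \<open>j\<close>
  leaves a path from \<open>x + j\<close>.\<close>

lemma walk_excursions_from:
  "(\<Sum>js | length js = n \<and> set js \<subseteq> H \<and> (\<forall>k\<le>n. 0 \<le> x + sum_list (take k js)) \<and> x + sum_list js = 0.
     mat_prod (map B js)) = walk B n x 0"
proof (induction n arbitrary: x)
  case 0
  have "{js::int list. length js = 0 \<and> set js \<subseteq> H \<and> (\<forall>k\<le>0. 0 \<le> x + sum_list (take k js)) \<and> x + sum_list js = 0}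
     = (if x = 0 then {[]} else {})" by auto
  then show ?case by (simp add: mat_prod_def)
next
  case (Suc n)
  let ?X = "\<lambda>n x. {js::int list. length js = n \<and> set js \<subseteq> H \<and> (\<forall>k\<le>n. 0 \<le> x + sum_list (take k js)) \<and> x + sum_list js = 0}"
  have fin: "finite (?X n x)" for x n
    by (rule finite_subset[OF _ finite_lists_length_eq[OF finite_H, of n]]) auto
  show ?case
  proof (cases "0 \<le> x")
    case True
    have "?X (Suc n) x = (\<Union>j\<in>H. (#) j ` ?X n (x + j))"
    proof (intro set_eqI iffI)
      fix js assume "js \<in> ?X (Suc n) x"
      then have js: "length js = Suc n" "set js \<subseteq> H" "x + sum_list js = 0"
        and pos: "\<And>k. k \<le> Suc n \<Longrightarrow> 0 \<le> x + sum_list (take k js)" by auto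
      obtain j ks where eq: "js = j # ks" using js(1) by (cases js) auto
      have "0 \<le> x + j + sum_list (take k ks)" if "k \<le> n" for k
        using pos[of "Suc k"] that by (simp add: eq add.assoc)
      then show "js \<in> (\<Union>j\<in>H. (#) j ` ?X n (x + j))" using js by (auto simp: eq add.assoc)
    next
      fix js assume "js \<in> (\<Union>j\<in>H. (#) j ` ?X n (x + j))"
      then obtain j ks where eq: "js = j # ks" "j \<in> H" "length ks = n" "set ks \<subseteq> H" "x + j + sum_list ks = 0"
        "\<And>k. k \<le> n \<Longrightarrow> 0 \<le> x + j + sum_list (take k ks)" by auto
      have "0 \<le> x + sum_list (take k js)" if "k \<le> Suc n" for k
        using True eq(6)[of "k - 1"] that by (cases k) (auto simp: eq(1) add.assoc)
      then show "js \<in> ?X (Suc n) x" using eq by (auto simp: add.assoc)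
    qed
    then have "(\<Sum>js\<in>?X (Suc n) x. mat_prod (map B js))
        = (\<Sum>j\<in>H. \<Sum>js\<in>(#) j ` ?X n (x + j). mat_prod (map B js))"
      using fin by (simp only:) (subst sum.UNION_disjoint; auto)
    also have "\<dots> = (\<Sum>j\<in>H. B j ** (\<Sum>js\<in>?X n (x + j). mat_prod (map B js)))"
      by (simp add: sum.reindex matrix_mult_sum_right mat_prod_def)
    finally show ?thesis using True by (simp only: Suc.IH walk.simps if_True)
  next
    case False
    then have "?X (Suc n) x = {}" by fastforce
    then show ?thesis using False by (simp only: sum.empty) simp
  qed
qed

lemma walk_excursions: "(\<Sum>js\<in>excursions n. mat_prod (map B js)) = walk B n 0 0"
  using walk_excursions_from[where x = 0 and B = B and n = n] by (simp add: excursions_def)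

lemma walk_nonneg:
  fixes B :: "int \<Rightarrow> real^('s::finite)^'s"
  assumes "\<And>j a b. j \<in> H \<Longrightarrow> 0 \<le> B j $ a $ b"
  shows "0 \<le> walk B n x y $ a $ b"
proof (induction n arbitrary: x a b)
  case 0
  then show ?case by (simp add: mat_def)
next
  case (Suc n)
  then show ?case using assms by (simp add: matrix_matrix_mult_def sum_nonneg)
qed

lemma norm_walk_le:
  fixes B :: "int \<Rightarrow> complex^('s::finite)^'s"
  assumes dom: "\<And>j a b. j \<in> H \<Longrightarrow> cmod (B j $ a $ b) \<le> K j $ a $ b"
  shows "cmod (walk B n x y $ a $ b) \<le> walk K n x y $ a $ b"
proof (induction n arbitrary: x a b)
  case 0
  then show ?case by (simp add: mat_def)
next
  case (Suc n)
  have "cmod ((B j ** walk B n (x + j) y) $ a $ b) \<le> (K j ** walk K n (x + j) y) $ a $ b"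
    if "j \<in> H" for j
    unfolding matrix_matrix_mult_def
    using dom[OF that] Suc.IH order_trans[OF norm_ge_zero dom[OF that]]
    by (auto intro!: sum_norm_le mult_mono simp: norm_mult)
  then show ?case by (auto intro: sum_norm_le)
qed

lemma complex_mat_walk: "complex_mat (walk B n x y) = walk (\<lambda>j. complex_mat (B j)) n x y"
proof (induction n arbitrary: x)
  case 0
  then show ?case by (simp add: vec_eq_iff mat_def)
next
  case (Suc n)
  have "complex_mat (\<Sum>j\<in>H. f j) = (\<Sum>j\<in>H. complex_mat (f j))" for f :: "int \<Rightarrow> real^'a^'a"
    by (simp add: vec_eq_iff)
  moreover have "complex_mat (0 :: real^'a^'a) = 0" by (simp add: vec_eq_iff)
  ultimately show ?case by (simp add: complex_mat_mult Suc.IH)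
qed

text \<open>Concatenation yields only those paths that are at 0 after \<open>n\<close> steps, hence
  an inequality.\<close>

lemma walk_supermult:
  fixes B :: "int \<Rightarrow> real^('s::finite)^'s"
  assumes B: "\<And>j a b. j \<in> H \<Longrightarrow> 0 \<le> B j $ a $ b"
  shows "(walk B n x 0 ** walk B k 0 0) $ a $ b \<le> walk B (n + k) x 0 $ a $ b"
proof (induction n arbitrary: x a b)
  case 0
  show ?case using walk_nonneg[OF B] by auto
next
  case (Suc n)
  have "(B j ** walk B n (x + j) 0 ** walk B k 0 0) $ a $ b \<le> (B j ** walk B (n + k) (x + j) 0) $ a $ b"
    if "j \<in> H" for j
    unfolding matrix_mul_assoc[symmetric]
    using B[OF that] Suc.IH by (auto simp: matrix_matrix_mult_def[of "B j"] intro!: sum_mono mult_left_mono)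
  then show ?case by (auto simp: matrix_mult_sum_left intro: sum_mono)
qed

text \<open>The vectors \<open>w\<^bsup>x+1\<^esup> h\<close> form a superharmonic function of the walk.\<close>

lemma walk_passage_bound:
  fixes B :: "int \<Rightarrow> real^('s::finite)^'s"
  assumes B: "\<And>j a b. j \<in> H \<Longrightarrow> 0 \<le> B j $ a $ b" and w: "0 < w"
    and h: "\<And>a. 0 \<le> h $ a" "\<And>a. (\<Sum>j\<in>H. w powi j * (B j *v h) $ a) \<le> h $ a"
    and x: "0 \<le> x"
  shows "(\<Sum>n<k. (walk B n x 0 *v (B (-1) *v h)) $ a) \<le> w powi (x + 1) * h $ a"
  using x
proof (induction k arbitrary: x a)
  case 0
  then show ?case using h(1)[of a] w by simp
next
  case (Suc k)
  let ?b = "B (-1) *v h"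
  define S where "S x = (\<chi> a. \<Sum>n<k. (walk B n x 0 *v ?b) $ a)" for x
  have S_le: "S y $ a \<le> (w powi (y + 1) *s h) $ a" if "0 \<le> y" for y a
    using Suc.IH[OF that] by (simp add: S_def)
  have b0: "0 \<le> ?b $ a" for a
    by (rule matrix_vector_nonneg) (use B h in \<open>auto simp: H_def\<close>)
  have S_eq: "S x = (\<Sum>n<k. walk B n x 0 *v ?b)" for x by (simp add: S_def vec_eq_iff)
  have mv_sum: "(\<Sum>i\<in>I. f i) *v v = (\<Sum>i\<in>I. f i *v v)" for I :: "int set" and f and v :: "real^'s"
    by (induction I rule: infinite_finite_induct) (auto simp: matrix_vector_mult_add_rdistrib)
  have step: "walk B (Suc n) x 0 *v ?b = (\<Sum>j\<in>H. B j *v (walk B n (x + j) 0 *v ?b))" for n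
    using Suc.prems by (simp add: mv_sum flip: matrix_vector_mul_assoc)
  have "(\<Sum>n<Suc k. walk B n x 0 *v ?b) = walk B 0 x 0 *v ?b + (\<Sum>n<k. walk B (Suc n) x 0 *v ?b)"
    by (rule sum.lessThan_Suc_shift)
  also have "(\<Sum>n<k. walk B (Suc n) x 0 *v ?b) = (\<Sum>j\<in>H. B j *v S (x + j))"
    by (simp only: step S_eq vec.sum) (rule sum.swap)
  finally have eq: "(\<Sum>n<Suc k. (walk B n x 0 *v ?b) $ a)
      = (walk B 0 x 0 *v ?b) $ a + (\<Sum>j\<in>H. (B j *v S (x + j)) $ a)"
    by (simp only: sum_component[symmetric] vector_add_component[symmetric])
  have Bj: "(B j *v S (x + j)) $ a \<le> w powi (x + 1) * (w powi j * (B j *v h) $ a)"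
    if "j \<in> H" "0 \<le> x + j" for j
  proof -
    have "(B j *v S (x + j)) $ a \<le> (B j *v (w powi (x + j + 1) *s h)) $ a"
      by (rule matrix_vector_mono) (use B S_le that in auto)
    also have "\<dots> = w powi (x + 1) * (w powi j * (B j *v h) $ a)"
      using w by (simp add: vec.scale power_int_add)
    finally show ?thesis .
  qed
  have "(walk B 0 x 0 *v ?b) $ a + (\<Sum>j\<in>H. (B j *v S (x + j)) $ a)
      \<le> (\<Sum>j\<in>H. w powi (x + 1) * (w powi j * (B j *v h) $ a))"
  \<comment> \<open>From height 0 the step -1 ends the walk. Its share of the superharmonic
    inequality, \<open>w * inverse w = 1\<close> times \<open>B (-1) *v h\<close>, is exactly the
    term for the path of length 0.\<close>
  proof (cases "x = 0")
    case True
    then have "S (x - 1) = 0" by (simp add: S_eq)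
    then show ?thesis using True Bj[of 0] Bj[of 1] w
      by (simp add: sum_H H_def power_int_minus flip: mult.assoc)
  next
    case False
    have "(\<Sum>j\<in>H. (B j *v S (x + j)) $ a) \<le> (\<Sum>j\<in>H. w powi (x + 1) * (w powi j * (B j *v h) $ a))"
      by (rule sum_mono, rule Bj) (use False Suc.prems in \<open>auto simp: H_def\<close>)
    then show ?thesis using False by simp
  qed
  also have "\<dots> \<le> w powi (x + 1) * h $ a"
    unfolding sum_distrib_left[symmetric] by (rule mult_left_mono[OF h(2)]) (use w in simp)
  finally show ?case using eq by simp
qed

section \<open>The Green matrix of excursions\<close>

definition green :: "(int \<Rightarrow> 'a::{real_normed_field,banach}^('s::finite)^'s) \<Rightarrow> 'a^'s^'s" where
  "green B = (\<chi> a b. \<Sum>n. walk B n 0 0 $ a $ b)"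

text \<open>Absolute convergence, as the Cauchy product in \<open>walk_one_sums\<close> requires; it
  also passes to complex weights dominated by real ones.\<close>

definition walk_summable :: "(int \<Rightarrow> 'a::{real_normed_field,banach}^('s::finite)^'s) \<Rightarrow> bool" where
  "walk_summable B \<longleftrightarrow> (\<forall>a b. summable (\<lambda>n. norm (walk B n 0 0 $ a $ b)))"

lemma mat_sums_iff:
  fixes f :: "nat \<Rightarrow> 'a::real_normed_vector^('n::finite)^('m::finite)"
  shows "f sums S \<longleftrightarrow> (\<forall>a b. (\<lambda>n. f n $ a $ b) sums (S $ a $ b))"
proof
  assume "f sums S"
  then show "\<forall>a b. (\<lambda>n. f n $ a $ b) sums (S $ a $ b)"
    unfolding sums_def by (auto simp flip: sum_component intro!: tendsto_vec_nth)
next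
  assume "\<forall>a b. (\<lambda>n. f n $ a $ b) sums (S $ a $ b)"
  then show "f sums S"
    unfolding sums_def by (intro vec_tendstoI) simp
qed

lemma mat_sums_mult_left:
  fixes f :: "nat \<Rightarrow> 'a::real_normed_field^('n::finite)^('m::finite)"
  assumes "f sums S"
  shows "(\<lambda>n. M ** f n) sums (M ** S)"
  using assms unfolding mat_sums_iff matrix_matrix_mult_def by (auto intro!: sums_sum sums_mult)

lemma mat_sums_mult_right:
  fixes f :: "nat \<Rightarrow> 'a::real_normed_field^('n::finite)^('m::finite)"
  assumes "f sums S"
  shows "(\<lambda>n. f n ** M) sums (S ** M)"
  using assms unfolding mat_sums_iff matrix_matrix_mult_def by (auto intro!: sums_sum sums_mult2)

lemma walk_summable_entry:
  assumes "walk_summable B"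
  shows "summable (\<lambda>n. walk B n 0 0 $ a $ b)"
  by (rule summable_norm_cancel) (use assms in \<open>simp add: walk_summable_def\<close>)

lemma green_sums:
  assumes "walk_summable B"
  shows "(\<lambda>n. walk B n 0 0) sums green B"
  unfolding mat_sums_iff using summable_sums[OF walk_summable_entry[OF assms]] by (simp add: green_def)

text \<open>A path from 1 to 0 is an excursion above 1, a step -1 and an excursion above 0, so the
  series is a Cauchy product; the step -1 accounts for the shift to \<open>Suc n\<close>.\<close>

lemma walk_one_sums:
  fixes B :: "int \<Rightarrow> 'a::{real_normed_field,banach}^('s::finite)^'s"
  assumes B: "walk_summable B"
  shows "(\<lambda>n. walk B n 1 0) sums (green B ** B (-1) ** green B)"
proof -
  let ?E = "\<lambda>n. walk B n 0 0"
  let ?p = "\<lambda>i. ?E i ** B (-1)"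
  have sE: "summable (\<lambda>n. norm (?E n $ a $ b))" for a b
    using B by (simp add: walk_summable_def)
  have sp: "summable (\<lambda>n. norm (?p n $ a $ b))" for a b
  proof (rule summable_comparison_test')
    show "summable (\<lambda>n. \<Sum>c\<in>UNIV. norm (?E n $ a $ c) * norm (B (-1) $ c $ b))"
      by (intro summable_sum summable_mult2 sE)
    show "norm (norm (?p n $ a $ b)) \<le> (\<Sum>c\<in>UNIV. norm (?E n $ a $ c) * norm (B (-1) $ c $ b))" if "n \<ge> 0" for n
      by (auto simp: matrix_matrix_mult_def norm_mult intro: sum_norm_le)
  qed
  have p_suminf: "(\<Sum>n. ?p n $ a $ b) = (green B ** B (-1)) $ a $ b" for a b
    using mat_sums_mult_right[OF green_sums[OF B], of "B (-1)"] unfolding mat_sums_iff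
    by (auto intro: sums_unique[symmetric])
  have "(\<lambda>n. walk B (Suc n) 1 0 $ a $ b) sums ((green B ** B (-1) ** green B) $ a $ b)" for a b
  proof -
    have "(\<lambda>n. \<Sum>i\<le>n. ?p i $ a $ d * ?E (n - i) $ d $ b) sums
        ((green B ** B (-1)) $ a $ d * green B $ d $ b)" for d
      using Cauchy_product_sums[OF sp sE, of a d d b] by (simp add: p_suminf) (simp add: green_def)
    then have "(\<lambda>n. \<Sum>d\<in>UNIV. \<Sum>i\<le>n. ?p i $ a $ d * ?E (n - i) $ d $ b) sums
        (\<Sum>d\<in>UNIV. (green B ** B (-1)) $ a $ d * green B $ d $ b)"
      by (rule sums_sum)
    moreover have "walk B (Suc n) 1 0 $ a $ b = (\<Sum>d\<in>UNIV. \<Sum>i\<le>n. ?p i $ a $ d * ?E (n - i) $ d $ b)" for n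
    proof -
      have "walk B (Suc n) 1 0 = (\<Sum>i\<le>n. ?p i ** ?E (n - i))"
        using walk_first_passage[of 0 B "Suc n"] by (simp add: lessThan_Suc_atMost del: walk.simps)
      then have "walk B (Suc n) 1 0 $ a $ b = (\<Sum>i\<le>n. \<Sum>d\<in>UNIV. ?p i $ a $ d * ?E (n - i) $ d $ b)"
        by (simp only: sum_component) (simp only: matrix_matrix_mult_def[of "?p _"] vec_lambda_beta)
      also have "\<dots> = (\<Sum>d\<in>UNIV. \<Sum>i\<le>n. ?p i $ a $ d * ?E (n - i) $ d $ b)"
        by (rule sum.swap)
      finally show ?thesis .
    qed
    ultimately show ?thesis
      by (simp only: matrix_matrix_mult_def[of "green B ** B (-1)"] vec_lambda_beta)
  qed
  then have "(\<lambda>n. walk B (Suc n) 1 0) sums (green B ** B (-1) ** green B)"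
    unfolding mat_sums_iff by blast
  from sums_Suc[OF this] have "(\<lambda>n. walk B n 1 0) sums (green B ** B (-1) ** green B + walk B 0 1 0)" .
  moreover have "walk B 0 1 0 = 0" by simp
  ultimately show ?thesis by (simp only: add_0_right)
qed

text \<open>Decomposition by the first step: none, level, or up, the last continuing with a path
  from 1 to 0.\<close>

lemma green_eq:
  fixes B :: "int \<Rightarrow> 'a::{real_normed_field,banach}^('s::finite)^'s"
  assumes B: "walk_summable B"
  shows "green B = mat 1 + B 0 ** green B + B 1 ** green B ** B (-1) ** green B"
proof -
  have "walk B (Suc n) 0 0 = B 0 ** walk B n 0 0 + B 1 ** walk B n 1 0" for n
    by (simp add: sum_H)
  moreover have "(\<lambda>n. B 0 ** walk B n 0 0 + B 1 ** walk B n 1 0) sums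
      (B 0 ** green B + B 1 ** (green B ** B (-1) ** green B))"
    by (rule sums_add[OF mat_sums_mult_left[OF green_sums[OF B]] mat_sums_mult_left[OF walk_one_sums[OF B]]])
  ultimately have "(\<lambda>n. walk B (Suc n) 0 0) sums
      (B 0 ** green B + B 1 ** (green B ** B (-1) ** green B))"
    by (simp del: walk.simps)
  from sums_Suc[OF this] have "(\<lambda>n. walk B n 0 0) sums
      (B 0 ** green B + B 1 ** (green B ** B (-1) ** green B) + mat 1)"
    by simp
  from sums_unique2[OF green_sums[OF B] this]
  have "green B = B 0 ** green B + B 1 ** (green B ** B (-1) ** green B) + mat 1" .
  also have "\<dots> = mat 1 + B 0 ** green B + B 1 ** green B ** B (-1) ** green B"
    by (simp only: matrix_mul_assoc add_ac)
  finally show ?thesis .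
qed

lemma N1_eq_green:
  assumes "walk_summable (Acol A z)"
  shows "N1 A z = green (Acol A z)"
proof -
  have "(\<lambda>n. walk (Acol A z) (Suc n) 0 0) sums (green (Acol A z) - mat 1)"
  proof (subst sums_Suc_iff)
    have "walk (Acol A z) 0 0 0 = mat 1" by simp
    then show "(\<lambda>n. walk (Acol A z) n 0 0) sums (green (Acol A z) - mat 1 + walk (Acol A z) 0 0 0)"
      using green_sums[OF assms] by (simp only: diff_add_cancel)
  qed
  then have "(\<Sum>n. walk (Acol A z) (Suc n) 0 0) = green (Acol A z) - mat 1"
    by (rule sums_unique[symmetric])
  then show ?thesis unfolding N1_def walk_excursions by (simp del: walk.simps)
qed

lemma walk_summable_dominated:
  assumes "\<And>j a b. j \<in> H \<Longrightarrow> cmod (B j $ a $ b) \<le> K j $ a $ b" and "walk_summable K"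
  shows "walk_summable B"
  unfolding walk_summable_def
proof (intro allI)
  fix a b
  show "summable (\<lambda>n. norm (walk B n 0 0 $ a $ b))"
    by (rule summable_comparison_test'[OF walk_summable_entry[OF assms(2), of a b], where N = 0])
       (simp add: norm_walk_le assms(1))
qed

lemma walk_summable_complex_mat:
  "walk_summable B \<Longrightarrow> walk_summable (\<lambda>j. complex_mat (B j))"
  by (simp add: walk_summable_def flip: complex_mat_walk)

lemma green_complex_mat:
  assumes "walk_summable B"
  shows "green (\<lambda>j. complex_mat (B j)) = complex_mat (green B)"
proof -
  have "(\<Sum>n. complex_of_real (walk B n 0 0 $ a $ b)) = complex_of_real (\<Sum>n. walk B n 0 0 $ a $ b)" for a b
    by (rule suminf_of_real[symmetric, OF walk_summable_entry[OF assms]])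
  then show ?thesis by (simp add: green_def vec_eq_iff flip: complex_mat_walk)
qed

lemma green_nonneg:
  fixes B :: "int \<Rightarrow> real^('s::finite)^'s"
  assumes "\<And>j a b. j \<in> H \<Longrightarrow> 0 \<le> B j $ a $ b" "walk_summable B"
  shows "0 \<le> green B $ a $ b"
  by (simp add: green_def suminf_nonneg walk_summable_entry walk_nonneg assms)

lemma mat_vec_sums:
  fixes f :: "nat \<Rightarrow> real^('n::finite)^('m::finite)"
  assumes "f sums S"
  shows "(\<lambda>n. (f n *v x) $ a) sums ((S *v x) $ a)"
  using assms unfolding mat_sums_iff matrix_vector_mult_def by (auto intro!: sums_sum sums_mult2)

text \<open>The bound on first passages from height 0, with the number of steps tending to infinity:
  \<open>G h\<close> is the total weight of first descents to -1, with \<open>h\<close> evaluated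
  there.\<close>

lemma green_descent_bound:
  fixes B :: "int \<Rightarrow> real^('s::finite)^'s"
  assumes B: "\<And>j a b. j \<in> H \<Longrightarrow> 0 \<le> B j $ a $ b" "walk_summable B" and w: "0 < w"
    and h: "\<And>a. 0 \<le> h $ a" "\<And>a. (\<Sum>j\<in>H. w powi j * (B j *v h) $ a) \<le> h $ a"
  shows "((green B ** B (-1)) *v h) $ a \<le> w * h $ a"
proof -
  have s: "(\<lambda>n. (walk B n 0 0 *v (B (-1) *v h)) $ a) sums (green B *v (B (-1) *v h)) $ a"
    by (rule mat_vec_sums[OF green_sums[OF B(2)]])
  have "(\<Sum>n. (walk B n 0 0 *v (B (-1) *v h)) $ a) \<le> w powi (0 + 1) * h $ a"
    by (rule suminf_le_const[OF sums_summable[OF s]])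
       (use walk_passage_bound[OF B(1) w h, of 0] in auto)
  then show ?thesis
    using sums_unique[OF s] by (simp add: matrix_vector_mul_assoc)
qed

text \<open>The descent bound after time reversal, which turns \<open>B 1\<close> into the weight of
  a descent and \<open>w\<close> into \<open>inverse w\<close>.\<close>

lemma green_ascent_bound:
  fixes B :: "int \<Rightarrow> real^('s::finite)^'s"
  assumes B: "\<And>j a b. j \<in> H \<Longrightarrow> 0 \<le> B j $ a $ b" "walk_summable B" and w: "0 < w"
    and y: "\<And>a. 0 \<le> y $ a" "\<And>a. (\<Sum>j\<in>H. w powi j * (y v* B j) $ a) \<le> y $ a"
  shows "(y v* (B 1 ** green B)) $ a \<le> inverse w * y $ a"
proof -
  let ?B = "\<lambda>j. transpose (B (- j))"
  have 1: "0 \<le> ?B j $ a $ b" if "j \<in> H" for j a b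
    using that B(1)[of "- j"] by (auto simp: transpose_def H_def)
  have 2: "walk_summable ?B"
    using B(2) by (simp add: walk_summable_def walk_reverse) (simp add: transpose_def)
  have 3: "(\<Sum>j\<in>H. inverse w powi j * (?B j *v y) $ a) \<le> y $ a" for a
    using y(2)[of a] w by (simp add: sum_H power_int_minus add_ac)
  have "green ?B = transpose (green B)"
    by (simp add: green_def walk_reverse) (simp add: transpose_def vec_eq_iff)
  then show ?thesis
    using green_descent_bound[OF 1 2 _ y(1) 3, of a] w
    by (simp flip: matrix_transpose_mul)
qed

text \<open>The total weight of first descents is bounded by \<open>w * h\<close>. Each excursion
  ending in phase \<open>b\<close> extends, after a fixed delay \<open>k\<close> and at the cost of
  a fixed factor \<open>C > 0\<close>, to a descent, so the excursion weights are summable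
  too.\<close>

lemma walk_summable_if_descends:
  fixes B :: "int \<Rightarrow> real^('s::finite)^'s"
  assumes B: "\<And>j a b. j \<in> H \<Longrightarrow> 0 \<le> B j $ a $ b" and w: "0 < w"
    and h: "\<And>a. 0 \<le> h $ a" "\<And>a. (\<Sum>j\<in>H. w powi j * (B j *v h) $ a) \<le> h $ a"
    and desc: "\<And>b. \<exists>k c. 0 < walk B k 0 0 $ b $ c \<and> 0 < (B (-1) *v h) $ c"
  shows "walk_summable B"
  unfolding walk_summable_def
proof (intro allI)
  fix a b
  let ?v = "B (-1) *v h"
  obtain k c where kc: "0 < walk B k 0 0 $ b $ c" "0 < ?v $ c" using desc by blast
  define C where "C = walk B k 0 0 $ b $ c * ?v $ c"
  have C: "0 < C" using kc by (simp add: C_def)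
  have v0: "0 \<le> ?v $ d" for d
    by (rule matrix_vector_nonneg) (use B h in \<open>auto simp: H_def\<close>)
  have bound: "walk B n 0 0 $ a $ b * C \<le> (walk B (n + k) 0 0 *v ?v) $ a" for n
  proof -
    have "walk B n 0 0 $ a $ b * walk B k 0 0 $ b $ c \<le> (walk B n 0 0 ** walk B k 0 0) $ a $ c"
      unfolding matrix_matrix_mult_def
      by (simp, rule member_le_sum) (auto intro!: mult_nonneg_nonneg walk_nonneg B)
    also have "\<dots> \<le> walk B (n + k) 0 0 $ a $ c" by (rule walk_supermult[OF B])
    finally have "walk B n 0 0 $ a $ b * C \<le> walk B (n + k) 0 0 $ a $ c * ?v $ c"
      using kc unfolding C_def by (simp add: mult.assoc[symmetric] mult_right_mono)
    also have "\<dots> \<le> (\<Sum>c\<in>UNIV. walk B (n + k) 0 0 $ a $ c * ?v $ c)"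
      by (rule member_le_sum) (auto intro!: mult_nonneg_nonneg walk_nonneg B v0)
    finally show ?thesis by (simp add: matrix_vector_mult_def)
  qed
  have "(\<Sum>n<m. walk B n 0 0 $ a $ b * C) \<le> w * h $ a" for m
  proof -
    have "(\<Sum>n<m. walk B n 0 0 $ a $ b * C) \<le> (\<Sum>n<m. (walk B (n + k) 0 0 *v ?v) $ a)"
      by (rule sum_mono) (rule bound)
    also have "\<dots> = (\<Sum>n\<in>(\<lambda>n. n + k) ` {..<m}. (walk B n 0 0 *v ?v) $ a)"
      by (simp add: sum.reindex)
    also have "\<dots> \<le> (\<Sum>n<m + k. (walk B n 0 0 *v ?v) $ a)"
      by (rule sum_mono2) (auto intro!: matrix_vector_nonneg walk_nonneg B v0)
    also have "\<dots> \<le> w powi (0 + 1) * h $ a" by (rule walk_passage_bound[OF B w h]) auto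
    finally show ?thesis by simp
  qed
  then have "summable (\<lambda>n. walk B n 0 0 $ a $ b * C)"
    by (intro summableI_nonneg_bounded) (use C in \<open>auto intro!: mult_nonneg_nonneg walk_nonneg B\<close>)
  then have "summable (\<lambda>n. walk B n 0 0 $ a $ b)" using C summable_divide[of _ C] by fastforce
  then show "summable (\<lambda>n. norm (walk B n 0 0 $ a $ b))"
    by (simp add: walk_nonneg[OF B])
qed

section \<open>The generating matrices at positive arguments\<close>

definition Acol_real :: "('s::finite) blocks \<Rightarrow> real \<Rightarrow> int \<Rightarrow> real^'s^'s" where
  "Acol_real A z j = (\<chi> a b. \<Sum>i\<in>H. A i j $ a $ b * z powi i)"

definition Cmat_real :: "('s::finite) blocks \<Rightarrow> real \<Rightarrow> real \<Rightarrow> real^'s^'s" where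
  "Cmat_real A z w = (\<chi> a b. \<Sum>i\<in>H. \<Sum>j\<in>H. A i j $ a $ b * z powi i * w powi j)"

lemma Acol_of_real: "Acol A (of_real z) = (\<lambda>j. complex_mat (Acol_real A z j))"
  by (simp add: fun_eq_iff vec_eq_iff Acol_def Acol_real_def)

lemma chi_eq: "chi A z w = spr (complex_mat (Cmat_real A z w))"
proof -
  have "Cmat A (of_real z) (of_real w) = complex_mat (Cmat_real A z w)"
    by (simp add: vec_eq_iff Cmat_def Cmat_real_def)
  then show ?thesis by (simp add: chi_def)
qed

lemma Cmat_real_vec:
  "(Cmat_real A z w *v h) $ a = (\<Sum>(b, i, j)\<in>UNIV \<times> H \<times> H. A i j $ a $ b * z powi i * w powi j * h $ b)"
  by (simp add: matrix_vector_mult_def Cmat_real_def sum_distrib_right sum.cartesian_product case_prod_unfold)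

lemma Cmat_vec:
  "(Cmat A z w *v x) $ a = (\<Sum>(b, i, j)\<in>UNIV \<times> H \<times> H. of_real (A i j $ a $ b) * z powi i * w powi j * x $ b)"
  by (simp add: matrix_vector_mult_def Cmat_def sum_distrib_right sum.cartesian_product case_prod_unfold)

lemma Cmat_real_Acol:
  "Cmat_real A z w $ a $ b = (\<Sum>j\<in>H. w powi j * Acol_real A z j $ a $ b)"
  by (simp add: Cmat_real_def Acol_real_def sum_H distrib_left mult_ac add_ac)

lemma Cmat_Acol:
  "Cmat A z w $ a $ b = (\<Sum>j\<in>H. w powi j * Acol A z j $ a $ b)"
  by (simp add: Cmat_def Acol_def sum_H distrib_left mult_ac add_ac)

lemma kpow_pos_rtrancl:
  "0 < kpow K n x y \<Longrightarrow> (x, y) \<in> {(x, y). 0 < K x y}\<^sup>*"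
proof (induction n arbitrary: x)
  case 0
  then show ?case by (auto split: if_splits)
next
  case (Suc n)
  have "\<exists>z. K x z * kpow K n z y \<noteq> 0"
  proof (rule ccontr)
    assume "\<not> ?thesis"
    then have "(\<Sum>\<^sub>\<infinity>z. K x z * kpow K n z y) = 0" by (intro infsum_0) auto
    then show False using Suc.prems by (simp add: kmult_def)
  qed
  then obtain z where "0 < K x z" "0 < kpow K n z y" by (auto simp: zero_less_iff_neq_zero)
  then show ?case using Suc.IH[of z] by (auto intro: converse_rtrancl_into_rtrancl)
qed

locale plane_blocks =
  fixes A :: "('s::finite) blocks"
  assumes nonneg: "\<And>i j a b. i \<in> H \<Longrightarrow> j \<in> H \<Longrightarrow> 0 \<le> A i j $ a $ b"
    and stoch: "stochastic (\<Sum>i\<in>H. \<Sum>j\<in>H. A i j)"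
    and plane_irreducible: "kirreducible (kernel (plane_chain A))"
begin

lemma plane_reach: "(x, y) \<in> {(x, y). 0 < plane_chain A x y}\<^sup>*"
proof -
  obtain n where "0 < kpow (kernel (plane_chain A)) n x y"
    using plane_irreducible unfolding kirreducible_def by blast
  then show ?thesis using kpow_pos_rtrancl[of "kernel (plane_chain A)" n x y] by (simp add: kernel_def)
qed

lemma plane_edge:
  assumes "0 < plane_chain A (x1, x2, a) (y1, y2, b)"
  obtains i j where "i \<in> H" "j \<in> H" "0 < A i j $ a $ b" "y1 = x1 + i" "y2 = x2 + j"
  using assms that[of "y1 - x1" "y2 - x2"] by (auto simp: plane_chain_def block_def split: if_splits)

text \<open>The form in which irreducibility of the plane chain is used: what passes along every
  transition passes from one state to all states, in particular to the same phase at another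
  position.\<close>

lemma plane_invariant:
  assumes "P x1 x2 a"
    and step: "\<And>x1 x2 a i j b. P x1 x2 a \<Longrightarrow> i \<in> H \<Longrightarrow> j \<in> H \<Longrightarrow> 0 < A i j $ a $ b \<Longrightarrow> P (x1 + i) (x2 + j) b"
  shows "P y1 y2 b"
proof -
  have "case y of (y1, y2, b) \<Rightarrow> P y1 y2 b" for y
    using plane_reach[of "(x1, x2, a)" y]
  proof induction
    case (step y z)
    then show ?case by (cases y, cases z) (auto elim!: plane_edge intro: assms(2))
  qed (use assms(1) in simp)
  from this[of "(y1, y2, b)"] show ?thesis by simp
qed

lemma plane_invariant_back:
  assumes "P y1 y2 b"
    and step: "\<And>x1 x2 a i j b. P (x1 + i) (x2 + j) b \<Longrightarrow> i \<in> H \<Longrightarrow> j \<in> H \<Longrightarrow> 0 < A i j $ a $ b \<Longrightarrow> P x1 x2 a"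
  shows "P x1 x2 a"
proof -
  have "case x of (x1, x2, a) \<Rightarrow> P x1 x2 a" for x
    using plane_reach[of x "(y1, y2, b)"]
  proof (induction rule: converse_rtrancl_induct)
    case (step y z)
    then show ?case by (cases y, cases z) (auto elim!: plane_edge intro: assms(2))
  qed (use assms(1) in simp)
  from this[of "(x1, x2, a)"] show ?thesis by simp
qed

lemma Cmat_real_nonneg: "0 < z \<Longrightarrow> 0 < w \<Longrightarrow> 0 \<le> Cmat_real A z w $ a $ b"
  by (simp add: Cmat_real_def sum_nonneg nonneg)

lemma Acol_real_nonneg: "0 < z \<Longrightarrow> j \<in> H \<Longrightarrow> 0 \<le> Acol_real A z j $ a $ b"
  by (simp add: Acol_real_def sum_nonneg nonneg)

text \<open>Paths of the plane chain, with their positions forgotten, connect any two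
  phases.\<close>

lemma Cmat_real_irreducible:
  assumes z: "0 < z" and w: "0 < w"
  shows "irreducible_mat (Cmat_real A z w)"
proof -
  let ?E = "{(a, b). 0 < Cmat_real A z w $ a $ b}"
  have "(a, b) \<in> ?E\<^sup>*" for a b
  proof (rule plane_invariant[where P = "\<lambda>_ _ c. (a, c) \<in> ?E\<^sup>*" and ?x1.0 = 0 and ?x2.0 = 0 and a = a and ?y1.0 = 0 and ?y2.0 = 0])
    fix c d i j assume c: "(a, c) \<in> ?E\<^sup>*" and ij: "i \<in> H" "j \<in> H" "0 < A i j $ c $ d"
    have "0 < A i j $ c $ d * z powi i * w powi j" using ij z w by simp
    also have "\<dots> \<le> (\<Sum>j\<in>H. A i j $ c $ d * z powi i * w powi j)"
      by (rule member_le_sum) (use ij z w in \<open>auto simp: nonneg\<close>)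
    also have "\<dots> \<le> Cmat_real A z w $ c $ d"
      unfolding Cmat_real_def vec_lambda_beta
      by (rule member_le_sum[of i H "\<lambda>i. \<Sum>j\<in>H. A i j $ c $ d * z powi i * w powi j"])
         (use ij z w in \<open>auto simp: nonneg intro!: sum_nonneg\<close>)
    finally show "(a, d) \<in> ?E\<^sup>*" using c by (simp add: rtrancl.rtrancl_into_rtrancl)
  qed simp
  then show ?thesis using Cmat_real_nonneg[OF z w] by (auto simp: irreducible_mat_def)
qed

section \<open>The region \<open>chi \<le> 1\<close>: compactness and right endpoint\<close>

lemma Cmat_real_term_le:
  assumes "0 < z" "0 < w" "\<And>b. 0 \<le> h $ b" "i \<in> H" "j \<in> H"
  shows "A i j $ a $ b * z powi i * w powi j * h $ b \<le> (Cmat_real A z w *v h) $ a"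
proof -
  have "(case (b, i, j) of (b, i, j) \<Rightarrow> A i j $ a $ b * z powi i * w powi j * h $ b) \<le> (Cmat_real A z w *v h) $ a"
    unfolding Cmat_real_vec by (rule member_le_sum) (use assms in \<open>auto simp: nonneg\<close>)
  then show ?thesis by simp
qed

text \<open>Replaces the spectral radius by finitely many inequalities continuous in
  \<open>z\<close>, \<open>w\<close> and \<open>h\<close>, with \<open>h\<close> in a compact set;
  closedness of the region rests on this form.\<close>

lemma chi_le_1_iff:
  assumes "0 < z" "0 < w"
  shows "chi A z w \<le> 1 \<longleftrightarrow> (\<exists>h\<in>prob_vecs. \<forall>a. (Cmat_real A z w *v h) $ a \<le> h $ a)"
proof
  assume le: "chi A z w \<le> 1"
  obtain h where h: "\<And>a. 0 < h $ a" "Cmat_real A z w *v h = chi A z w *s h"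
    using spr_complex_mat[OF Cmat_real_irreducible[OF assms]] by (auto simp: chi_eq)
  define S where "S = (\<Sum>a\<in>UNIV. h $ a)"
  have S: "0 < S" unfolding S_def by (rule sum_pos) (use h in auto)
  have "(1 / S) *s h \<in> prob_vecs"
    using S h by (simp add: prob_vecs_def less_imp_le flip: sum_divide_distrib S_def)
  moreover have "(Cmat_real A z w *v ((1 / S) *s h)) $ a \<le> ((1 / S) *s h) $ a" for a
  proof -
    have "chi A z w * (h $ a / S) \<le> 1 * (h $ a / S)"
      by (rule mult_right_mono[OF le]) (use S h(1)[of a] in simp)
    then show ?thesis by (simp add: vec.scale h)
  qed
  ultimately show "\<exists>h\<in>prob_vecs. \<forall>a. (Cmat_real A z w *v h) $ a \<le> h $ a" by blast
next
  assume "\<exists>h\<in>prob_vecs. \<forall>a. (Cmat_real A z w *v h) $ a \<le> h $ a"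
  then obtain h where h: "h \<in> prob_vecs" "\<And>a. (Cmat_real A z w *v h) $ a \<le> h $ a" by blast
  moreover have "h \<noteq> 0" using h(1) by (auto simp: prob_vecs_def)
  ultimately show "chi A z w \<le> 1"
    unfolding chi_eq using spr_le_1(1)[OF Cmat_real_irreducible[OF assms], of h]
    by (auto simp: prob_vecs_def)
qed

text \<open>Superharmonicity of \<open>h\<close> is iterated along a path of the plane chain. The
  product of the entries of \<open>A\<close> on the path serves as \<open>c\<close>, so
  \<open>c\<close> is common to all \<open>z\<close>, \<open>w\<close> and \<open>h\<close>.\<close>

lemma path_bound:
  "\<exists>c>0. \<forall>z w h. 0 < z \<and> 0 < w \<and> (\<forall>b. 0 \<le> h $ b) \<and> (\<forall>b. (Cmat_real A z w *v h) $ b \<le> h $ b) \<longrightarrow>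
     c * z powi x1 * w powi x2 * h $ b \<le> h $ a"
proof (rule plane_invariant[where P = "\<lambda>x1 x2 b. \<exists>c>0. \<forall>z w h. 0 < z \<and> 0 < w \<and> (\<forall>b. 0 \<le> h $ b) \<and> (\<forall>b. (Cmat_real A z w *v h) $ b \<le> h $ b) \<longrightarrow>
     c * z powi x1 * w powi x2 * h $ b \<le> h $ a" and ?x1.0 = 0 and ?x2.0 = 0 and a = a])
  show "\<exists>c>0. \<forall>z w h. 0 < z \<and> 0 < w \<and> (\<forall>b. 0 \<le> h $ b) \<and> (\<forall>b. (Cmat_real A z w *v h) $ b \<le> h $ b) \<longrightarrow>
     c * z powi 0 * w powi 0 * h $ a \<le> h $ a" by (rule exI[of _ 1]) simp
next
  fix x1 x2 b i j d
  assume "\<exists>c>0. \<forall>z w h. 0 < z \<and> 0 < w \<and> (\<forall>b. 0 \<le> h $ b) \<and> (\<forall>b. (Cmat_real A z w *v h) $ b \<le> h $ b) \<longrightarrow>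
     c * z powi x1 * w powi x2 * h $ b \<le> h $ a" and ij: "i \<in> H" "j \<in> H" "0 < A i j $ b $ d"
  then obtain c where c: "0 < c" and IH: "\<And>z w h. 0 < z \<Longrightarrow> 0 < w \<Longrightarrow> (\<And>b. 0 \<le> h $ b) \<Longrightarrow>
     (\<And>b. (Cmat_real A z w *v h) $ b \<le> h $ b) \<Longrightarrow> c * z powi x1 * w powi x2 * h $ b \<le> h $ a" by blast
  have "c * A i j $ b $ d * z powi (x1 + i) * w powi (x2 + j) * h $ d \<le> h $ a"
    if z: "0 < z" and w: "0 < w" and h: "\<And>b. 0 \<le> h $ b" "\<And>b. (Cmat_real A z w *v h) $ b \<le> h $ b" for z w h
  proof -
    have "c * z powi x1 * w powi x2 * (A i j $ b $ d * z powi i * w powi j * h $ d) \<le> c * z powi x1 * w powi x2 * h $ b"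
      by (rule mult_left_mono[OF order_trans[OF Cmat_real_term_le[OF z w h(1) ij(1,2)] h(2)]])
         (use c z w in simp)
    also have "\<dots> \<le> h $ a" by (rule IH[OF z w h])
    finally show ?thesis using z w by (simp add: power_int_add mult_ac)
  qed
  then show "\<exists>c>0. \<forall>z w h. 0 < z \<and> 0 < w \<and> (\<forall>b. 0 \<le> h $ b) \<and> (\<forall>b. (Cmat_real A z w *v h) $ b \<le> h $ b) \<longrightarrow>
     c * z powi (x1 + i) * w powi (x2 + j) * h $ d \<le> h $ a"
    using c ij by (intro exI[of _ "c * A i j $ b $ d"]) simp
qed

text \<open>A path back to the same phase lets the positive entry of \<open>h\<close> cancel. The
  four unit displacements then bound both coordinates of \<open>Gam\<close>.\<close>

lemma chi_le_1_power_bound: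
  "\<exists>c>0. \<forall>z w. 0 < z \<longrightarrow> 0 < w \<longrightarrow> chi A z w \<le> 1 \<longrightarrow> z powi x1 * w powi x2 \<le> c"
proof -
  let ?a = "undefined :: 's"
  obtain c where c: "0 < c" and le: "\<And>z w h. 0 < z \<Longrightarrow> 0 < w \<Longrightarrow> (\<And>b. 0 \<le> h $ b) \<Longrightarrow>
     (\<And>b. (Cmat_real A z w *v h) $ b \<le> h $ b) \<Longrightarrow> c * z powi x1 * w powi x2 * h $ ?a \<le> h $ ?a"
    using path_bound[of x1 x2 ?a ?a] by blast
  have "z powi x1 * w powi x2 \<le> 1 / c" if zw: "0 < z" "0 < w" "chi A z w \<le> 1" for z w
  proof -
    obtain h where h: "h \<in> prob_vecs" "\<And>b. (Cmat_real A z w *v h) $ b \<le> h $ b"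
      using chi_le_1_iff[of z w] zw by blast
    have h0: "0 \<le> h $ b" for b using h(1) by (simp add: prob_vecs_def)
    have "h \<noteq> 0" using h(1) by (auto simp: prob_vecs_def)
    then have "0 < h $ ?a"
      using irreducible_mat_pos[OF Cmat_real_irreducible[OF zw(1,2)] h0, of 1] h(2) by simp
    moreover have "c * z powi x1 * w powi x2 * h $ ?a \<le> 1 * h $ ?a"
      using le[OF zw(1,2) h0 h(2)] by simp
    ultimately have "c * z powi x1 * w powi x2 \<le> 1" by (simp only: mult_le_cancel_right_pos)
    then show ?thesis using c by (simp add: field_simps)
  qed
  then show ?thesis using c by (intro exI[of _ "1 / c"]) auto
qed

lemma Gam_bounded: "\<exists>K. \<forall>(s, t)\<in>Gam A. \<bar>s\<bar> \<le> K \<and> \<bar>t\<bar> \<le> K"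
proof -
  have "\<exists>k. \<forall>(s, t)\<in>Gam A. of_int i * s + of_int j * t \<le> k" for i j
  proof -
    obtain c where "0 < c" and c: "\<And>z w. 0 < z \<Longrightarrow> 0 < w \<Longrightarrow> chi A z w \<le> 1 \<Longrightarrow> z powi i * w powi j \<le> c"
      using chi_le_1_power_bound[of i j] by blast
    have "exp (of_int i * s + of_int j * t) \<le> c" if "(s, t) \<in> Gam A" for s t
      using that c[of "exp s" "exp t"] by (simp add: Gam_def exp_add exp_power_int)
    then have "of_int i * s + of_int j * t \<le> ln c" if "(s, t) \<in> Gam A" for s t
      using that \<open>0 < c\<close> by (simp add: ln_ge_iff)
    then show ?thesis by (intro exI[of _ "ln c"]) auto
  qed
  then obtain K where K: "\<And>i j. \<forall>(s, t)\<in>Gam A. of_int i * s + of_int j * t \<le> K i j" by metis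
  have "\<bar>s\<bar> \<le> \<bar>K 1 0\<bar> + \<bar>K (-1) 0\<bar> + \<bar>K 0 1\<bar> + \<bar>K 0 (-1)\<bar> \<and> \<bar>t\<bar> \<le> \<bar>K 1 0\<bar> + \<bar>K (-1) 0\<bar> + \<bar>K 0 1\<bar> + \<bar>K 0 (-1)\<bar>"
    if "(s, t) \<in> Gam A" for s t
  proof -
    have "s \<le> K 1 0" "- s \<le> K (-1) 0" "t \<le> K 0 1" "- t \<le> K 0 (-1)"
      using bspec[OF K[of 1 0] that] bspec[OF K[of "-1" 0] that] bspec[OF K[of 0 1] that] bspec[OF K[of 0 "-1"] that]
      by simp_all
    then show ?thesis by linarith
  qed
  then show ?thesis by blast
qed

text \<open>\<open>Gam\<close> is the projection of a compact set of triples
  \<open>(s, t, h)\<close>: bounded exponents and probability vectors subject to the superharmonic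
  inequalities.\<close>

lemma compact_Gam: "compact (Gam A)"
proof -
  obtain K where K: "\<And>s t. (s, t) \<in> Gam A \<Longrightarrow> \<bar>s\<bar> \<le> K \<and> \<bar>t\<bar> \<le> K" using Gam_bounded by blast
  let ?P = "\<lambda>s t h a. (\<Sum>(b, i, j)\<in>UNIV \<times> H \<times> H. A i j $ a $ b * exp (of_int i * s) * exp (of_int j * t) * h $ b) \<le> h $ a"
  define Q where "Q s t h \<longleftrightarrow> (\<forall>a. ?P s t h a)" for s t and h :: "real^'s"
  define T where "T = ({-K..K} \<times> {-K..K}) \<times> prob_vecs \<inter> {p. Q (fst (fst p)) (snd (fst p)) (snd p)}"
  have "closed {p :: (real \<times> real) \<times> (real^'s). Q (fst (fst p)) (snd (fst p)) (snd p)}"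
    unfolding case_prod_unfold Q_def
    by (intro closed_Collect_all closed_Collect_le continuous_intros)
  then have "compact T"
    unfolding T_def by (intro compact_Int_closed compact_Times compact_Icc compact_prob_vecs)
  then have "compact (fst ` T)" by (intro compact_continuous_image continuous_intros)
  moreover have "fst ` T = Gam A"
  proof -
    have *: "(Cmat_real A (exp s) (exp t) *v h) $ a \<le> h $ a \<longleftrightarrow> ?P s t h a" for s t h a
      by (simp add: Cmat_real_vec exp_power_int)
    have Gam: "(s, t) \<in> Gam A \<longleftrightarrow> (\<exists>h\<in>prob_vecs. Q s t h)" for s t
      unfolding Gam_def by (simp add: chi_le_1_iff * Q_def)
    have "(s, t) \<in> fst ` T \<longleftrightarrow> (s, t) \<in> Gam A" for s t
    proof -
      have "(s, t) \<in> fst ` T \<longleftrightarrow> (\<exists>h. ((s, t), h) \<in> T)" by force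
      also have "\<dots> \<longleftrightarrow> \<bar>s\<bar> \<le> K \<and> \<bar>t\<bar> \<le> K \<and> (s, t) \<in> Gam A"
        unfolding Gam T_def by (auto simp: abs_le_iff)
      finally show ?thesis using K by blast
    qed
    then show ?thesis by auto
  qed
  ultimately show ?thesis by simp
qed

lemma zero_in_Gam: "(0, 0) \<in> Gam A"
proof -
  have "Cmat_real A 1 1 = (\<Sum>i\<in>H. \<Sum>j\<in>H. A i j)" by (simp add: vec_eq_iff Cmat_real_def)
  then have "(Cmat_real A 1 1 *v 1) $ a = 1" for a
    using stoch by (simp add: stochastic_def matrix_vector_mult_def)
  then have "chi A 1 1 \<le> 1"
    unfolding chi_eq by (intro spr_le_1(1)[OF Cmat_real_irreducible, of 1 1 1]) (auto simp: vec_eq_iff)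
  then show ?thesis by (simp add: Gam_def)
qed

lemma compact_fst_Gam: "compact (fst ` Gam A)"
  by (intro compact_continuous_image compact_Gam continuous_intros)

lemma zlow_le_zup: "zlow A \<le> zup A"
proof -
  have "bdd_above (fst ` Gam A)" "bdd_below (fst ` Gam A)"
    using compact_imp_bounded[OF compact_fst_Gam] by (auto simp: bounded_imp_bdd_above bounded_imp_bdd_below)
  moreover have "0 \<in> fst ` Gam A" using zero_in_Gam by force
  ultimately have "Inf (fst ` Gam A) \<le> 0" "0 \<le> Sup (fst ` Gam A)"
    by (auto intro: cInf_lower cSup_upper)
  then show ?thesis by (simp add: zlow_def zup_def)
qed

lemma zup_pos: "0 < zup A"
  by (simp add: zup_def)

lemma zup_upper:
  assumes "0 < z" "0 < w" "chi A z w \<le> 1"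
  shows "z \<le> zup A"
proof -
  have "(ln z, ln w) \<in> Gam A" using assms by (simp add: Gam_def)
  then have "ln z \<in> fst ` Gam A" by force
  then have "ln z \<le> Sup (fst ` Gam A)"
    using compact_imp_bounded[OF compact_fst_Gam] by (auto intro: cSup_upper bounded_imp_bdd_above)
  then show ?thesis using assms(1) by (metis exp_le_cancel_iff exp_ln zup_def)
qed

lemma zup_attained: "\<exists>w>0. chi A (zup A) w \<le> 1"
proof -
  have ne: "fst ` Gam A \<noteq> {}" using zero_in_Gam by blast
  have "Sup (fst ` Gam A) \<in> fst ` Gam A"
    using closed_contains_Sup[OF ne _ compact_imp_closed[OF compact_fst_Gam]]
      compact_imp_bounded[OF compact_fst_Gam] by (auto simp: bounded_imp_bdd_above)
  then obtain t where "(Sup (fst ` Gam A), t) \<in> Gam A" by force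
  then show ?thesis by (auto simp: Gam_def zup_def intro!: exI[of _ "exp t"])
qed

text \<open>If \<open>\<chi>(r, w) < 1\<close> then also \<open>\<chi>(c r, w) \<le> 1\<close> for some \<open>c > 1\<close>, since \<open>C(c r, w) \<le> c C(r, w)\<close>.\<close>

lemma chi_zup_ge_1:
  assumes w: "0 < w"
  shows "1 \<le> chi A (zup A) w"
proof (rule ccontr)
  let ?r = "zup A" and ?s = "chi A (zup A) w"
  assume "\<not> 1 \<le> ?s"
  then have s: "?s < 1" by simp
  obtain h where h: "\<And>a. 0 < h $ a" "Cmat_real A ?r w *v h = ?s *s h"
    using spr_complex_mat[OF Cmat_real_irreducible[OF zup_pos w]] by (auto simp: chi_eq)
  obtain c where c: "1 < c" "c * ?s \<le> 1"
  proof (cases "0 < ?s")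
    case True
    then show thesis using that[of "1 / ?s"] s by simp
  next
    case False
    then show thesis using that[of 2] by simp
  qed
  have ci: "c powi i \<le> c" if "i \<in> H" for i
  proof -
    have "inverse c \<le> c" using c(1) by (smt (verit) inverse_le_1_iff)
    then show ?thesis using that c(1) by (auto simp: H_def power_int_minus)
  qed
  have "(Cmat_real A (c * ?r) w *v h) $ a \<le> 1 * h $ a" for a
  proof -
    have "(Cmat_real A (c * ?r) w *v h) $ a \<le> c * (Cmat_real A ?r w *v h) $ a"
      unfolding Cmat_real_vec sum_distrib_left
    proof (rule sum_mono, clarsimp)
      fix b i j assume ij: "i \<in> H" "j \<in> H"
      have "c powi i * (A i j $ a $ b * ?r powi i * w powi j * h $ b) \<le> c * (A i j $ a $ b * ?r powi i * w powi j * h $ b)"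
        by (rule mult_right_mono[OF ci[OF ij(1)]])
           (use ij zup_pos w h(1)[of b] in \<open>auto simp: nonneg\<close>)
      then show "A i j $ a $ b * (c * ?r) powi i * w powi j * h $ b \<le> c * (A i j $ a $ b * ?r powi i * w powi j * h $ b)"
        by (simp add: power_int_mult_distrib mult_ac)
    qed
    also have "\<dots> = (c * ?s) * h $ a" by (simp add: h(2))
    also have "\<dots> \<le> 1 * h $ a" by (rule mult_right_mono[OF c(2)]) (use h(1)[of a] in simp)
    finally show ?thesis .
  qed
  moreover have "h \<noteq> 0" using h(1) by (metis less_irrefl zero_index)
  ultimately have "chi A (c * ?r) w \<le> 1"
    unfolding chi_eq using c(1) zup_pos w h(1)
    by (intro spr_le_1(1)[OF Cmat_real_irreducible, of "c * ?r" w h]) (auto simp: less_imp_le)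
  then have "c * ?r \<le> ?r" using c(1) zup_pos w by (intro zup_upper) auto
  then show False using c(1) zup_pos by simp
qed

end

section \<open>Equality cases and the rigidity they force\<close>

lemma Re_eq_cmod: "Re w = cmod w \<Longrightarrow> w = complex_of_real (cmod w)"
  using cmod_power2[of w] by (simp add: complex_eq_iff)

lemma sqrt_eq_mean:
  fixes x y :: real
  assumes "0 \<le> x" "0 \<le> y" and eq: "sqrt (x * y) = (x + y) / 2"
  shows "x = y"
proof -
  have "x * y = ((x + y) / 2)\<^sup>2" unfolding eq[symmetric] using assms by simp
  then have "(x - y)\<^sup>2 = 0" by (simp add: power2_eq_square field_simps)
  then show ?thesis by simp
qed

lemma sum_mono_eq:
  fixes f g :: "'i \<Rightarrow> real"
  assumes "finite I" "\<And>i. i \<in> I \<Longrightarrow> f i \<le> g i" "sum f I = sum g I" "i \<in> I"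
  shows "f i = g i"
proof -
  have "(\<Sum>i\<in>I. g i - f i) = 0" using assms(3) by (simp add: sum_subtractf)
  then have "g i - f i = 0"
    using assms by (subst (asm) sum_nonneg_eq_0_iff) auto
  then show ?thesis by simp
qed

context plane_blocks
begin

text \<open>The geometric mean of the Perron vectors at \<open>w1\<close> and \<open>w2\<close> is superharmonic at \<open>sqrt (w1 w2)\<close>;
  equality in all the AM-GM inequalities makes \<open>(w2 / w1)\<^sup>j\<close> a coboundary along every transition.\<close>

lemma chi_zup_eq_1_unique:
  assumes w: "0 < w1" "0 < w2" and chi: "chi A (zup A) w1 = 1" "chi A (zup A) w2 = 1"
  shows "w1 = w2"
proof -
  let ?r = "zup A"
  obtain f where f: "\<And>a. 0 < f $ a" "Cmat_real A ?r w1 *v f = f"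
    using spr_complex_mat[OF Cmat_real_irreducible[OF zup_pos w(1)]] chi by (auto simp: chi_eq)
  obtain g where g: "\<And>a. 0 < g $ a" "Cmat_real A ?r w2 *v g = g"
    using spr_complex_mat[OF Cmat_real_irreducible[OF zup_pos w(2)]] chi by (auto simp: chi_eq)
  define w where "w = sqrt (w1 * w2)"
  define h where "h = (\<chi> a. sqrt (f $ a * g $ a))"
  have w0: "0 < w" using assms by (simp add: w_def)
  have h0: "0 < h $ a" for a using f g by (simp add: h_def)
  let ?T = "\<lambda>a. \<lambda>(b, i, j). A i j $ a $ b * ?r powi i * w powi j * h $ b"
  \<comment> \<open>\<open>t a\<close> balances the two means: \<open>t a * f\<close> and
    \<open>g / t a\<close> both equal \<open>h\<close> at \<open>a\<close>, so the upper bound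
    \<open>?U\<close> sums to exactly \<open>h\<close>.\<close>
  define t where "t a = sqrt (g $ a / f $ a)" for a
  have t0: "0 < t a" for a using f g by (simp add: t_def)
  let ?U = "\<lambda>a. \<lambda>(b, i, j). A i j $ a $ b * ?r powi i * ((t a * (w1 powi j * f $ b) + (w2 powi j * g $ b) / t a) / 2)"
  have TU: "?T a p \<le> ?U a p" if p_in: "p \<in> UNIV \<times> H \<times> H" for a p
  proof -
    obtain b i j where p: "p = (b, i, j)" "i \<in> H" "j \<in> H" using p_in by auto
    let ?x = "t a * (w1 powi j * f $ b)" and ?y = "(w2 powi j * g $ b) / t a"
    have "w powi j * h $ b = sqrt (?x * ?y)"
      using t0[of a] p(3) w by (auto simp: w_def h_def real_sqrt_mult H_def power_int_minus real_sqrt_divide real_sqrt_inverse)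
    also have "\<dots> \<le> (?x + ?y) / 2"
      by (rule arith_geo_mean_sqrt) (use t0[of a] w f(1)[of b] g(1)[of b] in \<open>auto simp: less_imp_le\<close>)
    finally have "(A i j $ a $ b * ?r powi i) * (w powi j * h $ b) \<le> (A i j $ a $ b * ?r powi i) * ((?x + ?y) / 2)"
      by (rule mult_left_mono) (use p zup_pos in \<open>simp add: nonneg\<close>)
    then show ?thesis by (simp add: p mult.assoc)
  qed
  have sumU: "sum (?U a) (UNIV \<times> H \<times> H) = h $ a" for a
  proof -
    have "sum (?U a) (UNIV \<times> H \<times> H) = (t a * (Cmat_real A ?r w1 *v f) $ a + (Cmat_real A ?r w2 *v g) $ a / t a) / 2"
      unfolding Cmat_real_vec sum_distrib_left sum_divide_distrib sum.distrib[symmetric]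
      by (rule sum.cong) (auto simp: field_simps)
    also have "\<dots> = h $ a"
    proof -
      have "t a * f $ a = h $ a" "g $ a / t a = h $ a"
        using f(1)[of a] g(1)[of a]
        by (simp_all add: t_def h_def real_sqrt_mult real_sqrt_divide field_simps)
      then show ?thesis by (simp add: f(2) g(2))
    qed
    finally show ?thesis .
  qed
  have le: "(Cmat_real A ?r w *v h) $ a \<le> h $ a" for a
  proof -
    have "sum (?T a) (UNIV \<times> H \<times> H) \<le> sum (?U a) (UNIV \<times> H \<times> H)" by (rule sum_mono[OF TU])
    then show ?thesis by (simp only: Cmat_real_vec sumU)
  qed
  \<comment> \<open>A strict entry would give \<open>chi < 1\<close> at \<open>w\<close>, which the
    endpoint excludes.\<close>
  have "Cmat_real A ?r w *v h = h"
  proof (rule ccontr)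
    assume "Cmat_real A ?r w *v h \<noteq> h"
    moreover have "h \<noteq> 0" using h0 by (metis less_irrefl zero_index)
    ultimately have "chi A ?r w < 1"
      unfolding chi_eq using spr_le_1(2)[OF Cmat_real_irreducible[OF zup_pos w0], of h] le h0
      by (simp add: less_imp_le)
    then show False using chi_zup_ge_1[OF w0] by simp
  qed
  then have sum_eq: "sum (?T a) (UNIV \<times> H \<times> H) = sum (?U a) (UNIV \<times> H \<times> H)" for a
    using Cmat_real_vec[of A ?r w h a] sumU[of a] by simp
  define k where "k a = g $ a / f $ a" for a
  have k0: "0 < k a" for a using f g by (simp add: k_def)
  have edge: "k a = (w2 / w1) powi j * k b" if ij: "i \<in> H" "j \<in> H" "0 < A i j $ a $ b" for a b i j
  proof -
    let ?x = "t a * (w1 powi j * f $ b)" and ?y = "(w2 powi j * g $ b) / t a"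
    have x0: "0 < ?x" and y0: "0 < ?y" using t0[of a] w f(1)[of b] g(1)[of b] by auto
    have "?T a (b, i, j) = ?U a (b, i, j)"
      by (rule sum_mono_eq[OF _ TU sum_eq]) (use ij in auto)
    then have "(A i j $ a $ b * ?r powi i) * (w powi j * h $ b) = (A i j $ a $ b * ?r powi i) * ((?x + ?y) / 2)"
      by (simp add: mult.assoc)
    then have "w powi j * h $ b = (?x + ?y) / 2" using ij zup_pos by simp
    moreover have "w powi j * h $ b = sqrt (?x * ?y)"
      using t0[of a] ij(2) w by (auto simp: w_def h_def real_sqrt_mult H_def power_int_minus real_sqrt_divide real_sqrt_inverse)
    ultimately have "sqrt (?x * ?y) = (?x + ?y) / 2" by (simp only:)
    then have xy: "?x = ?y" by (rule sqrt_eq_mean[OF less_imp_le[OF x0] less_imp_le[OF y0]])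
    have "t a * t a = k a" using f(1)[of a] g(1)[of a] by (simp add: t_def k_def)
    then have "k a * (w1 powi j * f $ b) = w2 powi j * g $ b"
      using xy t0[of a] by (metis (no_types, opaque_lifting) less_irrefl mult.assoc mult.commute nonzero_mult_div_cancel_left times_divide_eq_right)
    then show ?thesis using f(1)[of b] w by (simp add: k_def power_int_divide_distrib field_simps)
  qed
  let ?a = "undefined :: 's"
  \<comment> \<open>The states \<open>(0, 0, ?a)\<close> and \<open>(0, 1, ?a)\<close> share their
    phase, so \<open>k\<close> cancels and \<open>w2 / w1 = 1\<close> remains.\<close>
  have "k ?a = (w2 / w1) powi 1 * k ?a"
  proof (rule plane_invariant[where P = "\<lambda>x1 x2 b. k ?a = (w2 / w1) powi x2 * k b" and ?x1.0 = 0 and ?x2.0 = 0 and a = ?a and ?y1.0 = 0])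
    fix x1 x2 a i j b
    assume "k ?a = (w2 / w1) powi x2 * k a" "i \<in> H" "j \<in> H" "0 < A i j $ a $ b"
    then show "k ?a = (w2 / w1) powi (x2 + j) * k b"
      using edge[of i j a b] w by (simp add: power_int_add)
  qed simp
  then show ?thesis using k0[of ?a] w by (simp add: field_simps)
qed

lemma zeta_zup:
  obtains \<zeta> where "0 < \<zeta>" "chi A (zup A) \<zeta> = 1" "zeta_low A (zup A) = \<zeta>" "zeta_up A (zup A) = \<zeta>"
proof -
  obtain \<zeta> where "0 < \<zeta>" "chi A (zup A) \<zeta> \<le> 1" using zup_attained by blast
  then have z: "0 < \<zeta>" "chi A (zup A) \<zeta> = 1" using chi_zup_ge_1[of \<zeta>] by simp_all
  have uniq: "w = \<zeta>" if "0 < w \<and> chi A (zup A) w = 1" for w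
    using chi_zup_eq_1_unique[of w \<zeta>] that z by simp
  have "zeta_low A (zup A) = \<zeta>"
    unfolding zeta_low_def by (rule Least_equality) (use z in simp, drule uniq, simp)
  moreover have "zeta_up A (zup A) = \<zeta>"
    unfolding zeta_up_def by (rule Greatest_equality) (use z in simp, drule uniq, simp)
  ultimately show thesis using that z by blast
qed

text \<open>Equality in the triangle inequality makes \<open>(\<alpha> / \<zeta>)\<^sup>j\<close> a coboundary along every transition.\<close>

lemma Cmat_unimodular_eigenvalue:
  assumes r: "0 < r" and z: "0 < \<zeta>" "chi A r \<zeta> = 1" and \<alpha>: "cmod \<alpha> = \<zeta>"
    and x: "x \<noteq> 0" "Cmat A (of_real r) \<alpha> *v x = x"
  shows "\<alpha> = of_real \<zeta>"
proof -
  let ?K = "Cmat_real A r \<zeta>"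
  have irr: "irreducible_mat ?K" by (rule Cmat_real_irreducible[OF r z(1)])
  obtain y where y: "\<And>a. 0 < y $ a" "y v* ?K = y"
    using spr_complex_mat[OF irr] z(2) by (auto simp: chi_eq)
  have dom: "cmod (Cmat A (of_real r) \<alpha> $ a $ b) \<le> ?K $ a $ b" for a b
    unfolding Cmat_def Cmat_real_def vec_lambda_beta
    by (intro sum_norm_le) (use r \<alpha> in \<open>auto simp: norm_mult norm_power_int nonneg\<close>)
  have mod: "?K *v modulus x = modulus x"
    using modulus_eigvec(2)[of "Cmat A (of_real r) \<alpha>" ?K y 1 x 1] dom y x by simp
  have pos: "0 < cmod (x $ a)" for a
    using irreducible_mat_pos[OF irr, of "modulus x" 1 a] mod x(1) by simp
  \<comment> \<open>Since \<open>modulus x\<close> is a nonzero nonnegative fixed vector, every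
    entry of \<open>x\<close> is nonzero and has a phase \<open>p\<close>.\<close>
  define p where "p a = x $ a / of_real (cmod (x $ a))" for a
  define q where "q = \<alpha> / of_real \<zeta>"
  have p1: "cmod (p a) = 1" for a using pos[of a] by (simp add: p_def norm_divide)
  have px: "x $ a = of_real (cmod (x $ a)) * p a" for a using pos[of a] by (simp add: p_def)
  have cp: "cnj (p a) * p a = 1" for a
    using p1[of a] by (simp add: complex_norm_square[symmetric] mult.commute)
  have q0: "q \<noteq> 0" using z(1) \<alpha> by (auto simp: q_def)
  have edge: "p a = q powi j * p b" if ij: "i \<in> H" "j \<in> H" "0 < A i j $ a $ b" for a b i j
  proof -
    \<comment> \<open>Row \<open>a\<close> of the fixed-point equation, rotated by
      \<open>cnj (p a)\<close>, sums to \<open>cmod (x $ a)\<close>. The termwise bounds by moduli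
      have the same sum, so each rotated term equals its modulus.\<close>
    let ?T = "\<lambda>(b, i, j). Re (cnj (p a) * (of_real (A i j $ a $ b) * of_real r powi i * \<alpha> powi j * x $ b))"
    let ?U = "\<lambda>(b, i, j). A i j $ a $ b * r powi i * \<zeta> powi j * modulus x $ b"
    have norm_T: "cmod (cnj (p a) * (of_real (A i j $ a $ b) * of_real r powi i * \<alpha> powi j * x $ b)) = A i j $ a $ b * r powi i * \<zeta> powi j * cmod (x $ b)"
      if "i \<in> H" "j \<in> H" for b i j
      using r \<alpha> p1[of a] that by (simp add: norm_mult norm_power_int nonneg)
    have TU: "?T t \<le> ?U t" if t_in: "t \<in> UNIV \<times> H \<times> H" for t
    proof -
      obtain b i j where t: "t = (b, i, j)" "i \<in> H" "j \<in> H" using t_in by auto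
      show ?thesis unfolding t(1) case_prod_conv modulus_nth norm_T[OF t(2,3), symmetric]
        by (rule complex_Re_le_cmod)
    qed
    have "sum ?T (UNIV \<times> H \<times> H) = Re (cnj (p a) * (Cmat A (of_real r) \<alpha> *v x) $ a)"
      unfolding Cmat_vec sum_distrib_left Re_sum by (rule sum.cong) auto
    also have "\<dots> = cmod (x $ a)"
      using cp[of a] px[of a] x(2) by (metis Re_complex_of_real mult.commute mult.left_commute mult.right_neutral)
    also have "\<dots> = sum ?U (UNIV \<times> H \<times> H)"
      using mod Cmat_real_vec[of A r \<zeta> "modulus x" a] by simp
    finally have sums: "sum ?T (UNIV \<times> H \<times> H) = sum ?U (UNIV \<times> H \<times> H)" .
    have "?T (b, i, j) = ?U (b, i, j)"
      by (rule sum_mono_eq[OF _ TU sums]) (use ij in auto)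
    then have "cnj (p a) * (of_real (A i j $ a $ b) * of_real r powi i * \<alpha> powi j * x $ b)
        = of_real (A i j $ a $ b * r powi i * \<zeta> powi j * cmod (x $ b))"
      using Re_eq_cmod[of "cnj (p a) * (of_real (A i j $ a $ b) * of_real r powi i * \<alpha> powi j * x $ b)"]
      unfolding case_prod_conv modulus_nth norm_T[OF ij(1,2), of b] by blast
    then have "of_real (A i j $ a $ b) * of_real r powi i * of_real (cmod (x $ b)) * (cnj (p a) * \<alpha> powi j * p b)
        = of_real (A i j $ a $ b) * of_real r powi i * of_real (cmod (x $ b)) * of_real \<zeta> powi j"
      by (subst (asm) px[of b]) (simp add: mult_ac)
    then have "cnj (p a) * \<alpha> powi j * p b = of_real \<zeta> powi j"
      using ij(3) r pos[of b] by (auto simp: power_int_eq_0_iff)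
    then have "cnj (p a) * (q powi j * p b) = 1"
      using z(1) by (simp add: q_def power_int_divide_distrib field_simps)
    then have "p a * cnj (p a) * (q powi j * p b) = p a" by (simp only: mult.assoc mult_1_right)
    moreover have "p a * cnj (p a) = 1" using cp[of a] by (simp only: mult.commute)
    ultimately show ?thesis by (simp only: mult_1_left)
  qed
  let ?a = "undefined :: 's"
  have "p ?a = q powi 1 * p ?a"
  proof (rule plane_invariant[where P = "\<lambda>x1 x2 b. p ?a = q powi x2 * p b" and ?x1.0 = 0 and ?x2.0 = 0 and a = ?a and ?y1.0 = 0])
    fix x1 x2 a i j b
    assume "p ?a = q powi x2 * p a" "i \<in> H" "j \<in> H" "0 < A i j $ a $ b"
    then show "p ?a = q powi (x2 + j) * p b"
      using edge[of i j a b] q0 by (simp add: power_int_add)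
  qed simp
  then have "q = 1" using p1[of ?a] by auto
  then show ?thesis using z(1) by (simp add: q_def)
qed

lemma Acol_real_vec_sum: "(\<Sum>j\<in>H. w powi j * (Acol_real A r j *v h) $ a) = (Cmat_real A r w *v h) $ a"
  unfolding matrix_vector_mult_def Cmat_real_Acol vec_lambda_beta sum_distrib_left sum_distrib_right
  by (subst sum.swap) (simp add: mult.assoc)

lemma vec_Acol_real_sum: "(\<Sum>j\<in>H. w powi j * (y v* Acol_real A r j) $ a) = (y v* Cmat_real A r w) $ a"
  unfolding vector_matrix_mult_def Cmat_real_Acol vec_lambda_beta sum_distrib_left sum_distrib_right
  by (subst sum.swap) (simp add: mult_ac)

text \<open>It suffices that every phase can descend to -1 with positive weight. A plane path from
  height 0 to height -1 supplies this: until it first goes below 0 it is a nonnegative walk, and it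
  leaves 0 by a step -1.\<close>

lemma walk_summable_Acol_real:
  assumes r: "0 < r" and z: "0 < w" "chi A r w = 1"
  shows "walk_summable (Acol_real A r)"
proof -
  obtain h where h: "\<And>a. 0 < h $ a" "Cmat_real A r w *v h = h"
    using spr_complex_mat[OF Cmat_real_irreducible[OF r z(1)]] z(2) by (auto simp: chi_eq)
  let ?B = "Acol_real A r"
  have B_pos: "0 < ?B j $ a $ b" if "i \<in> H" "j \<in> H" "0 < A i j $ a $ b" for i j a b
  proof -
    have "0 < A i j $ a $ b * r powi i" using that r by simp
    also have "\<dots> \<le> ?B j $ a $ b"
      unfolding Acol_real_def vec_lambda_beta
      by (rule member_le_sum) (use that r in \<open>auto simp: nonneg\<close>)
    finally show ?thesis .
  qed
  have desc: "\<exists>k c. 0 < walk ?B k 0 0 $ b $ c \<and> 0 < (?B (-1) *v h) $ c" for b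
  proof -
    \<comment> \<open>The condition is empty below 0, so it holds at the end of the path at height
      -1 and can be carried back to height 0.\<close>
    let ?P = "\<lambda>x1 x2 a. 0 \<le> x2 \<longrightarrow> (\<exists>k c. 0 < walk ?B k x2 0 $ a $ c \<and> 0 < (?B (-1) *v h) $ c)"
    have "?P (0::int) 0 b"
    proof (rule plane_invariant_back[where P = ?P and ?y1.0 = 0 and ?y2.0 = "-1" and b = b])
      fix x1 x2 a i j b'
      assume IH: "?P (x1 + i) (x2 + j) b'" and ij: "i \<in> H" "j \<in> H" "0 < A i j $ a $ b'"
      show "?P x1 x2 a"
      proof
        assume x2: "0 \<le> x2"
        show "\<exists>k c. 0 < walk ?B k x2 0 $ a $ c \<and> 0 < (?B (-1) *v h) $ c"
        proof (cases "0 \<le> x2 + j")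
          case True
          then obtain k c where kc: "0 < walk ?B k (x2 + j) 0 $ b' $ c" "0 < (?B (-1) *v h) $ c"
            using IH by blast
          have nn: "0 \<le> walk ?B k x 0 $ d $ e" for x d e
            by (rule walk_nonneg) (use Acol_real_nonneg[OF r] in auto)
          have "0 < ?B j $ a $ b' * walk ?B k (x2 + j) 0 $ b' $ c" using B_pos[OF ij] kc by simp
          also have "\<dots> \<le> (?B j ** walk ?B k (x2 + j) 0) $ a $ c"
            unfolding matrix_matrix_mult_def vec_lambda_beta
            by (rule member_le_sum[of b' UNIV "\<lambda>d. ?B j $ a $ d * walk ?B k (x2 + j) 0 $ d $ c"])
               (use ij nn Acol_real_nonneg[OF r] in auto)
          also have "\<dots> \<le> (\<Sum>j\<in>H. (?B j ** walk ?B k (x2 + j) 0) $ a $ c)"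
            by (rule member_le_sum[of j H "\<lambda>j. (?B j ** walk ?B k (x2 + j) 0) $ a $ c"])
               (use ij nn Acol_real_nonneg[OF r] in \<open>auto simp: matrix_matrix_mult_def intro!: sum_nonneg\<close>)
          also have "\<dots> = walk ?B (Suc k) x2 0 $ a $ c" using x2 by simp
          finally show ?thesis using kc by blast
        next
          case False
          then have "x2 = 0" "j = -1" using x2 ij by (auto simp: H_def)
          have "0 < ?B (-1) $ a $ b' * h $ b'" using B_pos[OF ij] h(1) \<open>j = -1\<close> by simp
          also have "\<dots> \<le> (?B (-1) *v h) $ a"
            unfolding matrix_vector_mult_def vec_lambda_beta
            by (rule member_le_sum[of b' UNIV "\<lambda>d. ?B (-1) $ a $ d * h $ d"])
               (use h(1) Acol_real_nonneg[OF r, of "-1"] in \<open>auto simp: H_def less_imp_le\<close>)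
          finally have "0 < (?B (-1) *v h) $ a" .
          moreover have "0 < walk ?B 0 x2 0 $ a $ a" using \<open>x2 = 0\<close> by (simp add: mat_def)
          ultimately show ?thesis by blast
        qed
      qed
    qed simp
    then show ?thesis by simp
  qed
  show ?thesis
    by (rule walk_summable_if_descends[OF Acol_real_nonneg[OF r] z(1) _ _ desc])
       (use h in \<open>auto simp: less_imp_le Acol_real_vec_sum\<close>)
qed

end

section \<open>Algebra at the critical point\<close>

lemma matrix_add_rdist: "(M + K) ** L = M ** L + K ** L"
  for M :: "'a::ring_1^_^_"
  by (simp add: vec_eq_iff matrix_matrix_mult_def distrib_right sum.distrib)

lemma matrix_diff_rdist: "(M - K) ** L = M ** L - K ** L"
  for M :: "'a::ring_1^_^_"
  by (simp add: vec_eq_iff matrix_matrix_mult_def left_diff_distrib sum_subtractf)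

lemma Cmat_vec_Acol:
  "Cmat A z w *v x = inverse w *s (Acol A z (-1) *v x) + Acol A z 0 *v x + w *s (Acol A z 1 *v x)"
  by (simp add: vec_eq_iff matrix_vector_mult_def Cmat_Acol sum_H distrib_right sum.distrib
      sum_distrib_left power_int_minus mult.assoc)

text \<open>Collects the algebra that rests on convergence alone, so that it serves both the
  endpoint and nearby points of the circle.\<close>

locale excursion_sums =
  fixes A :: "('s::finite) blocks" and z :: complex
  assumes summ: "walk_summable (Acol A z)"
begin

abbreviation "B \<equiv> Acol A z"
abbreviation "N \<equiv> N1 A z"
abbreviation "G \<equiv> G1 A z"
abbreviation "R \<equiv> R1 A z"

lemma N_eq: "N = mat 1 + B 0 ** N + B 1 ** G ** N"
  using green_eq[OF summ] by (simp add: N1_eq_green[OF summ] G1_def matrix_mul_assoc)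

lemma G_eq: "G = B (-1) + B 0 ** G + B 1 ** G ** G"
proof -
  have "N ** B (-1) = (mat 1 + B 0 ** N + B 1 ** G ** N) ** B (-1)" using N_eq by simp
  also have "\<dots> = B (-1) + B 0 ** (N ** B (-1)) + B 1 ** G ** (N ** B (-1))"
    by (simp only: matrix_add_rdist matrix_mul_lid matrix_mul_assoc)
  finally show ?thesis by (simp only: G1_def[symmetric])
qed

lemma G_vec: "G *v x = B (-1) *v x + B 0 *v (G *v x) + B 1 *v (G *v (G *v x))"
  by (subst (1) G_eq) (simp add: matrix_vector_mult_add_rdistrib flip: matrix_vector_mul_assoc)

text \<open>\<open>B 0 + B 1 ** G\<close> is the weight of the first return to height 0 without
  going below it, which makes \<open>K\<close> the inverse of \<open>N\<close>.\<close>

abbreviation "K \<equiv> mat 1 - B 0 - B 1 ** G"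

lemma K_N: "K ** N = mat 1"
proof -
  have "K ** N = N - B 0 ** N - B 1 ** G ** N" by (simp add: matrix_diff_rdist)
  also have "\<dots> = mat 1"
    by (subst (1) N_eq) simp
  finally show ?thesis .
qed

lemma N_K: "N ** K = mat 1"
  using K_N by (simp add: matrix_left_right_inverse)

lemma N_K_vec: "N *v (K *v x) = x" "K *v (N *v x) = x"
  by (simp_all only: matrix_vector_mul_assoc N_K K_N matrix_vector_mul_lid)

lemma G_eigvec_Cmat:
  assumes "G *v x = a *s x" "a \<noteq> 0"
  shows "Cmat A z a *v x = x"
proof -
  have "a *s x = B (-1) *v x + a *s (B 0 *v x) + a *s (a *s (B 1 *v x))"
    using G_vec[of x] by (simp add: assms(1) vec.scale)
  then have "inverse a *s (a *s x) = inverse a *s (B (-1) *v x + a *s (B 0 *v x) + a *s (a *s (B 1 *v x)))"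
    by simp
  moreover have "inverse a * (a * a) = a" using assms(2) by simp
  ultimately show ?thesis
    using assms(2) by (simp add: Cmat_vec_Acol vector_add_ldistrib vector_smult_assoc)
qed

text \<open>A consequence of the factorisation \<open>I - C(w) = (I - w R) K (I - w\<^sup>-\<^sup>1 G)\<close>.\<close>

lemma Cmat_fixed_of_R:
  assumes w: "w \<noteq> 0" and R: "w *s (R *v x) = x" and f: "f - inverse w *s (G *v f) = N *v x"
  shows "Cmat A z w *v f = f"
proof -
  let ?g = "inverse w *s (G *v f)"
  \<comment> \<open>Equating two expressions for \<open>x\<close> eliminates it; by the quadratic
    equation for \<open>G\<close>, what remains is \<open>C(w) f = f\<close>.\<close>
  have "x = K *v (f - ?g)" by (simp add: f N_K_vec)
  moreover have "x = w *s (B 1 *v (f - ?g))" 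
    using R by (simp add: f R1_def matrix_vector_mul_assoc)
  ultimately have "w *s (B 1 *v (f - ?g)) = K *v (f - ?g)" by simp
  then have 1: "w *s (B 1 *v f) - B 1 *v (G *v f)
      = f - ?g - B 0 *v f + inverse w *s (B 0 *v (G *v f)) - B 1 *v (G *v f) + inverse w *s (B 1 *v (G *v (G *v f)))"
    using w by (simp add: matrix_vector_mult_diff_rdistrib matrix_vector_mult_diff_distrib vec.scale
        matrix_vector_mul_assoc[symmetric] vector_ssub_ldistrib vector_smult_assoc algebra_simps)
  have "?g = inverse w *s (B (-1) *v f + B 0 *v (G *v f) + B 1 *v (G *v (G *v f)))"
    by (rule arg_cong[OF G_vec])
  then have 2: "?g = inverse w *s (B (-1) *v f) + inverse w *s (B 0 *v (G *v f)) + inverse w *s (B 1 *v (G *v (G *v f)))"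
    by (simp only: vector_add_ldistrib)
  have "w *s (B 1 *v f) = f - B 0 *v f - inverse w *s (B (-1) *v f)"
    using 1 2 by (simp add: algebra_simps)
  then show ?thesis by (simp add: Cmat_vec_Acol)
qed

end


lemma row_col_linear:
  "row_col u (x - y) = row_col u x - row_col u y" "row_col u (c *s x) = c * row_col u x"
  "row_col (c *s u) x = c * row_col u x" "row_col u 0 = 0"
  by (simp_all add: row_col_def right_diff_distrib sum_subtractf sum_distrib_left mult_ac)

lemma row_col_add: "row_col u (x + y) = row_col u x + row_col u y"
  by (simp add: row_col_def distrib_left sum.distrib)

lemma row_col_mult: "row_col (u v* M) x = row_col u (M *v x)"
  unfolding row_col_def vector_matrix_mult_def matrix_vector_mult_def
  by (simp add: sum_distrib_left sum_distrib_right) (subst sum.swap, simp add: mult_ac)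

lemma mscale_outer_vec: "mscale d (outer y u) *v w = (d * row_col u w) *s y"
  by (simp add: vec_eq_iff mscale_def outer_def matrix_vector_mult_def row_col_def
      sum_distrib_left sum_distrib_right mult_ac)

lemma complex_mat_vec:
  "complex_mat M *v (\<chi> a. complex_of_real (w $ a)) = (\<chi> a. complex_of_real ((M *v w) $ a))"
  by (simp add: vec_eq_iff matrix_vector_mult_def)

lemma vec_complex_mat:
  "(\<chi> a. complex_of_real (w $ a)) v* complex_mat M = (\<chi> a. complex_of_real ((w v* M) $ a))"
  by (simp add: vec_eq_iff vector_matrix_mult_def)

text \<open>The same \<open>\<zeta>\<close> appears as an eigenvalue of \<open>G\<close> and,
  inverted, as the bound for \<open>R\<close>. The normalisation in the theorem refers to
  \<open>zeta_up\<close>, which at the endpoint is this \<open>\<zeta>\<close>.\<close>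

locale critical_point = plane_blocks A for A :: "('s::finite) blocks" +
  fixes r \<zeta> :: real and al :: "'s \<Rightarrow> complex" and v :: "'s \<Rightarrow> complex^'s" and m :: 's
  assumes r: "0 < r" and zeta: "0 < \<zeta>" "chi A r \<zeta> = 1"
    and al_inj: "inj al" and al_m: "al m = of_real \<zeta>"
    and v_nz: "\<And>j. v j \<noteq> 0" and v_eig: "\<And>j. G1 A (of_real r) *v v j = al j *s v j"
begin

lemma summable_real: "walk_summable (Acol_real A r)"
  by (rule walk_summable_Acol_real[OF r zeta])

sublocale excursion_sums A "of_real r"
  by unfold_locales (simp add: Acol_of_real walk_summable_complex_mat summable_real)

definition "V = (\<chi> a j. v j $ a)"
definition "u j = matrix_inv V $ j"

lemma V_vec: "V *v c = (\<Sum>j\<in>UNIV. c $ j *s v j)"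
  by (simp add: V_def vec_eq_iff matrix_vector_mult_def mult.commute)

lemma V_invertible: "invertible V"
proof -
  have "c = 0" if "V *v c = 0" for c
  proof -
    \<comment> \<open>The sum is reindexed by eigenvalues, as
      \<open>eigenvectors_independent\<close> requires; injectivity of \<open>al\<close> permits
      this.\<close>
    have z: "(\<Sum>l\<in>range al. c $ (inv al l) *s v (inv al l)) = 0"
      using that by (simp add: sum.reindex[OF al_inj] V_vec inv_f_f[OF al_inj])
    have "c $ j = 0" for j
    proof -
      have "c $ inv al (al j) = 0"
        by (rule eigenvectors_independent[of "range al" "\<lambda>l. v (inv al l)" G "\<lambda>l. c $ inv al l", OF _ _ z])
           (auto simp: inv_f_f[OF al_inj] v_nz v_eig)
      then show ?thesis by (simp add: inv_f_f[OF al_inj])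
    qed
    then show ?thesis by (simp add: vec_eq_iff)
  qed
  then show ?thesis using matrix_left_invertible_ker[of V] by (auto simp: invertible_left_inverse)
qed

lemma V_inv: "matrix_inv V ** V = mat 1" "V ** matrix_inv V = mat 1"
  using V_invertible someI_ex[of "\<lambda>M. V ** M = mat 1 \<and> M ** V = mat 1"]
  by (auto simp: invertible_def matrix_inv_def)

lemma u_v: "row_col (u i) (v j) = (if i = j then 1 else 0)"
proof -
  have "row_col (u i) (v j) = (matrix_inv V ** V) $ i $ j"
    by (simp add: row_col_def u_def V_def matrix_matrix_mult_def)
  then show ?thesis by (simp add: V_inv mat_def)
qed

lemma v_expand: "x = (\<Sum>j\<in>UNIV. row_col (u j) x *s v j)"
proof -
  have "x = V *v (matrix_inv V *v x)" by (simp add: matrix_vector_mul_assoc V_inv)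
  moreover have "(matrix_inv V *v x) $ j = row_col (u j) x" for j
    by (simp add: matrix_vector_mult_def row_col_def u_def)
  ultimately show ?thesis by (simp add: V_vec)
qed

lemma mat_eq_on_basis:
  assumes "\<And>j. M *v v j = M' *v v j"
  shows "M = (M' :: complex^'s^'s)"
proof -
  have "M *v x = M' *v x" for x
    by (subst (1 2) v_expand[of x]) (simp add: vec.sum vec.scale assms)
  then show ?thesis by (simp add: matrix_eq)
qed

lemma row_eq_on_basis:
  assumes "\<And>j. row_col w (v j) = row_col w' (v j)"
  shows "w = w'"
proof -
  have "w v* V = w' v* V"
    using assms by (simp add: vec_eq_iff vector_matrix_mult_def V_def row_col_def mult.commute)
  then have "w v* V v* matrix_inv V = w' v* V v* matrix_inv V" by simp
  then show ?thesis by (simp add: vector_matrix_mul_assoc V_inv)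
qed

lemma u_G: "u m v* G = of_real \<zeta> *s u m"
  by (rule row_eq_on_basis) (auto simp: row_col_mult v_eig row_col_linear u_v al_m)

lemma perron_vectors:
  obtains h y where "\<And>a. 0 < h $ a" "\<And>a. 0 < y $ a"
    "Cmat_real A r \<zeta> *v h = h" "y v* Cmat_real A r \<zeta> = y"
  using spr_complex_mat[OF Cmat_real_irreducible[OF r zeta(1)]] zeta(2) by (auto simp: chi_eq)

lemma Cmat_of_real: "Cmat A (of_real r) (of_real \<zeta>) = complex_mat (Cmat_real A r \<zeta>)"
  by (simp add: vec_eq_iff Cmat_def Cmat_real_def)

abbreviation "N_real \<equiv> green (Acol_real A r)"
abbreviation "G_real \<equiv> N_real ** Acol_real A r (-1)"
abbreviation "R_real \<equiv> Acol_real A r 1 ** N_real"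

lemma N_real: "N = complex_mat N_real"
  unfolding N1_eq_green[OF summ] Acol_of_real by (rule green_complex_mat[OF summable_real])

lemma G_real: "G = complex_mat G_real"
  by (simp add: G1_def N_real complex_mat_mult Acol_of_real)

lemma R_real: "R = complex_mat R_real"
  by (simp add: R1_def N_real complex_mat_mult Acol_of_real)

lemma N_real_nonneg: "0 \<le> N_real $ a $ b"
  by (rule green_nonneg[OF Acol_real_nonneg[OF r] summable_real])

lemma G_real_nonneg: "0 \<le> G_real $ a $ b"
  by (simp add: matrix_matrix_mult_def sum_nonneg N_real_nonneg Acol_real_nonneg[OF r] H_def)

lemma R_real_nonneg: "0 \<le> R_real $ a $ b"
  by (simp add: matrix_matrix_mult_def sum_nonneg N_real_nonneg Acol_real_nonneg[OF r] H_def)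

lemma G_real_bound:
  assumes "\<And>a. 0 < h $ a" "Cmat_real A r \<zeta> *v h = h"
  shows "(G_real *v h) $ a \<le> \<zeta> * h $ a"
  by (rule green_descent_bound[OF Acol_real_nonneg[OF r] summable_real zeta(1)])
     (use assms in \<open>auto simp: less_imp_le Acol_real_vec_sum\<close>)

lemma R_real_bound:
  assumes "\<And>a. 0 < y $ a" "y v* Cmat_real A r \<zeta> = y"
  shows "(y v* R_real) $ a \<le> inverse \<zeta> * y $ a"
  by (rule green_ascent_bound[OF Acol_real_nonneg[OF r] summable_real zeta(1)])
     (use assms in \<open>auto simp: less_imp_le vec_Acol_real_sum\<close>)

lemma R_eigenvalue_bound:
  assumes "R *v x = l *s x" "x \<noteq> 0"
  shows "cmod l \<le> inverse \<zeta>"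
    and "cmod l = inverse \<zeta> \<Longrightarrow> R_real *v modulus x = inverse \<zeta> *s modulus x"
proof -
  obtain h y where y: "\<And>a. 0 < y $ a" "y v* Cmat_real A r \<zeta> = y" using perron_vectors by metis
  have dom: "cmod (R $ a $ b) \<le> R_real $ a $ b" for a b
    by (simp add: R_real R_real_nonneg)
  show "cmod l \<le> inverse \<zeta>"
    by (rule modulus_eigvec(1)[OF dom y(1) R_real_bound[OF y] assms])
  show "cmod l = inverse \<zeta> \<Longrightarrow> R_real *v modulus x = inverse \<zeta> *s modulus x"
    by (rule modulus_eigvec(2)[OF dom y(1) R_real_bound[OF y] assms])
qed

text \<open>Left eigenvectors are treated because the comparison vector at hand is the right vector
  \<open>h\<close> with \<open>G h \<le> \<zeta> h\<close>; transposing makes it the left vector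
  that \<open>modulus_eigvec\<close> asks for.\<close>

lemma G_eigenvalue_bound:
  assumes "w v* G = l *s w" "w \<noteq> 0"
  shows "cmod l \<le> \<zeta>"
    and "cmod l = \<zeta> \<Longrightarrow> modulus w v* G_real = \<zeta> *s modulus w"
proof -
  obtain h y where h: "\<And>a. 0 < h $ a" "Cmat_real A r \<zeta> *v h = h" using perron_vectors by metis
  have dom: "cmod (transpose G $ a $ b) \<le> transpose G_real $ a $ b" for a b
    by (simp add: transpose_def G_real G_real_nonneg)
  have b: "(h v* transpose G_real) $ a \<le> \<zeta> * h $ a" for a
    using G_real_bound[OF h] by simp
  have e: "transpose G *v w = l *s w" using assms(1) by simp
  show "cmod l \<le> \<zeta>"
    by (rule modulus_eigvec(1)[OF dom h(1) b e assms(2)])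
  show "cmod l = \<zeta> \<Longrightarrow> modulus w v* G_real = \<zeta> *s modulus w"
    using modulus_eigvec(2)[OF dom h(1) b e assms(2)] by simp
qed

lemma u_nz: "u j \<noteq> 0"
  using u_v[of j j] by (auto simp: row_col_def)

lemma al_bound: "cmod (al j) \<le> \<zeta>"
proof -
  have "u j v* G = al j *s u j"
    by (rule row_eq_on_basis) (auto simp: row_col_mult v_eig row_col_linear u_v)
  then show ?thesis using G_eigenvalue_bound(1) u_nz by blast
qed

text \<open>The fixed space of the irreducible \<open>C(r, \<zeta>)\<close> is one-dimensional, and
  \<open>v m\<close> lies in it by the quadratic equation for \<open>G\<close>.\<close>

lemma Cmat_fixed_is_Perron:
  assumes "Cmat A (of_real r) (of_real \<zeta>) *v f = f"
  shows "\<exists>c. f = c *s v m"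
proof -
  obtain h y where h: "\<And>a. 0 < h $ a" "Cmat_real A r \<zeta> *v h = h" using perron_vectors by metis
  note fixed = irreducible_mat_fixed[OF Cmat_real_irreducible[OF r zeta(1)] h, folded Cmat_of_real]
  obtain c where c: "\<And>a. f $ a = c * of_real (h $ a)" using fixed[OF assms] by blast
  have "Cmat A (of_real r) (of_real \<zeta>) *v v m = v m"
    using G_eigvec_Cmat[of "v m" "of_real \<zeta>"] v_eig[of m] al_m zeta(1) by simp
  then obtain d where d: "\<And>a. v m $ a = d * of_real (h $ a)" using fixed by blast
  have "d \<noteq> 0" using v_nz[of m] d by (auto simp: vec_eq_iff)
  then have "f = (c / d) *s v m" by (simp add: vec_eq_iff c d)
  then show ?thesis ..
qed

text \<open>Hence the eigenvalue \<open>1 / \<zeta>\<close> of \<open>R\<close> is simple, and \<open>x \<mapsto> u N x\<close> is injective on its eigenspace.\<close>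

lemma R_eigvec_zero:
  assumes R: "R *v x = of_real (inverse \<zeta>) *s x" and z: "row_col (u m) (N *v x) = 0"
  shows "x = 0"
proof -
  let ?z = "complex_of_real \<zeta>"
  have z0: "?z \<noteq> 0" using zeta(1) by simp
  define c where "c j = row_col (u j) (N *v x)" for j
  \<comment> \<open>\<open>f\<close> is to solve \<open>f - \<zeta>^-1 G f = N x\<close>, coordinate
    by coordinate in the eigenbasis. In coordinate \<open>m\<close> the left side vanishes, and the
    right side does so by assumption.\<close>
  define d where "d j = (if j = m then 0 else c j / (1 - inverse ?z * al j))" for j
  define f where "f = (\<Sum>j\<in>UNIV. d j *s v j)"
  have dc: "d j - inverse ?z * (d j * al j) = c j" for j
  proof (cases "j = m")
    case False
    then have "al j \<noteq> ?z" using al_inj al_m by (metis injD)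
    then have "1 - inverse ?z * al j \<noteq> 0" using z0 by (auto simp: field_simps)
    then have "d j * (1 - inverse ?z * al j) = c j" using False by (simp add: d_def)
    then show ?thesis by (simp add: algebra_simps)
  qed (simp add: d_def c_def z)
  have "f - inverse ?z *s (G *v f) = (\<Sum>j\<in>UNIV. (d j - inverse ?z * (d j * al j)) *s v j)"
    by (simp add: f_def vec.sum vec.scale v_eig vec.scale_sum_right sum_subtractf vector_sub_rdistrib vector_smult_assoc)
  also have "\<dots> = N *v x" unfolding dc c_def by (rule v_expand[symmetric])
  finally have f: "f - inverse ?z *s (G *v f) = N *v x" .
  have "?z *s (R *v x) = x" using R z0 by (simp add: vector_smult_assoc)
  \<comment> \<open>Being a multiple of \<open>v m\<close>, \<open>f\<close> makes the left side of
    its equation vanish; hence \<open>N x = 0\<close>, and \<open>N\<close> is invertible.\<close>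
  from Cmat_fixed_of_R[OF z0 this f] obtain e where "f = e *s v m" using Cmat_fixed_is_Perron by blast
  then have "G *v f = ?z *s f" by (simp add: vec.scale v_eig al_m vector_smult_assoc mult.commute)
  then have "N *v x = 0" using f z0 by (simp add: vector_smult_assoc)
  then show ?thesis using N_K_vec(2)[of x] by simp
qed

text \<open>Also the source of the normalised eigenvector: \<open>x\<close> is
  \<open>X v m / d\<close>, and \<open>u N x = 1\<close> because \<open>D = N X\<close> and
  \<open>u D v = d\<close>.\<close>

lemma derivative_structure:
  assumes D: "D = B 0 ** D + B 1 ** (D ** G + G ** D)" and d: "row_col (u m) (D *v v m) = d" "d \<noteq> 0"
  shows "\<exists>x. R *v x = of_real (inverse \<zeta>) *s x \<and> row_col (u m) (N *v x) = 1 \<and>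
    D = mscale d (outer (N *v x) (u m))"
proof -
  define X where "X = K ** D"
  have X: "X = B 1 ** D ** G"
  proof -
    have "X = D - B 0 ** D - B 1 ** G ** D" by (simp add: X_def matrix_diff_rdist)
    also have "\<dots> = B 1 ** D ** G"
      by (subst (1) D) (simp add: matrix_add_ldistrib matrix_mul_assoc)
    finally show ?thesis .
  qed
  have D_X: "D = N ** X" by (simp add: X_def matrix_mul_assoc N_K)
  have Xv: "X *v v j = al j *s (R *v (X *v v j))" for j
  proof -
    have "X *v v j = al j *s (B 1 *v (D *v v j))"
      by (subst X) (simp add: v_eig vec.scale flip: matrix_vector_mul_assoc)
    also have "\<dots> = al j *s (R *v (X *v v j))"
      by (simp add: D_X R1_def flip: matrix_vector_mul_assoc)
    finally show ?thesis .
  qed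
  have Xv0: "X *v v j = 0" if "j \<noteq> m" for j
  proof (rule ccontr)
    assume nz: "X *v v j \<noteq> 0"
    have al0: "al j \<noteq> 0" using Xv[of j] nz by auto
    have "R *v (X *v v j) = inverse (al j) *s (X *v v j)"
      by (subst (2) Xv) (simp add: vector_smult_assoc al0)
    then have "cmod (inverse (al j)) \<le> inverse \<zeta>" using R_eigenvalue_bound(1) nz by blast
    then have "\<zeta> \<le> cmod (al j)" using al0 zeta(1) by (simp add: norm_inverse)
    then have "cmod (al j) = \<zeta>" using al_bound[of j] by simp
    then have "al j = of_real \<zeta>"
      by (rule Cmat_unimodular_eigenvalue[OF r zeta _ v_nz G_eigvec_Cmat[OF v_eig al0]])
    then show False using that al_inj al_m by (metis injD)
  qed
  let ?p = "X *v v m"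
  have Dp: "D *v v m = N *v ?p" by (simp add: D_X matrix_vector_mul_assoc)
  define x where "x = inverse d *s ?p"
  have "R *v ?p = of_real (inverse \<zeta>) *s ?p"
    by (subst (2) Xv) (use zeta(1) in \<open>simp add: vector_smult_assoc al_m\<close>)
  then have "R *v x = of_real (inverse \<zeta>) *s x"
    by (simp add: x_def vec.scale vector_smult_assoc mult.commute)
  moreover have "row_col (u m) (N *v x) = 1"
    using d by (simp add: x_def vec.scale row_col_linear flip: Dp)
  moreover have "D = mscale d (outer (N *v x) (u m))"
  proof (rule mat_eq_on_basis)
    fix j
    have "mscale d (outer (N *v x) (u m)) *v v j = (d * row_col (u m) (v j)) *s (N *v x)"
      by (rule mscale_outer_vec)
    also have "\<dots> = (if j = m then N *v ?p else 0)"
      using d(2) by (simp add: u_v x_def vec.scale vector_smult_assoc)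
    also have "\<dots> = D *v v j"
      using Xv0[of j] Dp by (auto simp: D_X simp flip: matrix_vector_mul_assoc)
    finally show "D *v v j = mscale d (outer (N *v x) (u m)) *v v j" by simp
  qed
  ultimately show ?thesis by blast
qed

text \<open>In this locale each factor is nonnegative only up to a complex scalar:
  \<open>p = s x\<close> and \<open>q = t u\<close> for the moduli. The normalisation gives
  \<open>t * s = q N p\<close>, a nonnegative number, so the scalars cancel in the product.\<close>

lemma outer_nonneg:
  assumes R: "R *v x = of_real (inverse \<zeta>) *s x" and x: "row_col (u m) (N *v x) = 1"
  shows "(outer (N *v x) (u m)) $ a $ b \<in> \<real>\<^sub>\<ge>\<^sub>0"
proof -
  define p where "p = (\<chi> a. complex_of_real (modulus x $ a))"
  define q where "q = (\<chi> a. complex_of_real (modulus (u m) $ a))"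
  have x0: "x \<noteq> 0" using x by (auto simp: row_col_linear)
  have Rp: "R *v p = of_real (inverse \<zeta>) *s p"
  proof -
    have "R_real *v modulus x = inverse \<zeta> *s modulus x"
      by (rule R_eigenvalue_bound(2)[OF R x0]) (use zeta(1) in \<open>simp add: norm_inverse\<close>)
    then show ?thesis by (simp only: R_real p_def complex_mat_vec) (simp add: vec_eq_iff)
  qed
  have qG: "q v* G = of_real \<zeta> *s q"
  proof -
    have "modulus (u m) v* G_real = \<zeta> *s modulus (u m)"
      by (rule G_eigenvalue_bound(2)[OF u_G u_nz]) (use zeta(1) in simp)
    then show ?thesis by (simp only: G_real q_def vec_complex_mat) (simp add: vec_eq_iff)
  qed
  define s where "s = row_col (u m) (N *v p)"
  define t where "t = row_col q (v m)"
  have "p - s *s x = 0"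
    by (rule R_eigvec_zero)
       (simp_all add: matrix_vector_mult_diff_distrib vec.scale Rp R x s_def row_col_linear vector_ssub_ldistrib vector_smult_assoc mult.commute)
  then have ps: "p = s *s x" by simp
  have qt: "q = t *s u m"
  proof (rule row_eq_on_basis)
    fix j
    have "of_real \<zeta> * row_col q (v j) = al j * row_col q (v j)"
      using row_col_mult[of q G "v j"] unfolding qG v_eig row_col_linear .
    moreover have "al j \<noteq> of_real \<zeta>" if "j \<noteq> m" using that al_inj al_m by (metis injD)
    ultimately show "row_col q (v j) = row_col (t *s u m) (v j)"
      by (auto simp: row_col_linear u_v t_def)
  qed
  have "p \<noteq> 0" "q \<noteq> 0" using x0 u_nz[of m] by (auto simp: vec_eq_iff p_def q_def)
  then have st0: "t * s \<noteq> 0" using ps qt by auto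
  have nn: "0 \<le> (N_real *v modulus x) $ a" for a
    by (rule matrix_vector_nonneg) (auto simp: N_real_nonneg)
  have Np: "(N *v p) $ a = of_real ((N_real *v modulus x) $ a)" for a
    by (simp add: N_real p_def matrix_vector_mult_def)
  define k where "k = (\<Sum>a\<in>UNIV. modulus (u m) $ a * (N_real *v modulus x) $ a)"
  have k0: "0 \<le> k" unfolding k_def using nn by (auto intro!: sum_nonneg)
  have "t * s = row_col q (N *v p)"
    unfolding qt ps by (simp add: row_col_linear vec.scale x)
  also have "\<dots> = of_real k"
    by (simp add: k_def row_col_def Np) (simp add: q_def)
  finally have k: "t * s = of_real k" .
  have "(N *v x) $ a * u m $ b = ((N *v p) $ a * q $ b) / (t * s)"
    using st0 unfolding qt ps by (simp add: vec.scale)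
  also have "\<dots> = of_real ((N_real *v modulus x) $ a * modulus (u m) $ b / k)"
    by (simp add: Np k) (simp add: q_def)
  also have "\<dots> \<in> \<real>\<^sub>\<ge>\<^sub>0"
    using nn[of a] k0 by simp
  finally show ?thesis by (simp add: outer_def)
qed

end

section \<open>The branch point\<close>

text \<open>Describes the sector without \<open>Arg\<close>, in a form that is visibly open and
  suits estimates along segments.\<close>

lemma Re_less_iff_Arg:
  assumes "w \<noteq> 0" "0 \<le> th" "th \<le> pi"
  shows "th < \<bar>Arg w\<bar> \<longleftrightarrow> Re w < cos th * cmod w"
proof -
  have "Re w = cmod w * cos \<bar>Arg w\<bar>"
    using assms(1) cos_Arg[of w] by simp
  moreover have "th < \<bar>Arg w\<bar> \<longleftrightarrow> cos \<bar>Arg w\<bar> < cos th"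
    using assms Arg_bounded[of w] by (subst cos_mono_less_eq) auto
  ultimately show ?thesis using assms(1) by (simp add: mult.commute)
qed

text \<open>Star-shaped about \<open>?p\<close>, to the left of \<open>c\<close>: on the segment to
  \<open>?p\<close>, subtracting \<open>s\<close> from a multiple of \<open>z - c\<close> lowers the
  real part by \<open>s\<close> and the modulus by at most \<open>s\<close>, and
  \<open>k \<le> 1\<close>.\<close>

lemma connected_sector:
  fixes c :: complex
  assumes k: "0 \<le> k" "k \<le> 1" and d: "0 < d"
  shows "connected {z. cmod (z - c) < d \<and> Re (z - c) < k * cmod (z - c)}" (is "connected ?W")
proof (rule starlike_imp_connected)
  let ?p = "c - of_real (d / 2)"
  have "- (d / 2) < 0" "0 \<le> k * (d / 2)" using k d by simp_all
  then have p: "?p \<in> ?W" using d by simp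
  have "closed_segment ?p z \<subseteq> ?W" if z: "z \<in> ?W" for z
  proof
    fix x assume x: "x \<in> closed_segment ?p z"
    have pz: "?p \<in> ball c d" "z \<in> ball c d" using p z by (auto simp: dist_norm norm_minus_commute)
    then have xb: "x \<in> ball c d"
      using closed_segment_subset[OF pz convex_ball] x by blast
    obtain t where t: "0 \<le> t" "t \<le> 1" "x = (1 - t) *\<^sub>R ?p + t *\<^sub>R z"
      using x by (auto simp: closed_segment_def)
    define s where "s = (1 - t) * (d / 2)"
    have s: "0 \<le> s" using t d by (simp add: s_def)
    have xc: "x - c = t *\<^sub>R (z - c) - of_real s"
      by (simp add: t(3) s_def algebra_simps scaleR_conv_of_real)
    have "Re (x - c) < k * cmod (x - c)"
    proof (cases "t = 0")
      case True
      then show ?thesis using t(3) p by simp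
    next
      case False
      have "Re (x - c) = t * Re (z - c) - s" by (simp add: xc)
      also have "\<dots> < t * (k * cmod (z - c)) - s"
        using z False t(1) by simp
      also have "\<dots> \<le> k * cmod (x - c)"
      proof -
        have "t * cmod (z - c) = cmod ((x - c) + of_real s)" using t(1) by (simp add: xc)
        also have "\<dots> \<le> cmod (x - c) + s" using norm_triangle_ineq[of "x - c" "of_real s"] s by simp
        finally have "k * (t * cmod (z - c)) \<le> k * (cmod (x - c) + s)"
          by (rule mult_left_mono[OF _ k(1)])
        also have "\<dots> \<le> k * cmod (x - c) + s"
          using mult_right_mono[OF k(2) s] by (simp add: distrib_left)
        finally show ?thesis by (simp add: mult.left_commute)
      qed
      finally show ?thesis .
    qed
    then show "x \<in> ?W" using xb by (simp add: dist_norm norm_minus_commute)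
  qed
  then show "starlike ?W" unfolding starlike_def using p by blast
qed

text \<open>The circle \<open>|z| = r\<close> enters the sector and accumulates there, so values on the circle
  determine the continuation.\<close>

lemma sector_continuation:
  assumes r: "0 < r" and e: "0 < e" and th: "0 \<le> th" "th < pi / 2" and d: "0 < d"
    and F: "F holomorphic_on Delta_tilde r e th \<inter> ball (of_real r) d"
    and g: "g analytic_on {0}"
    and ev: "\<forall>\<^sub>F z in nhds (of_real r). cmod z = r \<longrightarrow> z \<in> Delta_tilde r e th \<inter> ball (of_real r) d \<longrightarrow>
               F z = g (csqrt (of_real r - z))"
  shows "\<forall>\<^sub>F z in at (of_real r) within Delta_tilde r e th. F z = g (csqrt (of_real r - z))"
proof -
  obtain \<rho> where \<rho>: "0 < \<rho>" "g holomorphic_on ball 0 \<rho>" using g by (auto simp: analytic_at_ball)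
  obtain \<delta>\<^sub>0 where \<delta>\<^sub>0: "0 < \<delta>\<^sub>0" and ev': "\<And>z. dist z (of_real r) < \<delta>\<^sub>0 \<Longrightarrow> cmod z = r \<Longrightarrow>
      z \<in> Delta_tilde r e th \<inter> ball (of_real r) d \<Longrightarrow> F z = g (csqrt (of_real r - z))"
    using ev unfolding eventually_nhds_metric by blast
  \<comment> \<open>\<open>\<delta>\<^sub>0\<close> is for the identity on the circle,
    \<open>e\<close> and \<open>d\<close> for the domain of \<open>F\<close>, and
    \<open>\<rho>\<^sup>2\<close> so that \<open>csqrt\<close> maps into the disc where
    \<open>g\<close> is holomorphic.\<close>
  define \<delta> where "\<delta> = Min {\<delta>\<^sub>0, e, d, \<rho>\<^sup>2}"
  have \<delta>: "0 < \<delta>" "\<delta> \<le> \<delta>\<^sub>0" "\<delta> \<le> e" "\<delta> \<le> d" "\<delta> \<le> \<rho>\<^sup>2"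
    using \<delta>\<^sub>0 e d \<rho> by (simp_all add: \<delta>_def)
  define k where "k = cos th"
  have k: "0 \<le> k" "k \<le> 1" using th by (auto simp: k_def intro: cos_ge_zero)
  define W where "W = {z. cmod (z - of_real r) < \<delta> \<and> Re (z - of_real r) < k * cmod (z - of_real r)}"
  have W_Delta: "z \<in> W \<longleftrightarrow> z \<in> Delta_tilde r e th \<and> dist z (of_real r) < \<delta>" for z
  proof (cases "z = of_real r")
    case False
    have "cmod z < r + e" if "cmod (z - of_real r) < \<delta>"
      using norm_triangle_ineq[of "z - of_real r" "of_real r"] that \<delta>(3) r by simp
    moreover have "th < \<bar>Arg (z - of_real r)\<bar> \<longleftrightarrow> Re (z - of_real r) < k * cmod (z - of_real r)"
      unfolding k_def by (rule Re_less_iff_Arg) (use th False in auto)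
    ultimately show ?thesis using False by (auto simp: W_def Delta_tilde_def dist_norm)
  qed (simp add: W_def Delta_tilde_def)
  define f where "f z = F z - g (csqrt (of_real r - z))" for z
  have "f holomorphic_on W"
  proof -
    have "W \<subseteq> Delta_tilde r e th \<inter> ball (of_real r) d"
      using W_Delta \<delta>(4) by (auto simp: dist_commute)
    then have "F holomorphic_on W" by (rule holomorphic_on_subset[OF F])
    moreover have "(\<lambda>z. csqrt (of_real r - z)) holomorphic_on W"
    proof (intro holomorphic_intros)
      fix z assume z: "z \<in> W"
      show "of_real r - z \<notin> \<real>\<^sub>\<le>\<^sub>0"
      proof
        assume "of_real r - z \<in> \<real>\<^sub>\<le>\<^sub>0"
        then obtain s where s: "s \<le> 0" "of_real r - z = of_real s" by (elim nonpos_Reals_cases)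
        then have eq: "z - of_real r = of_real (- s)" by (simp add: algebra_simps)
        have "Re (z - of_real r) < k * cmod (z - of_real r)" using z by (simp only: W_def mem_Collect_eq)
        then have "- s < k * (- s)" unfolding eq using s(1) by simp
        then show False using mult_right_mono[OF k(2), of "- s"] s(1) by simp
      qed
    qed
    moreover have "csqrt (of_real r - z) \<in> ball 0 \<rho>" if "z \<in> W" for z
    proof -
      have "cmod (of_real r - z) < \<rho>\<^sup>2" using that \<delta>(5) by (simp add: W_def norm_minus_commute)
      then have "sqrt (cmod (of_real r - z)) < \<rho>" using \<rho>(1) by (metis abs_of_pos real_sqrt_abs real_sqrt_less_iff)
      then show ?thesis by simp
    qed
    then have "(\<lambda>z. csqrt (of_real r - z)) ` W \<subseteq> ball 0 \<rho>" by blast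
    ultimately have "(g \<circ> (\<lambda>z. csqrt (of_real r - z))) holomorphic_on W"
      using holomorphic_on_compose_gen[OF _ \<rho>(2)] by blast
    with \<open>F holomorphic_on W\<close> show ?thesis
      unfolding f_def o_def by (rule holomorphic_on_diff)
  qed
  moreover have "open W"
    unfolding W_def by (intro open_Collect_conj open_Collect_less continuous_intros)
  moreover have "connected W"
    unfolding W_def by (rule connected_sector[OF k \<delta>(1)])
  \<comment> \<open>The identity theorem needs a limit point inside \<open>W\<close>, and
    \<open>r\<close> is not in \<open>W\<close>. A point \<open>?c \<phi>\<close> of the arc near
    \<open>r\<close> serves instead; \<open>2 * \<phi>\<close> leaves room around it.\<close>
  moreover obtain \<phi> where \<phi>: "0 < \<phi>" "\<phi> \<le> 1 / 2" and
    near: "\<And>t. \<bar>t\<bar> < 2 * \<phi> \<Longrightarrow> dist (of_real r * cis t) (of_real r) < \<delta>"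
  proof -
    have "continuous (at 0) (\<lambda>t. of_real r * cis t)"
      unfolding isCont_def by (intro tendsto_intros)
    then obtain \<eta> where "0 < \<eta>" "\<And>t. dist t 0 < \<eta> \<Longrightarrow> dist (of_real r * cis t) (of_real r * cis 0) < \<delta>"
      using \<delta>(1) unfolding continuous_at_eps_delta by blast
    then show thesis using that[of "min \<eta> 1 / 2"] by (auto simp: dist_real_def)
  qed
  let ?c = "\<lambda>t. of_real r * cis t"
  have cW: "?c t \<in> W" if "0 < t" "t < 2 * \<phi>" for t
  proof -
    have "t < pi" using that \<phi> pi_gt3 by linarith
    then have "cos t < 1" using cos_monotone_0_pi[of 0 t] that by simp
    then have "Re (?c t - of_real r) < 0" using r by simp
    also have "0 \<le> k * cmod (?c t - of_real r)" using k by simp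
    finally show ?thesis using near[of t] that by (simp add: W_def dist_norm)
  qed
  define U where "U = {z \<in> W. cmod z = r}"
  have "?c \<phi> \<in> W" using cW[of \<phi>] \<phi> by simp
  moreover have "?c \<phi> islimpt U"
    unfolding islimpt_sequential
  proof (intro exI conjI allI)
    let ?t = "\<lambda>n. \<phi> * (1 - inverse (real (Suc (Suc n))))"
    fix n
    have q: "0 < inverse (real (Suc (Suc n)))" "inverse (real (Suc (Suc n))) < 1"
      by (simp_all add: field_simps)
    then have t: "0 < ?t n" "?t n < \<phi>" using \<phi> by simp_all
    have "\<phi> < pi" using \<phi> pi_gt3 by linarith
    then have "cos \<phi> < cos (?t n)" using t by (intro cos_monotone_0_pi) auto
    then have "cis \<phi> \<noteq> cis (?t n)" by (auto simp: complex_eq_iff)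
    moreover have "?c (?t n) \<in> W" by (rule cW[OF t(1)]) (use t(2) \<phi>(1) in linarith)
    ultimately show "?c (?t n) \<in> U - {?c \<phi>}" using r by (simp add: U_def norm_mult)
  next
    have "(\<lambda>n. \<phi> * (1 - inverse (real (Suc (Suc n))))) \<longlonglongrightarrow> \<phi> * (1 - 0)"
      by (intro tendsto_intros LIMSEQ_Suc[OF LIMSEQ_inverse_real_of_nat])
    then show "(\<lambda>n. ?c (\<phi> * (1 - inverse (real (Suc (Suc n)))))) \<longlonglongrightarrow> ?c \<phi>"
      by (intro tendsto_intros) simp
  qed
  moreover have "f z = 0" if "z \<in> U" for z
    using that W_Delta[of z] ev'[of z] \<delta> by (auto simp: U_def f_def dist_commute)
  ultimately have "f z = 0" if "z \<in> W" for z
    using analytic_continuation[of f W U "?c \<phi>" z] that by (auto simp: U_def)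
  then have "F z = g (csqrt (of_real r - z))" if "z \<in> Delta_tilde r e th" "dist z (of_real r) < \<delta>" for z
    using that W_Delta by (simp add: f_def)
  then show ?thesis
    unfolding eventually_at using \<delta>(1) by blast
qed

text \<open>\<open>csqrt (r - z)\<close> tends to 0 without taking the value 0, so the expression
  is, up to sign, the difference quotient of \<open>g\<close> at 0.\<close>

lemma sector_limit:
  assumes "0 < r" "0 < e" "0 \<le> th" "th < pi / 2" "0 < d"
    and "F holomorphic_on Delta_tilde r e th \<inter> ball (of_real r) d"
    and g: "g analytic_on {0}"
    and "\<forall>\<^sub>F z in nhds (of_real r). cmod z = r \<longrightarrow> z \<in> Delta_tilde r e th \<inter> ball (of_real r) d \<longrightarrow>
               F z = g (csqrt (of_real r - z))"
  shows "((\<lambda>z. 1 / csqrt (of_real r - z) * (g 0 - F z)) \<longlongrightarrow> - deriv g 0)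
           (at (of_real r) within Delta_tilde r e th)"
proof -
  let ?A = "at (complex_of_real r) within Delta_tilde r e th"
  have "(g has_field_derivative deriv g 0) (at 0)"
    using analytic_on_imp_differentiable_at[OF g] by (simp add: DERIV_deriv_iff_field_differentiable)
  then have "((\<lambda>t. (g (0 + t) - g 0) / t) \<longlongrightarrow> deriv g 0) (at 0)" by (simp only: DERIV_def)
  then have g': "((\<lambda>t. 1 / t * (g 0 - g t)) \<longlongrightarrow> - deriv g 0) (at 0)"
    by (auto dest: tendsto_minus simp: minus_divide_left)
  have "filterlim (\<lambda>z. csqrt (of_real r - z)) (at 0) ?A"
    unfolding filterlim_at
  proof
    have "((\<lambda>z. sqrt (cmod (of_real r - z))) \<longlongrightarrow> sqrt (cmod (of_real r - of_real r))) ?A"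
      by (intro tendsto_intros)
    then show "((\<lambda>z. csqrt (of_real r - z)) \<longlongrightarrow> 0) ?A"
      by (intro tendsto_norm_zero_cancel[of "\<lambda>z. csqrt (of_real r - z)"]) simp
    show "\<forall>\<^sub>F z in ?A. csqrt (of_real r - z) \<in> UNIV \<and> csqrt (of_real r - z) \<noteq> 0"
      by (auto simp: eventually_at intro: exI[of _ 1])
  qed
  from filterlim_compose[OF g' this]
  have "((\<lambda>z. 1 / csqrt (of_real r - z) * (g 0 - g (csqrt (of_real r - z)))) \<longlongrightarrow> - deriv g 0) ?A" .
  moreover have "\<forall>\<^sub>F z in ?A. 1 / csqrt (of_real r - z) * (g 0 - g (csqrt (of_real r - z)))
      = 1 / csqrt (of_real r - z) * (g 0 - F z)"
    using sector_continuation[OF assms] by eventually_elim simp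
  ultimately show ?thesis by (rule Lim_transform_eventually)
qed

text \<open>The branch identities hold only for arguments in the annulus, not in a full
  neighbourhood of 0 in the variable \<open>t\<close>; a null sequence of zeros is enough for a
  first derivative.\<close>

lemma deriv_zero_if_seq:
  fixes f :: "complex \<Rightarrow> complex"
  assumes "(f has_field_derivative D) (at 0)" "t \<longlonglongrightarrow> 0" "\<And>n. t n \<noteq> 0"
    "\<forall>\<^sub>F n in sequentially. f (t n) = 0" "f 0 = 0"
  shows "D = 0"
proof -
  have "((\<lambda>h. (f (0 + h) - f 0) / h) \<longlongrightarrow> D) (at 0)" using assms(1) by (simp only: DERIV_def)
  moreover have "filterlim t (at 0) sequentially"
    using assms(2,3) by (simp add: filterlim_at)
  ultimately have "(\<lambda>n. (f (0 + t n) - f 0) / t n) \<longlonglongrightarrow> D" by (rule filterlim_compose)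
  moreover have "(\<lambda>n. (f (0 + t n) - f 0) / t n) \<longlonglongrightarrow> 0"
    by (rule tendsto_eventually) (use assms(4,5) in \<open>auto elim: eventually_mono\<close>)
  ultimately show ?thesis by (rule LIMSEQ_unique)
qed

section \<open>Entrywise derivatives at the branch point\<close>

definition mat_deriv :: "(complex \<Rightarrow> complex^('n::finite)^('m::finite)) \<Rightarrow> complex^'n^'m \<Rightarrow> bool" where
  "mat_deriv F D \<longleftrightarrow> (\<forall>a b. ((\<lambda>t. F t $ a $ b) has_field_derivative D $ a $ b) (at 0))"

definition vec_deriv :: "(complex \<Rightarrow> complex^('n::finite)) \<Rightarrow> complex^'n \<Rightarrow> bool" where
  "vec_deriv F D \<longleftrightarrow> (\<forall>a. ((\<lambda>t. F t $ a) has_field_derivative D $ a) (at 0))"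

lemma mat_deriv_add: "mat_deriv F D \<Longrightarrow> mat_deriv K E \<Longrightarrow> mat_deriv (\<lambda>t. F t + K t) (D + E)"
  by (simp add: mat_deriv_def DERIV_add)

lemma mat_deriv_diff: "mat_deriv F D \<Longrightarrow> mat_deriv K E \<Longrightarrow> mat_deriv (\<lambda>t. F t - K t) (D - E)"
  by (simp add: mat_deriv_def DERIV_diff)

lemma mat_deriv_mult:
  "mat_deriv F D \<Longrightarrow> mat_deriv K E \<Longrightarrow> mat_deriv (\<lambda>t. F t ** K t) (D ** K 0 + F 0 ** E)"
  unfolding mat_deriv_def matrix_matrix_mult_def
  by (auto intro!: derivative_eq_intros simp: sum.distrib[symmetric] add.commute mult.commute)

lemma vec_deriv_diff: "vec_deriv F D \<Longrightarrow> vec_deriv K E \<Longrightarrow> vec_deriv (\<lambda>t. F t - K t) (D - E)"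
  by (simp add: vec_deriv_def DERIV_diff)

lemma vec_deriv_mult:
  "mat_deriv F D \<Longrightarrow> vec_deriv K E \<Longrightarrow> vec_deriv (\<lambda>t. F t *v K t) (D *v K 0 + F 0 *v E)"
  unfolding mat_deriv_def vec_deriv_def matrix_vector_mult_def
  by (auto intro!: derivative_eq_intros simp: sum.distrib[symmetric] add.commute mult.commute)

lemma vec_deriv_scale:
  "(c has_field_derivative d) (at 0) \<Longrightarrow> vec_deriv K E \<Longrightarrow> vec_deriv (\<lambda>t. c t *s K t) (d *s K 0 + c 0 *s E)"
  unfolding vec_deriv_def
  by (auto intro!: derivative_eq_intros simp: add.commute mult.commute)

lemma analytic_has_deriv:
  "g analytic_on {0} \<Longrightarrow> (g has_field_derivative taylor_coeff g 1) (at 0)"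
  using analytic_on_imp_differentiable_at[of g "{0}" 0]
  by (simp add: DERIV_deriv_iff_field_differentiable taylor_coeff_def)

lemma mat_deriv_analytic:
  "(\<And>a b. (\<lambda>t. F t $ a $ b) analytic_on {0}) \<Longrightarrow> mat_deriv F (taylor_coeff_mat F 1)"
  unfolding mat_deriv_def taylor_coeff_mat_def by (simp add: analytic_has_deriv del: One_nat_def)

lemma vec_deriv_analytic:
  "(\<And>a. (\<lambda>t. F t $ a) analytic_on {0}) \<Longrightarrow> vec_deriv F (\<chi> a. taylor_coeff (\<lambda>t. F t $ a) 1)"
  unfolding vec_deriv_def by (simp add: analytic_has_deriv del: One_nat_def)

lemma mat_deriv_Acol:
  assumes "r \<noteq> 0"
  shows "mat_deriv (\<lambda>t. Acol A (r - t\<^sup>2) j) 0"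
  unfolding mat_deriv_def
proof (intro allI)
  fix a b
  have inner: "((\<lambda>t. r - t\<^sup>2) has_field_derivative 0) (at 0)"
    by (auto intro!: derivative_eq_intros)
  have "((\<lambda>t. (r - t\<^sup>2) powi i) has_field_derivative 0) (at 0)" for i
  proof -
    have "((\<lambda>z. z powi i) has_field_derivative of_int i * r powi (i - 1) * 1) (at r)"
      by (rule DERIV_power_int) (use assms in auto)
    from DERIV_chain2[of "\<lambda>z. z powi i" _ "\<lambda>t. r - t\<^sup>2" 0, OF _ inner] this show ?thesis by simp
  qed
  then have "((\<lambda>t. \<Sum>i\<in>H. of_real (A i j $ a $ b) * (r - t\<^sup>2) powi i) has_field_derivative
      (\<Sum>i\<in>H. of_real (A i j $ a $ b) * 0)) (at 0)"
    by (intro DERIV_sum DERIV_cmult)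
  then show "((\<lambda>t. Acol A (r - t\<^sup>2) j $ a $ b) has_field_derivative 0 $ a $ b) (at 0)"
    by (simp add: Acol_def)
qed

lemma mat_deriv_zero_if_seq:
  assumes "mat_deriv F D" "t \<longlonglongrightarrow> 0" "\<And>n. t n \<noteq> 0" "\<forall>\<^sub>F n in sequentially. F (t n) = 0" "F 0 = 0"
  shows "D = 0"
proof -
  have "D $ a $ b = 0" for a b
    by (rule deriv_zero_if_seq[of "\<lambda>t. F t $ a $ b" _ t])
       (use assms in \<open>auto simp: mat_deriv_def elim: eventually_mono\<close>)
  then show ?thesis by (simp add: vec_eq_iff)
qed

lemma vec_deriv_zero_if_seq:
  assumes "vec_deriv F D" "t \<longlonglongrightarrow> 0" "\<And>n. t n \<noteq> 0" "\<forall>\<^sub>F n in sequentially. F (t n) = 0" "F 0 = 0"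
  shows "D = 0"
proof -
  have "D $ a = 0" for a
    by (rule deriv_zero_if_seq[of "\<lambda>t. F t $ a" _ t])
       (use assms in \<open>auto simp: vec_deriv_def elim: eventually_mono\<close>)
  then show ?thesis by (simp add: vec_eq_iff)
qed

lemma (in plane_blocks) walk_summable_on_circle:
  assumes z: "0 < cmod z" "0 < w" "chi A (cmod z) w = 1"
  shows "walk_summable (Acol A z)"
proof (rule walk_summable_dominated)
  show "walk_summable (Acol_real A (cmod z))" by (rule walk_summable_Acol_real[OF z])
  show "cmod (Acol A z j $ a $ b) \<le> Acol_real A (cmod z) j $ a $ b" if "j \<in> H" for j a b
    unfolding Acol_def Acol_real_def vec_lambda_beta
    by (rule sum_norm_le) (use that in \<open>simp add: norm_mult norm_power_int nonneg\<close>)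
qed

text \<open>Every eigenvalue is a root of the characteristic polynomial, hence a value of
  \<open>al\<close>; with as many eigenvalues as indices, no value repeats.\<close>

lemma distinct_eigenvalues_inj:
  fixes M :: "complex^('s::finite)^'s" and al :: "'s \<Rightarrow> complex"
  assumes "distinct_eigenvalues M" "\<And>x. det (mat x - M) = (\<Prod>j\<in>UNIV. x - al j)"
  shows "inj al"
proof (rule eq_card_imp_inj_on)
  have "eigenvalues M \<subseteq> range al"
  proof
    fix l assume "l \<in> eigenvalues M"
    then obtain x where x: "x \<noteq> 0" "M *v x = l *s x" by (auto simp: eigenvalues_def)
    have "mat l *v x = l *s x"
      by (simp add: vec_eq_iff mat_def matrix_vector_mult_def if_distrib[of "\<lambda>c. c * _"] cong: if_cong)
    then have "(mat l - M) *v x = 0" using x by (simp add: matrix_vector_mult_diff_rdistrib)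
    then have "\<not> invertible (mat l - M)"
      using x(1) matrix_left_invertible_ker[of "mat l - M"] by (auto simp: invertible_left_inverse)
    then have "(\<Prod>j\<in>UNIV. l - al j) = 0" using assms(2) by (simp add: invertible_det_nz)
    then obtain j where "l - al j = 0" using prod_zero_iff[of UNIV "\<lambda>j. l - al j"] by auto
    then show "l \<in> range al" by simp
  qed
  then have "card (eigenvalues M) \<le> card (range al)" by (intro card_mono) auto
  then show "card (range al) = card (UNIV :: 's set)"
    using assms(1) card_image_le[of UNIV al] by (simp add: distinct_eigenvalues_def)
qed simp

theorem proposition5p6:
  fixes A A1 A2 A0 :: "int \<Rightarrow> int \<Rightarrow> real^('s::finite)^'s"
    and nu :: "nat \<times> nat \<times> 's \<Rightarrow> real"
    and xi1 xi2 :: real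
    and m :: 's
    and al :: "'s \<Rightarrow> complex \<Rightarrow> complex"
    and v :: "'s \<Rightarrow> complex \<Rightarrow> complex^'s"
    and alt :: "complex \<Rightarrow> complex"
    and vt :: "complex \<Rightarrow> complex^'s"
    and Gt :: "complex \<Rightarrow> complex^'s^'s"
  assumes blocks: "qbd_blocks A A1 A2 A0"
    and chain: "irreducible_aperiodic (quarter_chain A A1 A2 A0)"
    and plane: "irreducible_aperiodic (plane_chain A)"
    and half1: "irreducible_aperiodic (half_plane_chain A A1)"
    and half2: "irreducible_aperiodic (half_plane_chain (swap A) (swap A2))"
    and rate1: "kirreducible (rate_matrix A A1 A2 A0)"
    and rate2: "kirreducible (rate_matrix (swap A) (swap A2) (swap A1) (swap A0))"
    and drift: "drift_conditions A A1 A2"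
    and nu: "is_stationary (quarter_chain A A1 A2 A0) nu"
    and xi1: "\<And>j k. (\<lambda>n. - (1 / real n) * ln (nu (n, j, k))) \<longlonglongrightarrow> xi1"
    and xi2: "\<And>i k. (\<lambda>n. - (1 / real n) * ln (nu (i, n, k))) \<longlonglongrightarrow> xi2"
    and dist1: "distinct_eigenvalues (G1 A (of_real (exp xi1)))"
    and dist2: "distinct_eigenvalues (G2 A (of_real (exp xi2)))"
    and r1: "exp xi1 = zup A"
    and eig: "eigen_data A m al v"
    and branch: "branch_data A m al v alt vt Gt"
    and neg: "taylor_coeff alt 1 \<in> \<real>" "Re (taylor_coeff alt 1) < 0"
  shows "let r = complex_of_real (zup A);
             u = left_eigvec v m r;
             L = - taylor_coeff_mat Gt 1
         in (\<forall>e th F. 0 < e \<and> 0 \<le> th \<and> th < pi / 2 \<and> continues_G1 A e th F \<longrightarrow>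
               ((\<lambda>z. mscale (1 / csqrt (r - z)) (G1 A r - F z)) \<longlongrightarrow> L)
                 (at r within Delta_tilde (zup A) e th)) \<and>
            (\<exists>!x. normalised_R1_eigvec A u (zup A) x) \<and>
            (\<forall>x. normalised_R1_eigvec A u (zup A) x \<longrightarrow>
               L = - mscale (taylor_coeff alt 1) (outer (N1 A r *v x) u)) \<and>
            (\<forall>a b. L $ a $ b \<in> \<real>\<^sub>\<ge>\<^sub>0) \<and> L \<noteq> 0"
proof -
  let ?r = "complex_of_real (zup A)"
  let ?D = "taylor_coeff_mat Gt 1" and ?d = "taylor_coeff alt 1"
  interpret plane_blocks A
    using blocks plane by unfold_locales (auto simp: qbd_blocks_def irreducible_aperiodic_def)
  obtain \<zeta> where \<zeta>: "0 < \<zeta>" "chi A (zup A) \<zeta> = 1" "zeta_low A (zup A) = \<zeta>" "zeta_up A (zup A) = \<zeta>"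
    by (rule zeta_zup)
  have circle: "z \<in> annulus A" if "cmod z = zup A" for z
    using that zlow_le_zup by (simp add: annulus_def)
  have r_in: "?r \<in> annulus A" using zup_pos by (intro circle) simp
  interpret critical_point A "zup A" \<zeta> "\<lambda>j. al j ?r" "\<lambda>j. v j ?r" m
  proof
    show "0 < zup A" by (rule zup_pos)
    show "0 < \<zeta>" "chi A (zup A) \<zeta> = 1" by (rule \<zeta>)+
    show "inj (\<lambda>j. al j ?r)"
      by (rule distinct_eigenvalues_inj[OF dist1[unfolded r1]]) (use eig r_in in \<open>auto simp: eigen_data_def\<close>)
    show "al m ?r = of_real \<zeta>"
      using eig zlow_le_zup \<zeta>(3) by (simp add: eigen_data_def)
    show "v j ?r \<noteq> 0" "G1 A ?r *v v j ?r = al j ?r *s v j ?r" for j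
      using eig r_in by (auto simp: eigen_data_def)
  qed
  have u_eq: "left_eigvec v m ?r = u m"
    by (simp add: left_eigvec_def Vmat_def u_def V_def)

  have ev: "\<forall>\<^sub>F z in nhds ?r. z \<in> annulus A \<longrightarrow>
      al m z = alt (csqrt (?r - z)) \<and> v m z = vt (csqrt (?r - z)) \<and> G1 A z = Gt (csqrt (?r - z))"
    and alt_an: "alt analytic_on {0}" and vt_an: "\<And>a. (\<lambda>t. vt t $ a) analytic_on {0}"
    and Gt_an: "\<And>a b. (\<lambda>t. Gt t $ a $ b) analytic_on {0}"
    using branch by (auto simp: branch_data_def Let_def)
  \<comment> \<open>\<open>nhds\<close> includes the centre, where
    \<open>csqrt 0 = 0\<close>.\<close>
  have at_r: "alt 0 = of_real \<zeta>" "vt 0 = v m ?r" "Gt 0 = G1 A ?r"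
    using eventually_nhds_x_imp_x[OF ev] r_in al_m by simp_all

  \<comment> \<open>Points of the circle tending to \<open>r\<close>. They lie in the annulus, so
    the branch expansions apply there, and their parameters \<open>t n\<close> form a null sequence
    without zeros.\<close>
  define z where "z n = ?r * cis (inverse (real (Suc n)))" for n
  define t where "t n = csqrt (?r - z n)" for n
  have z_norm: "cmod (z n) = zup A" for n using zup_pos by (simp add: z_def norm_mult)
  have z_lim: "z \<longlonglongrightarrow> ?r"
  proof -
    have "(\<lambda>n. ?r * cis (inverse (real (Suc n)))) \<longlonglongrightarrow> ?r * cis 0"
      by (intro tendsto_intros LIMSEQ_inverse_real_of_nat)
    then show ?thesis by (simp add: z_def[abs_def])
  qed
  have z_ne: "z n \<noteq> ?r" for n
  proof
    assume "z n = ?r"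
    then have "cos (inverse (real (Suc n))) = 1" using zup_pos by (simp add: z_def complex_eq_iff)
    moreover have "inverse (real (Suc n)) \<le> 1" by (simp add: field_simps)
    then have "inverse (real (Suc n)) < pi" using pi_gt3 by linarith
    then have "cos (inverse (real (Suc n))) < cos 0" by (intro cos_monotone_0_pi) auto
    ultimately show False by simp
  qed
  have t_ne: "t n \<noteq> 0" for n using z_ne[of n] by (simp add: t_def)
  have t_sq: "?r - (t n)\<^sup>2 = z n" for n by (simp add: t_def)
  have t_lim: "t \<longlonglongrightarrow> 0"
  proof -
    have "(\<lambda>n. sqrt (cmod (?r - z n))) \<longlonglongrightarrow> sqrt (cmod (?r - ?r))"
      by (intro tendsto_intros z_lim)
    then show ?thesis by (intro tendsto_norm_zero_cancel[of t]) (simp add: t_def)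
  qed
  have ev_seq: "\<forall>\<^sub>F n in sequentially. al m (z n) = alt (t n) \<and> v m (z n) = vt (t n) \<and> G1 A (z n) = Gt (t n)"
    using eventually_compose_filterlim[OF ev z_lim]
    by eventually_elim (use circle z_norm in \<open>auto simp: t_def\<close>)

  have D_eq: "?D = B 0 ** ?D + B 1 ** (?D ** G + G ** ?D)"
  proof -
    let ?B = "\<lambda>j t. Acol A (?r - t\<^sup>2) j"
    \<comment> \<open>The defect of the quadratic equation in the variable \<open>t\<close>; it
      vanishes at 0 and eventually along \<open>t n\<close>, hence so does its derivative at
      0.\<close>
    let ?F = "\<lambda>t. Gt t - (?B (-1) t + ?B 0 t ** Gt t + ?B 1 t ** Gt t ** Gt t)"
    have r0: "?r \<noteq> 0" using zup_pos by simp
    note dB = mat_deriv_Acol[OF r0, of A] and dG = mat_deriv_analytic[OF Gt_an]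
    have "mat_deriv ?F (?D - (0 + (0 ** Gt 0 + ?B 0 0 ** ?D) +
        ((0 ** Gt 0 + ?B 1 0 ** ?D) ** Gt 0 + ?B 1 0 ** Gt 0 ** ?D)))"
      by (intro mat_deriv_diff mat_deriv_add mat_deriv_mult dB dG)
    then have "?D - (0 + (0 ** Gt 0 + ?B 0 0 ** ?D) +
        ((0 ** Gt 0 + ?B 1 0 ** ?D) ** Gt 0 + ?B 1 0 ** Gt 0 ** ?D)) = 0"
    proof (rule mat_deriv_zero_if_seq[OF _ t_lim t_ne])
      show "\<forall>\<^sub>F n in sequentially. ?F (t n) = 0"
        using ev_seq
      proof eventually_elim
        case (elim n)
        interpret c: excursion_sums A "z n"
          by unfold_locales (use walk_summable_on_circle[of "z n" \<zeta>] zup_pos \<zeta> z_norm in simp)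
        show ?case using c.G_eq elim by (simp add: t_sq)
      qed
      show "?F 0 = 0" using G_eq by (simp add: at_r)
    qed
    then show ?thesis by (simp add: at_r matrix_add_ldistrib matrix_mul_assoc)
  qed

  have d_eq: "row_col (u m) (?D *v v m ?r) = ?d"
  proof -
    let ?w = "\<chi> a. taylor_coeff (\<lambda>t. vt t $ a) 1"
    let ?f = "\<lambda>t. Gt t *v vt t - alt t *s vt t"
    have "vec_deriv ?f ((?D *v vt 0 + Gt 0 *v ?w) - (?d *s vt 0 + alt 0 *s ?w))"
      by (intro vec_deriv_diff vec_deriv_mult vec_deriv_scale mat_deriv_analytic vec_deriv_analytic
          analytic_has_deriv Gt_an vt_an alt_an)
    then have "(?D *v vt 0 + Gt 0 *v ?w) - (?d *s vt 0 + alt 0 *s ?w) = 0"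
    proof (rule vec_deriv_zero_if_seq[OF _ t_lim t_ne])
      show "\<forall>\<^sub>F n in sequentially. ?f (t n) = 0"
        using ev_seq
      proof eventually_elim
        case (elim n)
        have "G1 A (z n) *v v m (z n) = al m (z n) *s v m (z n)"
          using eig circle[OF z_norm] by (auto simp: eigen_data_def)
        then show ?case using elim by simp
      qed
      show "?f 0 = 0" using v_eig[of m] al_m by (simp add: at_r)
    qed
    then have "?D *v v m ?r = (?d *s v m ?r + of_real \<zeta> *s ?w) - G *v ?w"
      by (simp add: at_r algebra_simps)
    \<comment> \<open>The unknown derivative \<open>?w\<close> of the eigenvector drops out under
      \<open>u m\<close>, since \<open>u m\<close> is a left eigenvector of \<open>G\<close> for
      \<open>\<zeta>\<close>.\<close>
    then have "row_col (u m) (?D *v v m ?r)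
        = ?d * row_col (u m) (v m ?r) + of_real \<zeta> * row_col (u m) ?w - row_col (u m v* G) ?w"
      by (simp add: row_col_linear row_col_mult row_col_add)
    then show ?thesis by (simp add: u_G row_col_linear u_v)
  qed

  have d0: "?d \<noteq> 0" using neg by auto
  obtain c where c: "?d = of_real c" "c < 0" using neg by (auto elim: Reals_cases)
  have norm_iff: "normalised_R1_eigvec A (u m) (zup A) x \<longleftrightarrow>
      R *v x = of_real (inverse \<zeta>) *s x \<and> row_col (u m) (N *v x) = 1" for x
    by (simp add: normalised_R1_eigvec_def \<zeta>(4))
  obtain x where x: "R *v x = of_real (inverse \<zeta>) *s x" "row_col (u m) (N *v x) = 1"
    and D: "?D = mscale ?d (outer (N *v x) (u m))"
    using derivative_structure[OF D_eq d_eq d0] by blast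
  have uniq: "x' = x" if "R *v x' = of_real (inverse \<zeta>) *s x'" "row_col (u m) (N *v x') = 1" for x'
  proof -
    have "x' - x = 0"
      by (rule R_eigvec_zero)
         (simp_all only: matrix_vector_mult_diff_distrib that x row_col_linear vector_ssub_ldistrib diff_self)
    then show ?thesis by simp
  qed

  have lim: "((\<lambda>z. mscale (1 / csqrt (?r - z)) (G1 A ?r - F z)) \<longlongrightarrow> - ?D)
      (at ?r within Delta_tilde (zup A) e th)"
    if e: "0 < e" and th: "0 \<le> th" "th < pi / 2" and cont: "continues_G1 A e th F" for e th F
  proof -
    obtain d where d: "0 < d"
      and hol: "\<And>a b. (\<lambda>z. F z $ a $ b) holomorphic_on Delta_tilde (zup A) e th \<inter> ball ?r d"
      and F_eq: "\<And>z. z \<in> Delta_tilde (zup A) e th \<inter> ball ?r d \<Longrightarrow> z \<in> annulus A \<Longrightarrow> F z = G1 A z"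
      using cont by (auto simp: continues_G1_def Let_def)
    have "((\<lambda>z. 1 / csqrt (?r - z) * (Gt 0 $ a $ b - F z $ a $ b)) \<longlongrightarrow> - deriv (\<lambda>t. Gt t $ a $ b) 0)
        (at ?r within Delta_tilde (zup A) e th)" for a b
    proof (rule sector_limit[OF zup_pos e th d hol Gt_an])
      show "\<forall>\<^sub>F z in nhds ?r. cmod z = zup A \<longrightarrow> z \<in> Delta_tilde (zup A) e th \<inter> ball ?r d \<longrightarrow>
          F z $ a $ b = Gt (csqrt (?r - z)) $ a $ b"
        using ev by eventually_elim (simp add: circle F_eq)
    qed
    then show ?thesis
      by (intro vec_tendstoI) (simp add: mscale_def taylor_coeff_mat_def taylor_coeff_def at_r)
  qed

  have L: "- ?D = mscale (of_real (- c)) (outer (N *v x) (u m))"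
    by (subst D) (simp add: c mscale_def vec_eq_iff del: One_nat_def)
  have nonneg: "(- ?D) $ a $ b \<in> \<real>\<^sub>\<ge>\<^sub>0" for a b
  proof -
    have "of_real (- c) * outer (N *v x) (u m) $ a $ b \<in> \<real>\<^sub>\<ge>\<^sub>0"
      by (rule nonneg_Reals_mult_I) (use c outer_nonneg[OF x] in auto)
    then show ?thesis unfolding L by (simp add: mscale_def)
  qed
  have "- ?D \<noteq> 0"
  proof
    assume "- ?D = 0"
    then have "row_col (u m) (?D *v v m ?r) = 0" by (simp add: row_col_linear)
    then show False using d_eq d0 by simp
  qed
  moreover have "\<exists>!x. normalised_R1_eigvec A (u m) (zup A) x"
    using x uniq unfolding norm_iff by blast
  moreover have "- ?D = - mscale ?d (outer (N *v x') (u m))"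
    if "normalised_R1_eigvec A (u m) (zup A) x'" for x'
    using uniq[of x'] that D by (simp add: norm_iff)
  ultimately show ?thesis
    unfolding Let_def u_eq using lim nonneg by blast
qed

end
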